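(* Let $k\ge 1$ and let $f:(S^d)^k\to\mathbb R$ be a bounded measurable function. Then, as $n\to\infty$, \[ \mathbb E(L_nf)=\Big(\frac{k_n}{s_d}\Big)^k\int_{(S^d)^k} f(x_1,\dots,x_k)\,dx_1\cdots dx_k-\frac{k_n^{k-1}}{s_d^k}\sum_{1\le i<j\le k}\frac{2^{d-1}}{\Gamma(d)\pi}\Gamma\Big(\frac d2\Big)^2\int_{S^d}\int_{S^d}\frac{f_{i,j}(x,y)}{\sin^{d-1}(\arccos(x\cdot y))}\,dx\,dy+o\big(n^{(d-1)(k-1)}\big). \]
   Context: Let $d\ge2$ and let $S^d\subset\mathbb R^{d+1}$ be the unit sphere with the standard round metric; $dx$ denotes its volume (surface) measure and $s_d=2\pi^{(d+1)/2}/\Gamma(\frac{d+1}2)$ its total area. For $n\ge0$ let $\mathcal H_n(S^d)$ be the space of spherical harmonics of degree $n$ (the eigenspace of the Laplacian with eigenvalue $-n(n+d-1)$), of dimension $k_n=\frac{2n+d-1}{n+d-1}\binom{n+d-1}{d-1}$ (so $k_n\sim 2n^{d-1}/\Gamma(d)$). Let $K_n(x,y)$ be the integral kernel of the orthogonal projection $L^2(S^d)\to\mathcal H_n(S^d)$; equivalently $K_n(x,y)=\frac{k_n}{s_d}P_n(x\cdot y)$, where $P_n$ is the Legendre (normalized Gegenbauer) polynomial of degree $n$ in dimension $d+1$ with $P_n(1)=1$. Let $\Phi_n$ be the determinantal point process on $S^d$ with kernel $K_n$ with respect to $dx$, i.e. its $j$-point correlation functions are $\rho_j(x_1,\dots,x_j)=\det(K_n(x_a,x_b))_{1\le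 a,b\le j}$ (it has exactly $k_n$ points a.s.). For $f:(S^d)^k\to\mathbb R$, $L_nf=\sum f(x_1,\dots,x_k)$, the sum running over all ordered $k$-tuples $(x_1,\dots,x_k)$ of pairwise distinct points of $\Phi_n$. For $1\le i<j\le k$, the $(i,j)$-margin $f_{i,j}(x_i,x_j)$ is the integral of $f(x_1,\dots,x_k)$ over all variables except $x_i,x_j$ with respect to $dx$ on each copy of $S^d$. *)

theory Defs
  imports "HOL-Analysis.Analysis" "HOL-Library.Landau_Symbols"
begin

text \<open>The sphere S^d is the unit sphere of the Euclidean space real^'n, with CARD('n) = d + 1.
  Its surface (volume) measure is the cone measure:
  sigma(A) = (d+1) * Lebesgue measure of the cone {t x | x in A, 0 < t <= 1}.\<close>

definition sph_cone :: "(real^'n) set \<Rightarrow> (real^'n) set" where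
  "sph_cone A = {t *\<^sub>R x | t x. x \<in> A \<and> 0 < t \<and> t \<le> 1}"

definition sph_measure :: "(real^'n) measure" where
  "sph_measure = measure_of (sphere 0 1) (sets (restrict_space borel (sphere (0::real^'n) 1)))
     (\<lambda>A. ennreal (real CARD('n)) * emeasure lborel (sph_cone A))"

definition s_area :: "nat \<Rightarrow> real" where
  "s_area d = 2 * pi powr ((real d + 1) / 2) / Gamma ((real d + 1) / 2)"

text \<open>Dimension k_n of the space of spherical harmonics of degree n on S^d.\<close>
definition kdim :: "nat \<Rightarrow> nat \<Rightarrow> real" where
  "kdim d n = (2 * real n + real d - 1) / (real n + real d - 1) * real ((n + d - 1) choose (d - 1))"

definition gegenbauer :: "real \<Rightarrow> nat \<Rightarrow> real \<Rightarrow> real" where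
  "gegenbauer lam n t = (\<Sum>j\<le>n div 2. (-1)^j * pochhammer lam (n - j)
       / (fact j * fact (n - 2*j)) * (2*t)^(n - 2*j))"

definition legendre :: "nat \<Rightarrow> nat \<Rightarrow> real \<Rightarrow> real" where
  "legendre d n t = gegenbauer ((real d - 1) / 2) n t / gegenbauer ((real d - 1) / 2) n 1"

definition Kproj :: "nat \<Rightarrow> real^'n \<Rightarrow> real^'n \<Rightarrow> real" where
  "Kproj n x y = kdim (CARD('n) - 1) n / s_area (CARD('n) - 1)
      * legendre (CARD('n) - 1) n (x \<bullet> y)"

definition corr :: "nat \<Rightarrow> nat \<Rightarrow> (nat \<Rightarrow> real^'n) \<Rightarrow> real" where
  "corr n j x = (\<Sum>p | p permutes {..<j}. of_int (sign p) * (\<Prod>a<j. Kproj n (x a) (x (p a))))"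

text \<open>E(L_n f) for the determinantal process Phi_n with kernel K_n: by definition of the
  k-point correlation function rho_k (factorial moment density), the expectation of the sum of f
  over ordered k-tuples of distinct points equals the integral of f * rho_k over (S^d)^k.\<close>
definition ELn :: "nat \<Rightarrow> nat \<Rightarrow> ((nat \<Rightarrow> real^'n) \<Rightarrow> real) \<Rightarrow> real" where
  "ELn k n f = (\<integral>x. f x * corr n k x \<partial>(PiM {..<k} (\<lambda>_. sph_measure)))"

definition margin :: "nat \<Rightarrow> ((nat \<Rightarrow> real^'n) \<Rightarrow> real) \<Rightarrow> nat \<Rightarrow> nat \<Rightarrow> real^'n \<Rightarrow> real^'n \<Rightarrow> real" where
  "margin k f i j x y = (\<integral>z. f (z(i := x, j := y)) \<partial>(PiM ({..<k} - {i, j}) (\<lambda>_. sph_measure)))"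

end

theory Submission
  imports Defs "HOL-Probability.Characteristic_Functions" "HOL-Real_Asymp.Real_Asymp"
begin

text \<open>
  Expand the determinant over permutations. The identity gives the first term exactly. Since
  \<open>K\<^sub>n(x, y) = k\<^sub>n / s\<^sub>d P\<^sub>n(x \<bullet> y)\<close>, a transposition \<open>(i j)\<close> contributes the integral of
  \<open>f P\<^sub>n(x\<^sub>i \<bullet> x\<^sub>j)\<^sup>2\<close>, and every other permutation contains a factor with a third moved point, which makes
  it negligible. With \<open>x \<bullet> y = cos \<theta>\<close>, everything reduces to two facts about
  \<open>v\<^sub>n(\<theta>) = k\<^sub>n sin\<^sup>d\<^sup>-\<^sup>1 \<theta> P\<^sub>n(cos \<theta>)\<^sup>2\<close>: it is bounded uniformly in \<open>n\<close> and \<open>\<theta>\<close>, and it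
  converges weakly to a constant.

  Both follow from the equation \<open>u'' = - (N\<^sup>2 + c / sin\<^sup>2 \<theta>) u\<close> satisfied by
  \<open>u = sin\<^sup>\<lambda> \<theta> P\<^sub>n(cos \<theta>)\<close>, where \<open>\<lambda> = (d - 1) / 2\<close> and \<open>N = n + \<lambda>\<close>: a Gronwall argument shows that the
  energy \<open>N\<^sup>2 u\<^sup>2 + u'\<^sup>2\<close> differs from its value at \<open>\<pi>/2\<close> by a factor between
  \<open>exp (\<plusminus> |c cot \<theta>| / N)\<close>, that value is explicit, and the two halves of the energy are asymptotically
  equal in mean. Weak convergence on intervals extends to integrable functions, and the angle
  between two random points of the sphere has an absolutely continuous distribution, so it can be
  integrated against \<open>f / sin\<^sup>d\<^sup>-\<^sup>1\<close>.
\<close>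

section \<open>Gegenbauer polynomials\<close>

text \<open>The classical route through pointwise asymptotics of P_n would need a phase and errors
  uniform up to the poles. Only quadratic averages of P_n matter here, and for these the energy
  suffices: its value at the equator fixes the amplitude, and the phase never appears. The v_n
  themselves keep oscillating, which is why the limit is taken weakly. The size of the admissible
  error dictates the rest: (k_n / s_d)^k times an integral known up to o(1 / k_n) is
  o(n^((d-1)(k-1))), so every term except that of the identity is studied after multiplication by
  k_n. Two factors P_n absorb this k_n at the price of the weight 1 / sin^(d-1), which is integrable
  because the poles have codimension d in the sphere. The constant is the product of 2 / Gamma d,
  the limit of k_n / N^(d-1), of the equatorial energy limit 2^(d-1) Gamma(d/2)^2 / pi, and of 1/2
  from equipartition.\<close>

definition gegenbauer_coeff :: "real \<Rightarrow> nat \<Rightarrow> nat \<Rightarrow> real" where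
  "gegenbauer_coeff lam n j = (-1)^j * pochhammer lam (n - j) / (fact j * fact (n - 2*j))"

text \<open>Formal derivatives with exponents in truncated subtraction: wherever an exponent is cut
  off at 0, the factor \<open>n - 2*j\<close> (for \<open>gegenbauer2\<close> possibly
  \<open>n - 2*j - 1\<close>) vanishes.\<close>

definition gegenbauer1 :: "real \<Rightarrow> nat \<Rightarrow> real \<Rightarrow> real" where
  "gegenbauer1 lam n t =
     (\<Sum>j\<le>n div 2. gegenbauer_coeff lam n j * (2 * real (n - 2*j)) * (2*t)^(n - 2*j - 1))"

definition gegenbauer2 :: "real \<Rightarrow> nat \<Rightarrow> real \<Rightarrow> real" where
  "gegenbauer2 lam n t =
     (\<Sum>j\<le>n div 2. gegenbauer_coeff lam n j * (4 * real (n - 2*j) * real (n - 2*j - 1)) * (2*t)^(n - 2*j - 2))"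

lemma gegenbauer_eq: "gegenbauer lam n t = (\<Sum>j\<le>n div 2. gegenbauer_coeff lam n j * (2*t)^(n - 2*j))"
  unfolding gegenbauer_def gegenbauer_coeff_def by simp

lemma DERIV_scaled_power:
  "((\<lambda>t::real. c * (2*t)^m) has_real_derivative c * (2 * real m) * (2*t)^(m - 1)) (at t)"
  by (rule DERIV_cong[OF DERIV_cmult[OF DERIV_power[OF DERIV_cmult[OF DERIV_ident]]]])
    (simp del: power_mult_distrib)

lemma DERIV_gegenbauer: "(gegenbauer lam n has_real_derivative gegenbauer1 lam n t) (at t)"
proof -
  have "((\<lambda>t. \<Sum>j\<le>n div 2. gegenbauer_coeff lam n j * (2*t)^(n - 2*j)) has_real_derivative
     (\<Sum>j\<le>n div 2. gegenbauer_coeff lam n j * (2 * real (n - 2*j)) * (2*t)^(n - 2*j - 1))) (at t)"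
    by (rule DERIV_sum) (rule DERIV_scaled_power)
  then show ?thesis
    unfolding gegenbauer_eq[abs_def] gegenbauer1_def .
qed

lemma DERIV_gegenbauer1: "(gegenbauer1 lam n has_real_derivative gegenbauer2 lam n t) (at t)"
proof -
  have "((\<lambda>t. \<Sum>j\<le>n div 2. gegenbauer_coeff lam n j * (2 * real (n - 2*j)) * (2*t)^(n - 2*j - 1)) has_real_derivative
     (\<Sum>j\<le>n div 2. gegenbauer_coeff lam n j * (4 * real (n - 2*j) * real (n - 2*j - 1)) * (2*t)^(n - 2*j - 2))) (at t)"
  proof (rule DERIV_sum)
    fix j
    show "((\<lambda>t. gegenbauer_coeff lam n j * (2 * real (n - 2*j)) * (2*t)^(n - 2*j - 1)) has_real_derivative
      gegenbauer_coeff lam n j * (4 * real (n - 2*j) * real (n - 2*j - 1)) * (2*t)^(n - 2*j - 2)) (at t)"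
      by (rule DERIV_cong[OF DERIV_scaled_power])
        (simp add: numeral_2_eq_2 del: power_mult_distrib)
  qed
  then show ?thesis
    unfolding gegenbauer1_def[abs_def] gegenbauer2_def .
qed

text \<open>Equating the coefficients of \<open>t^(n - 2*j - 2)\<close> in the Gegenbauer equation
  yields precisely this relation; consecutive coefficients differ by one Pochhammer factor and a few
  factorial factors.\<close>

lemma gegenbauer_coeff_rec:
  assumes "2 * j + 2 \<le> n"
  shows "gegenbauer_coeff lam n j * (real (n - 2*j) * real (n - 2*j - 1))
     = - (real (Suc j) * (real n - real (Suc j) + lam)) * gegenbauer_coeff lam n (Suc j)"
proof -
  define m where "m = n - 2*j - 2"
  have n: "n = m + 2*j + 2" using assms by (simp add: m_def)
  define r where "r = n - Suc j"
  have *: "n - j = Suc r" "n - 2*j = Suc (Suc m)" "n - 2 * Suc j = m" "real n - real (Suc j) = real r"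
    by (auto simp: n r_def)
  have 1: "gegenbauer_coeff lam n j = (-1)^j * (pochhammer lam r * (lam + real r))
      / (fact j * (real (Suc (Suc m)) * real (Suc m) * fact m))"
    unfolding gegenbauer_coeff_def * pochhammer_Suc by simp
  have 2: "gegenbauer_coeff lam n (Suc j) = - ((-1)^j) * pochhammer lam r / (real (Suc j) * fact j * fact m)"
    unfolding gegenbauer_coeff_def *(3) r_def by simp
  have alg: "s * (P * (lam + r)) / (F * (A * B * G)) * (A * B) = - (C * (r + lam)) * (- s * P / (C * F * G))"
    if "A \<noteq> 0" "B \<noteq> 0" "C \<noteq> 0" for s P r A B C F G :: real
    using that by (cases "F = 0 \<or> G = 0") (auto simp: divide_simps)
  show ?thesis
    unfolding 1 2 unfolding * diff_Suc_1
    by (rule alg) simp_all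
qed

text \<open>The operator splits by degree: \<open>- t^2 y''\<close>, \<open>t y'\<close> and
  \<open>y\<close> preserve the degree of each monomial and combine to \<open>?H\<close>, while
  \<open>y''\<close> lowers it by two. After an index shift the two contributions cancel term by
  term.\<close>

lemma gegenbauer_ode:
  "(1 - t^2) * gegenbauer2 lam n t - (2*lam+1) * t * gegenbauer1 lam n t
     + real n * (real n + 2*lam) * gegenbauer lam n t = 0"
proof -
  let ?a = "gegenbauer_coeff lam n"
  let ?F = "\<lambda>j. ?a j * (4 * real (n - 2*j) * real (n - 2*j - 1)) * (2*t)^(n - 2*j - 2)"
  let ?H = "\<lambda>j. 4 * real j * (real n - real j + lam) * ?a j * (2*t)^(n - 2*j)"
  \<comment> \<open>With \<open>m = n - 2*j\<close> the coefficient is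
    \<open>n*(n + 2*lam) - m*(m + 2*lam)\<close>, that is \<open>4*j*(n - j + lam)\<close>.\<close>
  have trm: "- (t^2) * ?F j - (2*lam+1) * t * (?a j * (2 * real (n - 2*j)) * (2*t)^(n - 2*j - 1))
       + real n * (real n + 2*lam) * (?a j * (2*t)^(n - 2*j)) = ?H j" if "j \<le> n div 2" for j
  proof -
    define m where "m = n - 2*j"
    have n: "real n = real m + 2 * real j" using that by (auto simp: m_def)
    have 1: "t^2 * (4 * real m * real (m - 1)) * (2*t)^(m - 2) = real m * (real m - 1) * (2*t)^m"
    proof (cases "m < 2")
      case True then have "m = 0 \<or> m = 1" by auto then show ?thesis by auto
    next
      case False then obtain q where "m = q + 2" using le_Suc_ex[of 2 m] by (auto simp: add.commute)
      then show ?thesis by (simp add: power_add power2_eq_square algebra_simps)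
    qed
    have 2: "t * (2 * real m) * (2*t)^(m - 1) = real m * (2*t)^m"
      by (cases m) auto
    have "- (t^2) * ?F j = - ?a j * (t^2 * (4 * real m * real (m - 1)) * (2*t)^(m - 2))"
      by (simp add: m_def)
    moreover have "(2*lam+1) * t * (?a j * (2 * real (n - 2*j)) * (2*t)^(n - 2*j - 1)) =
      (2*lam+1) * ?a j * (t * (2 * real m) * (2*t)^(m - 1))" by (simp add: m_def)
    ultimately show ?thesis
      unfolding 1 2 m_def[symmetric] n by (simp add: algebra_simps)
  qed
  have lin: "(\<Sum>j\<le>n div 2. a * F j - b * B j + e * C j)
      = a * (\<Sum>j\<le>n div 2. F j) - b * (\<Sum>j\<le>n div 2. B j) + e * (\<Sum>j\<le>n div 2. C j)"
    for a b e :: real and F B C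
    by (simp add: sum.distrib sum_subtractf sum_distrib_left)
  have "(1 - t^2) * gegenbauer2 lam n t - (2*lam+1) * t * gegenbauer1 lam n t
     + real n * (real n + 2*lam) * gegenbauer lam n t
     = (\<Sum>j\<le>n div 2. ?F j) + (\<Sum>j\<le>n div 2. - (t^2) * ?F j - (2*lam+1) * t * (?a j * (2 * real (n - 2*j)) * (2*t)^(n - 2*j - 1))
       + real n * (real n + 2*lam) * (?a j * (2*t)^(n - 2*j)))"
    unfolding gegenbauer_eq gegenbauer1_def gegenbauer2_def
    unfolding lin by algebra
  also have "\<dots> = (\<Sum>j\<le>n div 2. ?F j) + (\<Sum>j\<le>n div 2. ?H j)"
    using trm by (intro arg_cong2[where f="(+)"] sum.cong refl) auto
  also have "(\<Sum>j\<le>n div 2. ?H j) = (\<Sum>j<n div 2. ?H (Suc j))"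
    by (subst sum.atMost_shift) simp
  \<comment> \<open>The last monomial has degree 0 or 1, so its second derivative vanishes; the term
    \<open>?H 0\<close> dropped above vanishes too.\<close>
  also have "(\<Sum>j\<le>n div 2. ?F j) = (\<Sum>j<n div 2. ?F j)"
  proof -
    have "n - 2*(n div 2) = 0 \<or> n - 2*(n div 2) - 1 = 0"
      by presburger
    then have "?F (n div 2) = 0" by (elim disjE) simp_all
    then show ?thesis unfolding lessThan_Suc_atMost[symmetric] sum.lessThan_Suc by linarith
  qed
  also have "(\<Sum>j<n div 2. ?F j) + (\<Sum>j<n div 2. ?H (Suc j)) = 0"
    unfolding sum.distrib[symmetric]
  proof (rule sum.neutral, safe)
    fix j assume "j < n div 2"
    then have j: "2 * j + 2 \<le> n" by auto
    show "?F j + ?H (Suc j) = 0"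
    proof -
      define p where "p = (2*t)^(n - 2*j - 2)"
      have "n - 2 * Suc j = n - 2*j - 2" by simp
      then have "?F j + ?H (Suc j) = 4 * p * (?a j * (real (n - 2*j) * real (n - 2*j - 1))
          + real (Suc j) * (real n - real (Suc j) + lam) * ?a (Suc j))"
        unfolding p_def[symmetric] by (simp only: p_def[symmetric]) (simp only: distrib_left distrib_right mult_ac)
      also have "\<dots> = 0" unfolding gegenbauer_coeff_rec[OF j] by (simp del: of_nat_Suc)
      finally show ?thesis .
    qed
  qed
  finally show ?thesis .
qed

text \<open>Differentiation raises \<open>lam\<close> and lowers the degree, so facts valid for all
  \<open>lam\<close> give the derivative for free: the value at 1, the parity and the value at 0 all
  use this.\<close>

lemma gegenbauer1_Suc: "gegenbauer1 lam (Suc n) t = 2 * lam * gegenbauer (lam + 1) n t"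
proof -
  have g: "gegenbauer_coeff lam (Suc n) j * real (Suc n - 2*j) = lam * gegenbauer_coeff (lam+1) n j" if "2 * j \<le> n" for j
  proof -
    have *: "Suc n - j = Suc (n - j)" "Suc n - 2*j = Suc (n - 2*j)" using that by auto
    show ?thesis unfolding gegenbauer_coeff_def * pochhammer_rec fact_Suc
      by (simp add: field_simps del: of_nat_Suc)
  qed
  have "gegenbauer1 lam (Suc n) t = (\<Sum>j\<le>n div 2. gegenbauer_coeff lam (Suc n) j * (2 * real (Suc n - 2*j)) * (2*t)^(Suc n - 2*j - 1))"
    unfolding gegenbauer1_def
  \<comment> \<open>For odd \<open>n\<close> the sum up to \<open>Suc n div 2\<close> has one more
    index, that of the constant monomial.\<close>
  proof (rule sum.mono_neutral_right)
    show "\<forall>i\<in>{..Suc n div 2} - {..n div 2}. gegenbauer_coeff lam (Suc n) i * (2 * real (Suc n - 2 * i)) * (2 * t) ^ (Suc n - 2 * i - 1) = 0"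
    proof
      fix i assume "i \<in> {..Suc n div 2} - {..n div 2}"
      then have "Suc n - 2*i = 0" by auto
      then show "gegenbauer_coeff lam (Suc n) i * (2 * real (Suc n - 2 * i)) * (2 * t) ^ (Suc n - 2 * i - 1) = 0" by simp
    qed
  qed (auto simp: div_le_mono)
  also have "\<dots> = (\<Sum>j\<le>n div 2. 2 * lam * (gegenbauer_coeff (lam+1) n j * (2*t)^(n - 2*j)))"
  proof (rule sum.cong[OF refl])
    fix j assume "j \<in> {..n div 2}"
    then have "2*j \<le> n" by auto
    then show "gegenbauer_coeff lam (Suc n) j * (2 * real (Suc n - 2*j)) * (2*t)^(Suc n - 2*j - 1) = 2 * lam * (gegenbauer_coeff (lam+1) n j * (2*t)^(n - 2*j))"
      using arg_cong[OF g[of j], of "\<lambda>x. 2 * x * (2*t)^(n - 2*j)"]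
      by (simp add: mult_ac del: power_mult_distrib of_nat_diff of_nat_Suc)
  qed
  finally show ?thesis by (simp add: gegenbauer_eq sum_distrib_left)
qed

text \<open>At \<open>t = 1\<close> the second-order term of the equation disappears, which ties the
  value to the derivative; the latter belongs to \<open>lam + 1\<close> and a smaller degree, hence
  the induction over all \<open>lam\<close>.\<close>

lemma gegenbauer_at_1:
  assumes "lam > 0"
  shows "gegenbauer lam n 1 = pochhammer (2*lam) n / fact n"
  using assms
proof (induction n arbitrary: lam)
  case 0
  then show ?case by (simp add: gegenbauer_def)
next
  case (Suc n)
  have IH: "gegenbauer (lam+1) n 1 = pochhammer (2*lam+2) n / fact n"
    using Suc.IH[of "lam+1"] Suc.prems by (simp add: algebra_simps)
  have "real (Suc n) * (real (Suc n) + 2*lam) * gegenbauer lam (Suc n) 1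
      = (2*lam+1) * (2 * lam * gegenbauer (lam + 1) n 1)"
    using gegenbauer_ode[of 1 lam "Suc n"] by (simp add: gegenbauer1_Suc)
  also have "\<dots> = (2*lam) * ((2*lam+1) * pochhammer (2*lam+1+1) n) / fact n"
    unfolding IH by (simp add: add.assoc)
  also have "\<dots> = pochhammer (2*lam) (Suc (Suc n)) / fact n"
    unfolding pochhammer_rec[of "2*lam" "Suc n"] pochhammer_rec[of "2*lam+1" "n"] by simp
  also have "\<dots> = pochhammer (2*lam) (Suc n) * (real (Suc n) + 2*lam) / fact n"
    by (simp add: pochhammer_Suc algebra_simps)
  finally have "(real (Suc n) + 2*lam) * (real (Suc n) * gegenbauer lam (Suc n) 1)
     = (real (Suc n) + 2*lam) * (pochhammer (2*lam) (Suc n) / fact n)"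
    by (simp add: algebra_simps)
  moreover have "real (Suc n) + 2*lam \<noteq> 0" using Suc.prems by auto
  ultimately have "real (Suc n) * gegenbauer lam (Suc n) 1 = pochhammer (2*lam) (Suc n) / fact n"
    using mult_left_cancel by blast
  then show ?case by (simp add: field_simps del: of_nat_Suc)
qed

lemma gegenbauer_at_1_pos: "lam > 0 \<Longrightarrow> gegenbauer lam n 1 > 0"
  by (simp add: gegenbauer_at_1 pochhammer_pos)

lemma gegenbauer_minus: "gegenbauer lam n (- t) = (-1)^n * gegenbauer lam n t"
proof -
  have "(2 * - t)^(n - 2*j) = (-1)^n * (2*t)^(n - 2*j)" if "j \<le> n div 2" for j
  proof -
    have "n = (n - 2*j) + 2*j" using that by simp
    then have "(-1::real)^n = (-1)^(n - 2*j) * (-1)^(2*j)"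
      by (metis power_add)
    then have "(-1::real)^n = (-1)^(n - 2*j)" by simp
    moreover have "(2 * - t)^(n - 2*j) = (- 1 * (2*t))^(n - 2*j)" by simp
    ultimately show ?thesis by (metis power_mult_distrib)
  qed
  then show ?thesis
    unfolding gegenbauer_eq sum_distrib_left by (intro sum.cong refl) (simp del: power_mult_distrib)
qed

lemma gegenbauer1_minus: "gegenbauer1 lam n (- t) = - ((-1)^n * gegenbauer1 lam n t)"
proof (cases n)
  case 0 then show ?thesis by (simp add: gegenbauer1_def)
next
  case (Suc m) then show ?thesis by (simp add: gegenbauer1_Suc gegenbauer_minus)
qed

text \<open>Sonine's function \<open>y\<^sup>2 + (1 - t\<^sup>2) y'\<^sup>2 / (n (n + 2 lam))\<close> is increasing on \<open>[0, 1]\<close>.\<close>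

lemma gegenbauer_abs_le:
  assumes lam: "lam > 0" and t: "\<bar>t\<bar> \<le> 1"
  shows "\<bar>gegenbauer lam n t\<bar> \<le> gegenbauer lam n 1"
proof (cases "n = 0")
  case True then show ?thesis by (simp add: gegenbauer_def)
next
  case False
  let ?y = "gegenbauer lam n" and ?y1 = "gegenbauer1 lam n" and ?y2 = "gegenbauer2 lam n"
  define M where "M = real n * (real n + 2*lam)"
  have M: "M > 0" using False lam by (simp add: M_def)
  \<comment> \<open>Sonine's function multiplied by \<open>M\<close>; the equation cancels the mixed
    terms of its derivative and leaves a square whose factor is nonnegative on
    \<open>[0, 1]\<close>.\<close>
  define G where "G = (\<lambda>t. M * ?y t ^ 2 + (1 - t^2) * ?y1 t ^ 2)"
  have dG: "(G has_real_derivative 4 * lam * t * ?y1 t ^ 2) (at t)" for t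
  proof -
    have ode: "(1 - t^2) * ?y2 t = (2*lam+1) * t * ?y1 t - M * ?y t"
      using gegenbauer_ode[of t lam n] by (simp add: M_def)
    have "(G has_real_derivative (2 * M * ?y t * ?y1 t + (- 2 * t) * ?y1 t ^ 2 + 2 * ?y1 t * ((1 - t^2) * ?y2 t))) (at t)"
      unfolding G_def by (auto intro!: derivative_eq_intros DERIV_gegenbauer DERIV_gegenbauer1 simp: power2_eq_square algebra_simps)
    then show ?thesis unfolding ode by (simp add: algebra_simps power2_eq_square)
  qed
  have G1: "G s \<le> G 1" if "0 \<le> s" "s \<le> 1" for s
  proof (rule DERIV_nonneg_imp_nondecreasing[OF that(2)])
    fix x assume "s \<le> x" "x \<le> 1"
    then show "\<exists>y. (G has_real_derivative y) (at x) \<and> 0 \<le> y"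
      using that lam by (intro exI[of _ "4 * lam * x * ?y1 x ^ 2"] conjI dG) (auto intro!: mult_nonneg_nonneg)
  qed
  have abs: "\<bar>?y t\<bar> = \<bar>?y \<bar>t\<bar>\<bar>"
    using gegenbauer_minus[of lam n t] by (cases "t \<ge> 0") (auto simp: abs_mult power_abs)
  have "M * ?y \<bar>t\<bar> ^ 2 \<le> G \<bar>t\<bar>" using t by (auto simp: G_def abs_square_le_1)
  also have "\<dots> \<le> G 1" using G1[of "\<bar>t\<bar>"] t by simp
  also have "\<dots> = M * ?y 1 ^ 2" by (simp add: G_def)
  finally have "?y \<bar>t\<bar> ^ 2 \<le> ?y 1 ^ 2" using M by simp
  then show ?thesis unfolding abs using gegenbauer_at_1_pos[OF lam, of n]
    by (simp add: abs_le_square_iff[symmetric])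
qed

section \<open>Values at 0, separated by parity\<close>

lemma gegenbauer_at_0_even: "gegenbauer lam (2*m) 0 = (-1)^m * pochhammer lam m / fact m"
proof -
  have "gegenbauer lam (2*m) 0 = (\<Sum>j\<in>{m}. gegenbauer_coeff lam (2*m) j * (2*0)^(2*m - 2*j))"
    unfolding gegenbauer_eq by (rule sum.mono_neutral_right) auto
  then show ?thesis by (simp add: gegenbauer_coeff_def mult_2)
qed

lemma gegenbauer_at_0_odd: "odd n \<Longrightarrow> gegenbauer lam n 0 = 0"
  using gegenbauer_minus[of lam n 0] by simp

lemma gegenbauer1_at_0_even: "even n \<Longrightarrow> gegenbauer1 lam n 0 = 0"
  using gegenbauer1_minus[of lam n 0] by simp

lemma gegenbauer1_at_0_odd:
  "gegenbauer1 lam (Suc (2*m)) 0 = 2 * (-1)^m * pochhammer lam (Suc m) / fact m"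
  by (simp add: gegenbauer1_Suc gegenbauer_at_0_even pochhammer_rec)

section \<open>The energy of an ultraspherical equation\<close>

text \<open>The eigenvalue \<open>n * (n + 2*lam)\<close> is written as \<open>N^2 - lam^2\<close>
  with \<open>N = n + lam\<close>, since \<open>N\<close> is the frequency that survives in the
  normal form. Keeping \<open>y\<close> abstract lets the results apply to normalised
  polynomials.\<close>

locale ultraspherical_ode =
  fixes y y1 y2 :: "real \<Rightarrow> real" and lam N :: real
  assumes N_pos: "N > 0"
    and DERIV_y: "(y has_real_derivative y1 t) (at t)"
    and DERIV_y1: "(y1 has_real_derivative y2 t) (at t)"
    and ode: "(1 - t^2) * y2 t - (2*lam+1) * t * y1 t + (N^2 - lam^2) * y t = 0"
begin

text \<open>Liouville's normal form: the factor \<open>sin \<theta> powr lam\<close> removes the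
  first-order term. The exponent is real because \<open>lam\<close> may be a half-integer.\<close>

definition u :: "real \<Rightarrow> real" where
  "u \<theta> = sin \<theta> powr lam * y (cos \<theta>)"

definition u1 :: "real \<Rightarrow> real" where
  "u1 \<theta> = sin \<theta> powr lam * (lam * (cos \<theta> / sin \<theta>) * y (cos \<theta>) - sin \<theta> * y1 (cos \<theta>))"

definition energy :: "real \<Rightarrow> real" where
  "energy \<theta> = N^2 * u \<theta> ^ 2 + u1 \<theta> ^ 2"

text \<open>The perturbation left in the normal form. It vanishes for \<open>lam = 1\<close>, where
  \<open>u\<close> is an exact sinusoid of frequency \<open>N\<close>; in general it becomes strong
  only near the poles.\<close>

definition c :: real where "c = lam * (1 - lam)"

lemma DERIV_sin_powr:
  assumes "0 < \<theta>" "\<theta> < pi"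
  shows "((\<lambda>\<theta>. sin \<theta> powr lam) has_real_derivative lam * sin \<theta> powr lam * (cos \<theta> / sin \<theta>)) (at \<theta>)"
proof -
  have s: "sin \<theta> > 0" using assms by (rule sin_gt_zero)
  then show ?thesis
    by (auto intro!: derivative_eq_intros simp: powr_diff)
qed

lemma DERIV_u:
  assumes "0 < \<theta>" "\<theta> < pi"
  shows "(u has_real_derivative u1 \<theta>) (at \<theta>)"
proof -
  have "((\<lambda>\<theta>. y (cos \<theta>)) has_real_derivative y1 (cos \<theta>) * (- sin \<theta>)) (at \<theta>)"
    by (rule DERIV_chain2[OF DERIV_y DERIV_cos])
  from DERIV_mult[OF DERIV_sin_powr[OF assms] this] show ?thesis
    unfolding u_def[abs_def] u1_def by (simp add: algebra_simps)
qed

text \<open>The only use of the differential equation: it is evaluated at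
  \<open>cos \<theta>\<close>, where \<open>1 - t^2\<close> is \<open>sin \<theta> ^ 2\<close>, and
  removes both \<open>y1\<close> and \<open>y2\<close>.\<close>

lemma DERIV_u1:
  assumes "0 < \<theta>" "\<theta> < pi"
  shows "(u1 has_real_derivative - (N^2 + c / sin \<theta> ^ 2) * u \<theta>) (at \<theta>)"
proof -
  have s: "sin \<theta> > 0" using assms by (rule sin_gt_zero)
  have dy: "((\<lambda>\<theta>. y (cos \<theta>)) has_real_derivative y1 (cos \<theta>) * (- sin \<theta>)) (at \<theta>)"
    by (rule DERIV_chain2[OF DERIV_y DERIV_cos])
  have dy1: "((\<lambda>\<theta>. y1 (cos \<theta>)) has_real_derivative y2 (cos \<theta>) * (- sin \<theta>)) (at \<theta>)"
    by (rule DERIV_chain2[OF DERIV_y1 DERIV_cos])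
  have dcot: "((\<lambda>\<theta>. cos \<theta> / sin \<theta>) has_real_derivative - (1 / sin \<theta> ^ 2)) (at \<theta>)"
    using s DERIV_cot[of \<theta>] by (simp add: cot_def[abs_def] divide_inverse)
  let ?S = "sin \<theta>" and ?C = "cos \<theta>" and ?p = "sin \<theta> powr lam"
  have inner: "((\<lambda>\<theta>. lam * (cos \<theta> / sin \<theta>) * y (cos \<theta>) - sin \<theta> * y1 (cos \<theta>)) has_real_derivative
     lam * (- (1 / ?S^2)) * y ?C + lam * (?C / ?S) * (y1 ?C * (- ?S))
      - (?C * y1 ?C + ?S * (y2 ?C * (- ?S)))) (at \<theta>)"
    by (rule DERIV_cong[OF DERIV_diff[OF DERIV_mult[OF DERIV_cmult[OF dcot] dy] DERIV_mult[OF DERIV_sin dy1]]])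
      (simp add: algebra_simps)
  have "(u1 has_real_derivative
     lam * ?p * (?C / ?S) * (lam * (?C / ?S) * y ?C - ?S * y1 ?C) +
     (lam * (- (1 / ?S^2)) * y ?C + lam * (?C / ?S) * (y1 ?C * (- ?S))
      - (?C * y1 ?C + ?S * (y2 ?C * (- ?S)))) * ?p) (at \<theta>)"
    unfolding u1_def[abs_def] by (rule DERIV_mult[OF DERIV_sin_powr[OF assms] inner])
  also have "lam * ?p * (?C / ?S) * (lam * (?C / ?S) * y ?C - ?S * y1 ?C) +
     (lam * (- (1 / ?S^2)) * y ?C + lam * (?C / ?S) * (y1 ?C * (- ?S))
      - (?C * y1 ?C + ?S * (y2 ?C * (- ?S)))) * ?p
     = ?p * (lam^2 * (?C^2 / ?S^2) * y ?C - lam / ?S^2 * y ?C - (2*lam+1) * ?C * y1 ?C + ?S^2 * y2 ?C)"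
    using s by (simp add: field_simps power2_eq_square)
  also have "?S^2 * y2 ?C = (2*lam+1) * ?C * y1 ?C - (N^2 - lam^2) * y ?C"
    using ode[of ?C] sin_squared_eq[of \<theta>] by simp
  also have "?C^2 / ?S^2 = 1 / ?S^2 - 1"
    using s by (simp add: cos_squared_eq field_simps)
  also have "?p * (lam^2 * (1 / ?S^2 - 1) * y ?C - lam / ?S^2 * y ?C - (2*lam+1) * ?C * y1 ?C
      + ((2*lam+1) * ?C * y1 ?C - (N^2 - lam^2) * y ?C)) = - (N^2 + c / ?S ^ 2) * u \<theta>"
    using s by (simp add: c_def u_def field_simps power2_eq_square)
  finally show ?thesis .
qed

lemma energy_nonneg: "0 \<le> energy \<theta>"
  by (simp add: energy_def)

lemma u_le_energy: "N^2 * u \<theta> ^ 2 \<le> energy \<theta>"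
  by (simp add: energy_def)

lemma abs_u_u1_le_energy: "2 * N * \<bar>u \<theta> * u1 \<theta>\<bar> \<le> energy \<theta>"
proof -
  have "0 \<le> (N * \<bar>u \<theta>\<bar> - \<bar>u1 \<theta>\<bar>)^2" by simp
  then show ?thesis by (simp add: energy_def power2_diff power_mult_distrib abs_mult mult_ac)
qed

text \<open>For \<open>c = 0\<close> this is the conserved energy of a harmonic oscillator, so only
  the perturbation appears in the derivative.\<close>

lemma DERIV_energy:
  assumes "0 < \<theta>" "\<theta> < pi"
  shows "(energy has_real_derivative - 2 * c / sin \<theta> ^ 2 * (u \<theta> * u1 \<theta>)) (at \<theta>)"
proof -
  have "(energy has_real_derivative
     N^2 * (2 * u \<theta> * u1 \<theta>) + 2 * u1 \<theta> * (- (N^2 + c / sin \<theta> ^ 2) * u \<theta>)) (at \<theta>)"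
    unfolding energy_def[abs_def]
    by (auto intro!: derivative_eq_intros DERIV_u DERIV_u1 assms)
  then show ?thesis by (simp add: algebra_simps)
qed

text \<open>Gronwall's inequality: \<open>|E'| \<le> k E / sin\<^sup>2\<close> and \<open>- 1 / sin\<^sup>2\<close> is the derivative of \<open>cot\<close>.\<close>

lemma DERIV_energy_exp_cot:
  assumes "0 < \<theta>" "\<theta> < pi" "\<bar>c\<bar> \<le> k * N" and e: "e = 1 \<or> e = -1"
  shows "\<exists>D. ((\<lambda>\<theta>. energy \<theta> * exp (e * k * cot \<theta>)) has_real_derivative D) (at \<theta>) \<and> e * D \<le> 0"
proof -
  have s: "sin \<theta> > 0" using assms(1,2) by (rule sin_gt_zero)
  let ?E1 = "- 2 * c / sin \<theta> ^ 2 * (u \<theta> * u1 \<theta>)"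
  \<comment> \<open>The sign \<open>e\<close> handles both directions at once: multiplication by
    \<open>exp (k * cot \<theta>)\<close> gives a nonincreasing, by
    \<open>exp (- (k * cot \<theta>))\<close> a nondecreasing function.\<close>
  let ?x = "exp (e * k * cot \<theta>)"
  have D: "((\<lambda>\<theta>. energy \<theta> * exp (e * k * cot \<theta>)) has_real_derivative
      ?E1 * ?x + ?x * (e * k * (- inverse (sin \<theta> ^ 2))) * energy \<theta>) (at \<theta>)"
    using s by (intro DERIV_mult DERIV_energy assms DERIV_fun_exp DERIV_cmult DERIV_cot) auto
  have "\<bar>2 * c * (u \<theta> * u1 \<theta>)\<bar> \<le> k * energy \<theta>"
  proof -
    have "\<bar>2 * c * (u \<theta> * u1 \<theta>)\<bar> = \<bar>c\<bar> * (2 * \<bar>u \<theta> * u1 \<theta>\<bar>)" by (simp add: abs_mult)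
    also have "\<dots> \<le> (k * N) * (2 * \<bar>u \<theta> * u1 \<theta>\<bar>)" using assms(3) by (intro mult_right_mono) auto
    also have "\<dots> = k * (2 * N * \<bar>u \<theta> * u1 \<theta>\<bar>)" by simp
    also have "\<dots> \<le> k * energy \<theta>"
    proof (intro mult_left_mono abs_u_u1_le_energy)
      have "0 \<le> k * N" using assms(3) by linarith
      then show "0 \<le> k" using N_pos by (simp add: zero_le_mult_iff)
    qed
    finally show ?thesis .
  qed
  then have "- (e * (2 * c * (u \<theta> * u1 \<theta>))) - k * energy \<theta> \<le> 0"
    using e by (auto simp: abs_le_iff)
  then have "?x * inverse (sin \<theta> ^ 2) * (- (e * (2 * c * (u \<theta> * u1 \<theta>))) - k * energy \<theta>) \<le> 0"
    by (intro mult_nonneg_nonpos) auto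
  also have "?x * inverse (sin \<theta> ^ 2) * (- (e * (2 * c * (u \<theta> * u1 \<theta>))) - k * energy \<theta>)
    = e * (?E1 * ?x + ?x * (e * k * (- inverse (sin \<theta> ^ 2))) * energy \<theta>)"
    using e by (auto simp: divide_inverse algebra_simps)
  finally show ?thesis using D by blast
qed

text \<open>The base point is the equator because \<open>cot\<close> vanishes there, so that both
  monotone products reduce to the energy itself, and because the values at \<open>t = 0\<close> are
  explicit.\<close>

lemma energy_bounds:
  assumes \<theta>: "0 < \<theta>" "\<theta> < pi" and k: "\<bar>c\<bar> \<le> k * N"
  shows "energy \<theta> \<le> energy (pi/2) * exp (k * \<bar>cot \<theta>\<bar>)"
    and "energy (pi/2) * exp (- (k * \<bar>cot \<theta>\<bar>)) \<le> energy \<theta>"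
proof -
  have [simp]: "cot (pi/2 :: real) = 0" by (simp add: cot_def)
  have dec: "energy b * exp (k * cot b) \<le> energy a * exp (k * cot a)" if "0 < a" "a \<le> b" "b < pi" for a b
  proof (rule DERIV_nonpos_imp_nonincreasing[OF that(2)])
    fix x assume "a \<le> x" "x \<le> b"
    then show "\<exists>D. ((\<lambda>\<theta>. energy \<theta> * exp (k * cot \<theta>)) has_real_derivative D) (at x) \<and> D \<le> 0"
      using DERIV_energy_exp_cot[of x k 1] that k by auto
  qed
  have inc: "energy a * exp (- (k * cot a)) \<le> energy b * exp (- (k * cot b))" if "0 < a" "a \<le> b" "b < pi" for a b
  proof (rule DERIV_nonneg_imp_nondecreasing[OF that(2)])
    fix x assume "a \<le> x" "x \<le> b"
    then show "\<exists>D. ((\<lambda>\<theta>. energy \<theta> * exp (- (k * cot \<theta>))) has_real_derivative D) (at x) \<and> 0 \<le> D"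
      using DERIV_energy_exp_cot[of x k "-1"] that k by auto
  qed
  have m: "a * exp (- z) \<le> b \<Longrightarrow> a \<le> b * exp z" "a \<le> b * exp z \<Longrightarrow> a * exp (- z) \<le> b" for a b z :: real
    by (simp_all add: exp_minus field_simps)
  have "energy \<theta> \<le> energy (pi/2) * exp (k * \<bar>cot \<theta>\<bar>) \<and> energy (pi/2) * exp (- (k * \<bar>cot \<theta>\<bar>)) \<le> energy \<theta>"
  \<comment> \<open>Beyond the equator \<open>cot\<close> is negative, and the two monotone
    functions exchange their roles.\<close>
  proof (cases "\<theta> \<le> pi/2")
    case True
    then have "cot \<theta> \<ge> 0" using \<theta> by (auto simp: cot_def intro!: divide_nonneg_nonneg cos_ge_zero sin_ge_zero)
    then show ?thesis using dec[OF \<theta>(1) True] inc[OF \<theta>(1) True] m by auto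
  next
    case False
    then have "cot \<theta> \<le> 0" using \<theta> cos_ge_zero[of "pi - \<theta>"]
      by (auto simp: cot_def intro!: divide_nonpos_nonneg sin_ge_zero)
    then show ?thesis using dec[of "pi/2" \<theta>] inc[of "pi/2" \<theta>] False \<theta> m(1)[of "energy \<theta>" "- (k * cot \<theta>)" "energy (pi/2)"] 
       m(2)[of "energy (pi/2)" "energy \<theta>" "- (k * cot \<theta>)"] by auto
  qed
  then show "energy \<theta> \<le> energy (pi/2) * exp (k * \<bar>cot \<theta>\<bar>)"
    and "energy (pi/2) * exp (- (k * \<bar>cot \<theta>\<bar>)) \<le> energy \<theta>" by auto
qed

lemma isCont_u: "0 < \<theta> \<Longrightarrow> \<theta> < pi \<Longrightarrow> isCont u \<theta>"
  using DERIV_u DERIV_isCont by blast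

lemma isCont_u1: "0 < \<theta> \<Longrightarrow> \<theta> < pi \<Longrightarrow> isCont u1 \<theta>"
  using DERIV_u1 DERIV_isCont by blast

text \<open>Equipartition: \<open>2 N\<^sup>2 u\<^sup>2\<close> and \<open>N\<^sup>2 u\<^sup>2 + u'\<^sup>2\<close> differ by \<open>(u u')'\<close> up to \<open>c u\<^sup>2 / sin\<^sup>2\<close>.\<close>

lemma integral_u_squared:
  assumes ab: "0 < a" "a \<le> b" "b < pi"
  shows "2 * N^2 * (LBINT \<theta>. u \<theta> ^ 2 * indicator {a..b} \<theta>)
    = (LBINT \<theta>. (energy \<theta> - c / sin \<theta> ^ 2 * u \<theta> ^ 2) * indicator {a..b} \<theta>)
      - (u b * u1 b - u a * u1 a)"
proof -
  let ?g = "\<lambda>\<theta>. u1 \<theta> ^ 2 - (N^2 + c / sin \<theta> ^ 2) * u \<theta> ^ 2"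
  have D: "((\<lambda>\<theta>. u \<theta> * u1 \<theta>) has_real_derivative ?g \<theta>) (at \<theta>)" if "a \<le> \<theta>" "\<theta> \<le> b" for \<theta>
  proof -
    have "0 < \<theta>" "\<theta> < pi" using that ab by auto
    from DERIV_mult[OF DERIV_u[OF this] DERIV_u1[OF this]] show ?thesis
      by (simp add: power2_eq_square algebra_simps)
  qed
  have cont: "isCont ?g \<theta>" if "a \<le> \<theta>" "\<theta> \<le> b" for \<theta>
  proof -
    have "0 < \<theta>" "\<theta> < pi" "sin \<theta> \<noteq> 0" using that ab sin_gt_zero[of \<theta>] by auto
    then show ?thesis by (auto intro!: continuous_intros isCont_u isCont_u1)
  qed
  have cont2: "isCont (\<lambda>\<theta>. u \<theta> ^ 2) \<theta>" if "a \<le> \<theta>" "\<theta> \<le> b" for \<theta>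
    using that ab by (auto intro!: continuous_intros isCont_u)
  have I: "integrable lborel (\<lambda>\<theta>. h \<theta> * indicator {a..b} \<theta>)" if "\<And>\<theta>. a \<le> \<theta> \<Longrightarrow> \<theta> \<le> b \<Longrightarrow> isCont h \<theta>" for h :: "real \<Rightarrow> real"
    using borel_integrable_atLeastAtMost[of a b h] that by (auto simp: indicator_def if_distrib mult.commute cong: if_cong)
  have "(LBINT \<theta>. (energy \<theta> - c / sin \<theta> ^ 2 * u \<theta> ^ 2) * indicator {a..b} \<theta>)
     = (LBINT \<theta>. 2 * N^2 * (u \<theta> ^ 2 * indicator {a..b} \<theta>) + ?g \<theta> * indicator {a..b} \<theta>)"
    by (rule Bochner_Integration.integral_cong) (auto simp: energy_def algebra_simps)
  also have "\<dots> = 2 * N^2 * (LBINT \<theta>. u \<theta> ^ 2 * indicator {a..b} \<theta>) + (LBINT \<theta>. ?g \<theta> * indicator {a..b} \<theta>)"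
    using I[OF cont2] I[OF cont] by (subst Bochner_Integration.integral_add) auto
  also have "(LBINT \<theta>. ?g \<theta> * indicator {a..b} \<theta>) = u b * u1 b - u a * u1 a"
    by (rule integral_FTC_Icc_real[OF ab(2) D cont])
  finally show ?thesis by simp
qed

end

section \<open>Legendre polynomials at the equator\<close>

text \<open>Separates the growth \<open>n powr z / (z + n)\<close> from
  \<open>rGamma_series\<close>, whose limit is \<open>rGamma z\<close>; the asymptotics of binomial
  type below all go through this form.\<close>

lemma pochhammer_eq_rGamma_series:
  fixes z :: real
  assumes "z > 0" "n > 0"
  shows "pochhammer z n / fact n = rGamma_series z n * real n powr z / (z + real n)"
proof -
  have "exp (z * ln (real n)) = real n powr z" using assms by (simp add: powr_def)
  then show ?thesis
    using assms by (simp add: rGamma_series_def pochhammer_Suc divide_simps)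
qed

text \<open>Needed because \<open>2 * gegenbauer_index d + 1 = d\<close>: it converts a quotient of
  Gamma values at \<open>d - 1\<close> and \<open>(d - 1) / 2\<close> into a multiple of
  \<open>Gamma (d / 2)\<close>.\<close>

lemma Gamma_duplication_real:
  fixes x :: real
  assumes "x > 0"
  shows "Gamma x * Gamma (x + 1/2) = 2 powr (1 - 2*x) * sqrt pi * Gamma (2*x)"
proof -
  have *: "complex_of_real y \<notin> \<int>\<^sub>\<le>\<^sub>0" if "y > 0" for y
    using that by (auto elim!: nonpos_Ints_cases simp: complex_eq_iff)
  have "complex_of_real (Gamma x * Gamma (x + 1/2)) = Gamma (of_real x) * Gamma (of_real x + 1/2)"
    using Gamma_complex_of_real[of "x + 1/2"] by (simp add: Gamma_complex_of_real)
  also have "\<dots> = exp ((1 - 2 * of_real x) * of_real (ln 2)) * of_real (sqrt pi) * Gamma (2 * of_real x)"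
    using *[of x] *[of "x + 1/2"] assms by (intro Gamma_legendre_duplication) auto
  also have "exp ((1 - 2 * of_real x) * of_real (ln 2)) = complex_of_real (2 powr (1 - 2*x))"
    by (simp add: powr_def exp_of_real[symmetric])
  also have "Gamma (2 * of_real x) = complex_of_real (Gamma (2*x))"
    using Gamma_complex_of_real[of "2*x"] by simp
  finally have "complex_of_real (Gamma x * Gamma (x + 1/2)) = complex_of_real (2 powr (1 - 2*x) * sqrt pi * Gamma (2*x))"
    by simp
  then show ?thesis unfolding of_real_eq_iff .
qed

definition gegenbauer_index :: "nat \<Rightarrow> real" where "gegenbauer_index d = (real d - 1) / 2"

lemma gegenbauer_index_pos: "d \<ge> 2 \<Longrightarrow> gegenbauer_index d > 0"
  by (simp add: gegenbauer_index_def)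

definition legendre1 :: "nat \<Rightarrow> nat \<Rightarrow> real \<Rightarrow> real" where
  "legendre1 d n t = gegenbauer1 (gegenbauer_index d) n t / gegenbauer (gegenbauer_index d) n 1"

lemma legendre_eq: "legendre d n t = gegenbauer (gegenbauer_index d) n t / gegenbauer (gegenbauer_index d) n 1"
  by (simp add: legendre_def gegenbauer_index_def)

lemma ultraspherical_ode_legendre:
  assumes "d \<ge> 2"
  shows "ultraspherical_ode (legendre d n) (legendre1 d n)
    (\<lambda>t. gegenbauer2 (gegenbauer_index d) n t / gegenbauer (gegenbauer_index d) n 1) (gegenbauer_index d) (real n + gegenbauer_index d)"
proof
  let ?g = "gegenbauer (gegenbauer_index d) n 1"
  show "0 < real n + gegenbauer_index d" using gegenbauer_index_pos[OF assms] by simp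
  show "(legendre d n has_real_derivative legendre1 d n t) (at t)" for t
    unfolding legendre_eq[abs_def] legendre1_def by (rule DERIV_cdivide[OF DERIV_gegenbauer])
  show "(legendre1 d n has_real_derivative gegenbauer2 (gegenbauer_index d) n t / ?g) (at t)" for t
    unfolding legendre1_def[abs_def] by (rule DERIV_cdivide[OF DERIV_gegenbauer1])
  fix t
  have "(1 - t\<^sup>2) * (gegenbauer2 (gegenbauer_index d) n t / ?g) - (2 * gegenbauer_index d + 1) * t * legendre1 d n t
      + ((real n + gegenbauer_index d)\<^sup>2 - (gegenbauer_index d)\<^sup>2) * legendre d n t
     = ((1 - t\<^sup>2) * gegenbauer2 (gegenbauer_index d) n t - (2 * gegenbauer_index d + 1) * t * gegenbauer1 (gegenbauer_index d) n t
       + real n * (real n + 2 * gegenbauer_index d) * gegenbauer (gegenbauer_index d) n t) / ?g"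
    by (simp add: legendre_eq legendre1_def add_divide_distrib diff_divide_distrib power2_eq_square algebra_simps)
  then show "(1 - t\<^sup>2) * (gegenbauer2 (gegenbauer_index d) n t / ?g) - (2 * gegenbauer_index d + 1) * t * legendre1 d n t
      + ((real n + gegenbauer_index d)\<^sup>2 - (gegenbauer_index d)\<^sup>2) * legendre d n t = 0"
    unfolding gegenbauer_ode by simp
qed

lemma abs_legendre_le_1:
  assumes "d \<ge> 2" "\<bar>t\<bar> \<le> 1"
  shows "\<bar>legendre d n t\<bar> \<le> 1"
  using gegenbauer_abs_le[OF gegenbauer_index_pos[OF assms(1)] assms(2), of n]
    gegenbauer_at_1_pos[OF gegenbauer_index_pos[OF assms(1)], of n]
  by (simp add: legendre_eq)

lemma legendre_at_1: "d \<ge> 2 \<Longrightarrow> legendre d n 1 = 1"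
  using gegenbauer_at_1_pos[OF gegenbauer_index_pos, of d n] by (simp add: legendre_eq)

lemma continuous_on_legendre: "continuous_on A (legendre d n)"
proof -
  have "isCont (gegenbauer (gegenbauer_index d) n) t" for t
    using DERIV_gegenbauer DERIV_isCont by blast
  then have "continuous_on A (gegenbauer (gegenbauer_index d) n)"
    by (simp add: continuous_at_imp_continuous_on)
  then show ?thesis unfolding legendre_eq[abs_def] divide_inverse
    by (intro continuous_intros)
qed

lemma borel_measurable_legendre [measurable]: "legendre d n \<in> borel_measurable borel"
  by (rule borel_measurable_continuous_onI[OF continuous_on_legendre])

text \<open>Limit of the rescaled energy at the equator. The constant of the theorem,
  \<open>legendre_const d\<close>, is this number divided by \<open>Gamma (real d)\<close>.\<close>

definition midpoint_limit :: "nat \<Rightarrow> real" where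
  "midpoint_limit d = 2^(d-1) * Gamma (real d / 2)^2 / pi"

lemma midpoint_limit_eq:
  assumes "d \<ge> 2"
  shows "4 * (rGamma (gegenbauer_index d) / rGamma (2 * gegenbauer_index d))^2 * (1/2)^(d-1) = midpoint_limit d"
proof -
  define l where "l = gegenbauer_index d"
  have l: "l > 0" using gegenbauer_index_pos[OF assms] by (simp add: l_def)
  have d: "real d = 2*l + 1" by (simp add: l_def gegenbauer_index_def field_simps)
  have G: "Gamma l > 0" "Gamma (2*l) > 0" "Gamma (l + 1/2) > 0" using l by (auto intro!: Gamma_real_pos)
  have dup: "Gamma (2*l) / Gamma l = Gamma (l + 1/2) * 2 powr (2*l - 1) / sqrt pi"
    using Gamma_duplication_real[OF l] G by (simp add: field_simps powr_diff)
  have p: "2 powr (2*l-1) = 2^(d-1) / (2::real)"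
    using assms by (simp add: powr_diff powr_realpow[symmetric] d)
  have "rGamma l / rGamma (2*l) = Gamma (2*l) / Gamma l"
    by (simp add: rGamma_inverse_Gamma divide_inverse)
  also have "\<dots> ^ 2 = Gamma (l + 1/2)^2 * (2^(d-1))^2 / (4 * pi)"
    unfolding dup p by (simp add: power_mult_distrib power_divide)
  finally have *: "(rGamma l / rGamma (2*l))^2 = Gamma (l + 1/2)^2 * (2^(d-1))^2 / (4 * pi)" .
  show ?thesis unfolding l_def[symmetric] * midpoint_limit_def d
    by (simp add: power_divide power2_eq_square field_simps)
qed

text \<open>Makes \<open>wscale d n * N^2\<close> equal to \<open>N^(d-1)\<close>, which is the
  order of \<open>kdim d n\<close>. The quotient avoids the exponent \<open>d - 3\<close>, which
  truncated subtraction would falsify for \<open>d = 2\<close>.\<close>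

definition wscale :: "nat \<Rightarrow> nat \<Rightarrow> real" where
  "wscale d n = (real n + gegenbauer_index d)^(d-1) / (real n + gegenbauer_index d)^2"

text \<open>For even \<open>n\<close> the derivative vanishes at 0, for odd \<open>n\<close> the
  value does. The two parities thus see different halves of the energy; that both have the same
  limit is what makes the sum converge.\<close>

lemma legendre_at_0_tendsto:
  assumes d: "d \<ge> 2"
  shows "(\<lambda>n. wscale d n * ((real n + gegenbauer_index d)^2 * legendre d n 0 ^ 2 + legendre1 d n 0 ^ 2))
    \<longlonglongrightarrow> midpoint_limit d" (is "?f \<longlonglongrightarrow> _")
proof (rule limseq_even_odd)
  define l where "l = gegenbauer_index d"
  have l: "l > 0" using gegenbauer_index_pos[OF d] by (simp add: l_def)
  have dl: "2 * l = real (d - 1)" using d by (simp add: l_def gegenbauer_index_def)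
  define q1 q2 where "q1 = rGamma_series l" and "q2 = rGamma_series (2*l)"
  have q: "q1 \<longlonglongrightarrow> rGamma l" "q2 \<longlonglongrightarrow> rGamma (2*l)"
    unfolding q1_def q2_def by (rule rGamma_series_LIMSEQ)+
  have nz: "rGamma (2*l) \<noteq> 0" 
  proof -
    have "0 < Gamma (2*l)" using l by (intro Gamma_real_pos) simp
    from less_imp_neq[OF this] show ?thesis unfolding rGamma_inverse_Gamma inverse_nonzero_iff_nonzero by (rule not_sym)
  qed
  have powr2: "(x powr l)^2 = x^(d-1)" if "x > 0" for x :: real
    using that dl by (simp add: powr_realpow[symmetric] powr_powr mult.commute flip: powr_numeral)
  have powr4: "(x powr (2*l))^2 = (x^2)^(d-1)" if "x > 0" for x :: real
    using that dl by (simp add: powr_realpow power_mult[symmetric] mult.commute)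
  have q2pos: "q2 n > 0" if "n > 0" for n
    unfolding q2_def rGamma_series_def using l that by (auto intro!: divide_pos_pos mult_pos_pos pochhammer_pos)
  have lim: "4 * (rGamma l / rGamma (2*l))^2 * (1/2)^(d-1) = midpoint_limit d"
    using midpoint_limit_eq[OF d] by (simp add: l_def)

  have sgn2: "((-1) ^ m)^2 = (1::real)" for m :: nat
    by (simp add: power_mult[symmetric])

  show "(\<lambda>m. ?f (2*m)) \<longlonglongrightarrow> midpoint_limit d"
  proof -
    \<comment> \<open>The base \<open>4 * real m\<close> is \<open>(2 * m)^2 / m\<close>: the
      squares of \<open>m powr l\<close> and \<open>(2 * m) powr (2 * l)\<close> are
      \<open>m^(d-1)\<close> and \<open>((2 * m)^2)^(d-1)\<close>.\<close>
    have ev: "4 * (q1 m / q2 (2*m))^2 * ((2 * real m + l) / (4 * real m))^(d-1) = ?f (2*m)" if m: "m > 0" for m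
    proof -
      let ?N = "2 * real m + l"
      have N: "?N > 0" using l by simp
      have quot: "real m / (2 * real m)^2 = 1 / (4 * real m)" using m by (simp add: power2_eq_square)
      have "legendre d (2*m) 0 = (-1)^m * ((pochhammer l m / fact m) / (pochhammer (2*l) (2*m) / fact (2*m)))"
        unfolding legendre_eq l_def[symmetric] gegenbauer_at_0_even gegenbauer_at_1[OF l] by simp
      then have "legendre d (2*m) 0 ^ 2 = ((pochhammer l m / fact m) / (pochhammer (2*l) (2*m) / fact (2*m)))^2"
        by (simp only: power_mult_distrib sgn2 mult_1)
      also have "(pochhammer l m / fact m) / (pochhammer (2*l) (2*m) / fact (2*m))
         = (q1 m * real m powr l / (l + real m)) / (q2 (2*m) * (2 * real m) powr (2*l) / (2 * (l + real m)))"
        using m l by (simp add: pochhammer_eq_rGamma_series q1_def q2_def)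
      also have "\<dots> = 2 * (q1 m / q2 (2*m)) * (real m powr l / (2 * real m) powr (2*l))"
        using l m by (simp add: divide_simps)
      also have "\<dots> ^ 2 = 4 * (q1 m / q2 (2*m))^2 * (real m ^ (d-1) / ((2 * real m)^2)^(d-1))"
        unfolding power_mult_distrib power_divide using m by (simp add: powr2 powr4)
      also have "\<dots> = 4 * (q1 m / q2 (2*m))^2 * (1 / (4 * real m))^(d-1)"
        by (simp only: power_divide[symmetric] quot)
      finally have leg: "legendre d (2*m) 0 ^ 2 = 4 * (q1 m / q2 (2*m))^2 * (1 / (4 * real m))^(d-1)" .
      have "?f (2*m) = ?N^(d-1) / ?N^2 * (?N^2 * legendre d (2*m) 0 ^ 2)"
        by (simp add: wscale_def l_def[symmetric] legendre1_def gegenbauer1_at_0_even)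
      also have "\<dots> = ?N^(d-1) * legendre d (2*m) 0 ^ 2" using N by simp
      also have "\<dots> = 4 * (q1 m / q2 (2*m))^2 * (?N * (1 / (4 * real m)))^(d-1)"
        unfolding leg power_mult_distrib by simp
      finally show ?thesis by simp
    qed
    have "(\<lambda>m. 4 * (q1 m / q2 (2*m))^2 * ((2 * real m + l) / (4 * real m))^(d-1))
        \<longlonglongrightarrow> 4 * (rGamma l / rGamma (2*l))^2 * (1/2)^(d-1)"
    proof -
      have h1: "(\<lambda>m. q2 (2*m)) \<longlonglongrightarrow> rGamma (2*l)"
        using LIMSEQ_subseq_LIMSEQ[OF q(2), of "\<lambda>m. 2*m"] by (simp add: o_def strict_mono_def)
      have h2: "(\<lambda>m. (2 * real m + l) / (4 * real m)) \<longlonglongrightarrow> 1/2"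
        by real_asymp
      show ?thesis
        by (rule tendsto_mult[OF tendsto_mult[OF tendsto_const tendsto_power[OF tendsto_divide[OF q(1) h1 nz]]]
          tendsto_power[OF h2]])
    qed
    then show ?thesis unfolding lim
      by (rule Lim_transform_eventually) (use ev in \<open>auto intro!: eventually_mono[OF eventually_gt_at_top[of 0]]\<close>)
  qed

  show "(\<lambda>m. ?f (2*m+1)) \<longlonglongrightarrow> midpoint_limit d"
  proof -
    \<comment> \<open>The last factor compares the \<open>2 * l + n\<close> from the normalisation
      at 1 with the \<open>N\<close> from \<open>wscale\<close>; it tends to 1.\<close>
    have ev: "4 * (q1 m / q2 (2*m+1))^2 * ((2 * real m + 1 + l) * real m / (2 * real m + 1)^2)^(d-1) *
         ((2 * l + (2 * real m + 1)) / (2 * real m + 1 + l))^2 = ?f (2*m+1)" if m: "m > 0" for m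
    proof -
      let ?n = "2 * real m + 1"
      let ?N = "?n + l"
      have N: "?N > 0" using l by simp
      have "legendre1 d (2*m+1) 0 = (-1)^m * (2 * (pochhammer l m / fact m * (l + real m)) / (pochhammer (2*l) (2*m+1) / fact (2*m+1)))"
        using gegenbauer1_at_0_odd[of l m]
        unfolding legendre1_def l_def[symmetric] gegenbauer_at_1[OF l] by (simp add: pochhammer_Suc[of l m])
      then have "legendre1 d (2*m+1) 0 ^ 2 = (2 * (pochhammer l m / fact m * (l + real m)) / (pochhammer (2*l) (2*m+1) / fact (2*m+1)))^2"
        by (simp only: power_mult_distrib sgn2 mult_1)
      also have "2 * (pochhammer l m / fact m * (l + real m)) / (pochhammer (2*l) (2*m+1) / fact (2*m+1))
         = 2 * (q1 m * real m powr l / (l + real m) * (l + real m)) / (q2 (2*m+1) * ?n powr (2*l) / (2 * l + ?n))"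
        using m l pochhammer_eq_rGamma_series[of "2*l" "2*m+1"]
        by (simp add: pochhammer_eq_rGamma_series q1_def q2_def add_ac)
      also have "\<dots> = 2 * (q1 m / q2 (2*m+1)) * (real m powr l / ?n powr (2*l)) * (2 * l + ?n)"
        using l m by (simp add: divide_simps)
      also have "\<dots> ^ 2 = 4 * (q1 m / q2 (2*m+1))^2 * (real m ^ (d-1) / (?n^2)^(d-1)) * (2 * l + ?n)^2"
        unfolding power_mult_distrib power_divide using m by (simp add: powr2 powr4)
      also have "\<dots> = 4 * (q1 m / q2 (2*m+1))^2 * (real m / ?n^2)^(d-1) * (2 * l + ?n)^2"
        by (simp only: power_divide)
      finally have leg: "legendre1 d (2*m+1) 0 ^ 2 = 4 * (q1 m / q2 (2*m+1))^2 * (real m / ?n^2)^(d-1) * (2 * l + ?n)^2" .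
      have "?f (2*m+1) = ?N^(d-1) / ?N^2 * (legendre1 d (2*m+1) 0 ^ 2)"
        by (simp add: wscale_def l_def[symmetric] legendre_eq gegenbauer_at_0_odd add_ac)
      also have "\<dots> = 4 * (q1 m / q2 (2*m+1))^2 * (?N * (real m / ?n^2))^(d-1) * ((2 * l + ?n) / ?N)^2"
        unfolding leg power_mult_distrib power_divide[of "2*l+?n"] by simp
      finally show ?thesis by simp
    qed
    have "(\<lambda>m. 4 * (q1 m / q2 (2*m+1))^2 * ((2 * real m + 1 + l) * real m / (2 * real m + 1)^2)^(d-1) *
         ((2 * l + (2 * real m + 1)) / (2 * real m + 1 + l))^2)
        \<longlonglongrightarrow> 4 * (rGamma l / rGamma (2*l))^2 * (1/2)^(d-1) * 1^2"
    proof -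
      have h1: "(\<lambda>m. q2 (2*m+1)) \<longlonglongrightarrow> rGamma (2*l)"
        using LIMSEQ_subseq_LIMSEQ[OF q(2), of "\<lambda>m. 2*m+1"] by (simp add: o_def strict_mono_def)
      have h2: "(\<lambda>m. (2 * real m + 1 + l) * real m / (2 * real m + 1)^2) \<longlonglongrightarrow> 1/2"
        by real_asymp
      have h3: "(\<lambda>m. (2 * l + (2 * real m + 1)) / (2 * real m + 1 + l)) \<longlonglongrightarrow> 1"
        by real_asymp
      show ?thesis
        by (rule tendsto_mult[OF tendsto_mult[OF tendsto_mult[OF tendsto_const tendsto_power[OF tendsto_divide[OF q(1) h1 nz]]]
          tendsto_power[OF h2]] tendsto_power[OF h3]])
    qed
    then have "(\<lambda>m. 4 * (q1 m / q2 (2*m+1))^2 * ((2 * real m + 1 + l) * real m / (2 * real m + 1)^2)^(d-1) *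
         ((2 * l + (2 * real m + 1)) / (2 * real m + 1 + l))^2) \<longlonglongrightarrow> midpoint_limit d" by (simp only: lim power_one mult_1_right)
    then show ?thesis
      by (rule Lim_transform_eventually) (use ev in \<open>auto intro!: eventually_mono[OF eventually_gt_at_top[of 0]]\<close>)
  qed
qed

text \<open>The binomial coefficient is \<open>pochhammer (real d) n / fact n\<close>. The free
  shift \<open>b\<close> serves two scales: \<open>gegenbauer_index d\<close> gives powers of
  \<open>N\<close>, 0 gives powers of \<open>n\<close>.\<close>

lemma kdim_tendsto:
  assumes d: "d \<ge> 2"
  shows "(\<lambda>n. kdim d n / (real n + b)^(d-1)) \<longlonglongrightarrow> 2 / Gamma (real d)"
proof -
  have ev: "(2 * real n + real d - 1) / (real n + real d - 1) * rGamma_series (real d) n * (real n / (real d + real n))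
     * (real n / (real n + b))^(d-1) = kdim d n / (real n + b)^(d-1)" if n: "n > 0" for n
  proof -
    have "real ((n + d - 1) choose (d - 1)) = real ((n + d - 1) choose n)"
      using d by (subst binomial_symmetric) auto
    also have "\<dots> = pochhammer (real d) n / fact n"
      using d by (simp add: binomial_gbinomial gbinomial_pochhammer' of_nat_diff)
    also have "\<dots> = rGamma_series (real d) n * real n ^ d / (real d + real n)"
      using d n by (simp add: pochhammer_eq_rGamma_series powr_realpow)
    also have "real n ^ d = real n * real n ^ (d-1)" using d by (cases d) auto
    finally show ?thesis unfolding kdim_def power_divide by simp
  qed
  have "(\<lambda>n. (2 * real n + real d - 1) / (real n + real d - 1) * rGamma_series (real d) n * (real n / (real d + real n))
     * (real n / (real n + b))^(d-1)) \<longlonglongrightarrow> 2 * rGamma (real d) * 1 * 1^(d-1)"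
  proof (intro tendsto_mult tendsto_power rGamma_series_LIMSEQ)
    show "(\<lambda>n. (2 * real n + real d - 1) / (real n + real d - 1)) \<longlonglongrightarrow> 2" by real_asymp
    show "(\<lambda>n. (real n / (real d + real n))) \<longlonglongrightarrow> 1" by real_asymp
    show "(\<lambda>n. (real n / (real n + b))) \<longlonglongrightarrow> 1" by real_asymp
  qed
  then have "(\<lambda>n. (2 * real n + real d - 1) / (real n + real d - 1) * rGamma_series (real d) n * (real n / (real d + real n))
     * (real n / (real n + b))^(d-1)) \<longlonglongrightarrow> 2 / Gamma (real d)"
    by (simp add: rGamma_inverse_Gamma divide_inverse)
  then show ?thesis
    by (rule Lim_transform_eventually) (use ev in \<open>auto intro!: eventually_mono[OF eventually_gt_at_top[of 0]]\<close>)
qed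

section \<open>Asymptotics of squared Legendre polynomials\<close>

context ultraspherical_ode
begin

lemma borel_measurable_y: "y \<in> borel_measurable borel" and borel_measurable_y1: "y1 \<in> borel_measurable borel"
  by (auto intro!: borel_measurable_continuous_onI continuous_at_imp_continuous_on
      DERIV_isCont[OF DERIV_y] DERIV_isCont[OF DERIV_y1])

lemma borel_measurable_u: "u \<in> borel_measurable borel"
  using borel_measurable_y unfolding u_def[abs_def] by measurable

lemma borel_measurable_energy: "energy \<in> borel_measurable borel"
  using borel_measurable_y borel_measurable_y1 borel_measurable_u
  unfolding energy_def[abs_def] u1_def[abs_def] by measurable

end

text \<open>The function v_n of the overview, whose sine factor keeps it bounded in \<open>n\<close>
  even near the poles.\<close>

definition legendre_density :: "nat \<Rightarrow> nat \<Rightarrow> real \<Rightarrow> real" where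
  "legendre_density d n \<theta> = kdim d n * (sin \<theta> ^ (d-1) * legendre d n (cos \<theta>) ^ 2)"

definition legendre_const :: "nat \<Rightarrow> real" where
  "legendre_const d = 2 ^ (d - 1) / (Gamma (real d) * pi) * Gamma (real d / 2) ^ 2"

locale legendre_asymptotics =
  fixes d :: nat
  assumes d: "d \<ge> 2"
begin

definition N :: "nat \<Rightarrow> real" where "N n = real n + gegenbauer_index d"
definition rho :: "nat \<Rightarrow> real" where "rho n = kdim d n / N n ^ (d-1)"
definition c :: real where "c = gegenbauer_index d * (1 - gegenbauer_index d)"
definition U :: "nat \<Rightarrow> real \<Rightarrow> real" where
  "U n = ultraspherical_ode.u (legendre d n) (gegenbauer_index d)"
definition U1 :: "nat \<Rightarrow> real \<Rightarrow> real" where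
  "U1 n = ultraspherical_ode.u1 (legendre d n) (legendre1 d n) (gegenbauer_index d)"
definition e :: "nat \<Rightarrow> real \<Rightarrow> real" where
  "e n \<theta> = wscale d n * ultraspherical_ode.energy (legendre d n) (legendre1 d n) (gegenbauer_index d) (N n) \<theta>"

lemma ode: "ultraspherical_ode (legendre d n) (legendre1 d n)
    (\<lambda>t. gegenbauer2 (gegenbauer_index d) n t / gegenbauer (gegenbauer_index d) n 1) (gegenbauer_index d) (N n)"
  unfolding N_def by (rule ultraspherical_ode_legendre[OF d])

lemma N_pos: "N n > 0" and N_ge: "N n \<ge> gegenbauer_index d" and gegenbauer_index_pos': "gegenbauer_index d > 0"
  using gegenbauer_index_pos[OF d] by (auto simp: N_def)

lemma c_eq: "ultraspherical_ode.c (gegenbauer_index d) = c"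
  unfolding ultraspherical_ode.c_def[OF ode] c_def ..

lemma wscale_pos: "wscale d n > 0"
  using N_pos[of n] unfolding wscale_def N_def by simp

lemma wscale_N: "wscale d n * N n ^ 2 = N n ^ (d-1)"
  using N_pos[of n] unfolding wscale_def N_def by simp

lemma U_squared: "0 < \<theta> \<Longrightarrow> \<theta> < pi \<Longrightarrow> U n \<theta> ^ 2 = sin \<theta> ^ (d-1) * legendre d n (cos \<theta>) ^ 2"
proof -
  assume "0 < \<theta>" "\<theta> < pi"
  then have s: "sin \<theta> > 0" by (rule sin_gt_zero)
  have "(sin \<theta> powr gegenbauer_index d)^2 = sin \<theta> powr (real (d - 1))"
  proof -
    have "gegenbauer_index d * 2 = real (d - 1)" using d by (simp add: gegenbauer_index_def of_nat_diff)
    then show ?thesis using s by (simp add: powr_powr flip: powr_numeral)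
  qed
  then show ?thesis
    unfolding U_def ultraspherical_ode.u_def[OF ode] using s by (simp add: power_mult_distrib powr_realpow)
qed

lemma density_eq: "0 < \<theta> \<Longrightarrow> \<theta> < pi \<Longrightarrow>
    legendre_density d n \<theta> = rho n * (wscale d n * N n ^ 2 * U n \<theta> ^ 2)"
  using N_pos[of n] unfolding wscale_N by (simp add: U_squared legendre_density_def rho_def)

lemma U_le_e: "wscale d n * N n ^ 2 * U n \<theta> ^ 2 \<le> e n \<theta>"
  using ultraspherical_ode.u_le_energy[OF ode, of n \<theta>] wscale_pos[of n]
  by (simp add: e_def U_def mult.assoc)

lemma UU1_le_e: "2 * N n * (wscale d n * \<bar>U n \<theta> * U1 n \<theta>\<bar>) \<le> e n \<theta>"
  using mult_left_mono[OF ultraspherical_ode.abs_u_u1_le_energy[OF ode, of n \<theta>], of "wscale d n"] wscale_pos[of n]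
  by (simp add: e_def U_def U1_def mult_ac)

lemma e_nonneg: "e n \<theta> \<ge> 0"
  using ultraspherical_ode.energy_nonneg[OF ode, of n \<theta>] wscale_pos[of n] by (simp add: e_def)

lemma e_bounds:
  assumes "0 < \<theta>" "\<theta> < pi"
  shows "e n \<theta> \<le> e n (pi/2) * exp (\<bar>c\<bar> / N n * \<bar>cot \<theta>\<bar>)"
    and "e n (pi/2) * exp (- (\<bar>c\<bar> / N n * \<bar>cot \<theta>\<bar>)) \<le> e n \<theta>"
proof -
  have k: "\<bar>ultraspherical_ode.c (gegenbauer_index d)\<bar> \<le> \<bar>c\<bar> / N n * N n" using N_pos[of n] by (simp add: c_eq)
  show "e n \<theta> \<le> e n (pi/2) * exp (\<bar>c\<bar> / N n * \<bar>cot \<theta>\<bar>)"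
    using mult_left_mono[OF ultraspherical_ode.energy_bounds(1)[OF ode assms k], of "wscale d n"] wscale_pos[of n]
    by (simp add: e_def mult.assoc)
  show "e n (pi/2) * exp (- (\<bar>c\<bar> / N n * \<bar>cot \<theta>\<bar>)) \<le> e n \<theta>"
    using mult_left_mono[OF ultraspherical_ode.energy_bounds(2)[OF ode assms k], of "wscale d n"] wscale_pos[of n]
    by (simp add: e_def mult.assoc)
qed

lemma e_mid_tendsto: "(\<lambda>n. e n (pi/2)) \<longlonglongrightarrow> midpoint_limit d"
proof -
  have "e n (pi/2) = wscale d n * ((real n + gegenbauer_index d)^2 * legendre d n 0 ^ 2 + legendre1 d n 0 ^ 2)" for n
  proof -
    have "ultraspherical_ode.energy (legendre d n) (legendre1 d n) (gegenbauer_index d) (N n) (pi/2)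
        = N n ^ 2 * legendre d n 0 ^ 2 + legendre1 d n 0 ^ 2"
      unfolding ultraspherical_ode.energy_def[OF ode] ultraspherical_ode.u_def[OF ode]
        ultraspherical_ode.u1_def[OF ode] by simp
    then show ?thesis by (simp add: e_def N_def)
  qed
  then show ?thesis using legendre_at_0_tendsto[OF d] by simp
qed

lemma rho_tendsto: "rho \<longlonglongrightarrow> 2 / Gamma (real d)"
  unfolding rho_def[abs_def] N_def by (rule kdim_tendsto[OF d])

lemma rho_nonneg: "rho n \<ge> 0"
  using N_pos[of n] d by (auto simp: rho_def kdim_def intro!: divide_nonneg_nonneg mult_nonneg_nonneg)

lemma inverse_N_tendsto: "(\<lambda>n. 1 / N n) \<longlonglongrightarrow> 0"
  unfolding N_def by real_asymp

text \<open>At a fixed angle the exponent in the Gronwall bounds is \<open>O(1 / N)\<close>, so the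
  energy has the same limit as at the equator.\<close>

lemma e_tendsto:
  assumes "0 < \<theta>" "\<theta> < pi"
  shows "(\<lambda>n. e n \<theta>) \<longlonglongrightarrow> midpoint_limit d"
proof -
  have k: "(\<lambda>n. \<bar>c\<bar> / N n * \<bar>cot \<theta>\<bar>) \<longlonglongrightarrow> 0"
    using tendsto_mult[OF tendsto_mult[OF tendsto_const inverse_N_tendsto] tendsto_const, of "\<bar>c\<bar>" "\<bar>cot \<theta>\<bar>"] by simp
  have "(\<lambda>n. e n (pi/2) * exp (\<bar>c\<bar> / N n * \<bar>cot \<theta>\<bar>)) \<longlonglongrightarrow> midpoint_limit d"
    using tendsto_mult[OF e_mid_tendsto tendsto_exp[OF k]] by simp
  note upper = this
  have "(\<lambda>n. e n (pi/2) * exp (- (\<bar>c\<bar> / N n * \<bar>cot \<theta>\<bar>))) \<longlonglongrightarrow> midpoint_limit d"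
    using tendsto_mult[OF e_mid_tendsto tendsto_exp[OF tendsto_minus[OF k]]] by simp
  then show ?thesis
    by (rule tendsto_sandwich[OF _ _ _ upper, rotated 2]) (intro always_eventually allI e_bounds assms)+
qed

lemma e_mid_bounded: obtains C where "C > 0" "\<And>n. e n (pi/2) \<le> C"
proof -
  have "Bseq (\<lambda>n. e n (pi/2))" using e_mid_tendsto by (intro convergent_imp_Bseq convergentI)
  then show ?thesis using that unfolding Bseq_def by (metis abs_le_D1 real_norm_def)
qed

lemma density_nonneg: "0 < \<theta> \<Longrightarrow> \<theta> < pi \<Longrightarrow> legendre_density d n \<theta> \<ge> 0"
  unfolding density_eq using wscale_pos[of n] rho_nonneg[of n] by simp

text \<open>The Gronwall factor is uniform only while \<open>cot \<theta>\<close> stays below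
  \<open>N\<close> in modulus. Closer to a pole \<open>N * sin \<theta>\<close> is at most 1, and
  the bound 1 for the polynomial takes over.\<close>

lemma density_bounded: obtains C where "\<And>n \<theta>. 0 < \<theta> \<Longrightarrow> \<theta> < pi \<Longrightarrow> legendre_density d n \<theta> \<le> C"
proof -
  obtain C where C: "C > 0" "\<And>n. e n (pi/2) \<le> C" using e_mid_bounded by blast
  have "Bseq rho" using rho_tendsto by (intro convergent_imp_Bseq convergentI)
  then obtain R where R: "R > 0" "\<And>n. rho n \<le> R" unfolding Bseq_def by (metis abs_le_D1 real_norm_def)
  have "wscale d n * N n ^ 2 * U n \<theta> ^ 2 \<le> max 1 (C * exp \<bar>c\<bar>)" if \<theta>: "0 < \<theta>" "\<theta> < pi" for n \<theta>
  proof (cases "\<bar>cot \<theta>\<bar> \<le> N n")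
    case True
    have "wscale d n * N n ^ 2 * U n \<theta> ^ 2 \<le> e n \<theta>" by (rule U_le_e)
    also have "\<dots> \<le> e n (pi/2) * exp (\<bar>c\<bar> / N n * \<bar>cot \<theta>\<bar>)" by (rule e_bounds[OF \<theta>])
    also have "\<dots> \<le> C * exp \<bar>c\<bar>"
    proof (intro mult_mono C)
      have "\<bar>c\<bar> / N n * \<bar>cot \<theta>\<bar> \<le> \<bar>c\<bar> / N n * N n"
        using N_pos[of n] True by (intro mult_left_mono) auto
      then show "exp (\<bar>c\<bar> / N n * \<bar>cot \<theta>\<bar>) \<le> exp \<bar>c\<bar>" using N_pos[of n] by simp
    qed (use C in auto)
    finally show ?thesis by simp
  next
    case False
    have s: "sin \<theta> > 0" using \<theta> by (rule sin_gt_zero)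
    have "\<bar>cot \<theta>\<bar> \<le> 1 / sin \<theta>" using s by (simp add: cot_def divide_right_mono)
    then have "N n < 1 / sin \<theta>" using False by simp
    then have Ns: "N n * sin \<theta> \<le> 1" using s by (simp add: field_simps)
    have "wscale d n * N n ^ 2 * U n \<theta> ^ 2 = (N n * sin \<theta>) ^ (d-1) * legendre d n (cos \<theta>) ^ 2"
      unfolding wscale_N U_squared[OF \<theta>] by (simp add: power_mult_distrib)
    also have "\<dots> \<le> 1 * 1"
    proof (intro mult_mono)
      show "(N n * sin \<theta>) ^ (d-1) \<le> 1" using Ns N_pos[of n] s by (intro power_le_one) auto
      show "legendre d n (cos \<theta>) ^ 2 \<le> 1"
        using abs_legendre_le_1[OF d, of "cos \<theta>" n] by (simp add: abs_square_le_1)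
    qed auto
    finally show ?thesis by simp
  qed
  then have "legendre_density d n \<theta> \<le> R * max 1 (C * exp \<bar>c\<bar>)" if "0 < \<theta>" "\<theta> < pi" for n \<theta>
    unfolding density_eq[OF that] using that R rho_nonneg wscale_pos[of n] by (intro mult_mono) auto
  then show ?thesis by (rule that)
qed

text \<open>After rescaling, equipartition leaves half the energy: the correction \<open>r\<close>
  is \<open>O(1 / N^2)\<close> on a compact interval, the boundary terms are
  \<open>O(1 / N)\<close>, and the energy converges to a constant.\<close>

lemma integral_density_tendsto:
  assumes ab: "0 < a" "a \<le> b" "b < pi"
  shows "(\<lambda>n. LBINT \<theta>. legendre_density d n \<theta> * indicator {a..b} \<theta>) \<longlonglongrightarrow> legendre_const d * (b - a)"
proof -
  obtain C where C: "C > 0" "\<And>n. e n (pi/2) \<le> C" using e_mid_bounded by blast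
  have pos: "sin \<theta> > 0" "0 < \<theta>" "\<theta> < pi" if "\<theta> \<in> {a..b}" for \<theta>
    using that ab by (auto intro!: sin_gt_zero)
  have "compact ((\<lambda>\<theta>. 1 / sin \<theta>) ` {a..b})"
    using pos by (intro compact_continuous_image continuous_intros) (auto simp: less_imp_neq[symmetric])
  then obtain M where "\<forall>\<theta>\<in>{a..b}. \<bar>1 / sin \<theta>\<bar> \<le> M"
    by (auto dest!: compact_imp_bounded simp: bounded_iff)
  then have M: "\<And>\<theta>. \<theta> \<in> {a..b} \<Longrightarrow> 1 / sin \<theta> \<le> M" by (meson abs_le_D1)
  have M1: "1 / sin \<theta> ^ 2 \<le> M^2" if "\<theta> \<in> {a..b}" for \<theta>
    using power_mono[OF M[OF that], of 2] pos[OF that] by (simp add: power_divide)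
  have cotM: "\<bar>cot \<theta>\<bar> \<le> M" if "\<theta> \<in> {a..b}" for \<theta>
  proof -
    have "\<bar>cot \<theta>\<bar> \<le> 1 / sin \<theta>" using pos[OF that] by (simp add: cot_def divide_right_mono)
    then show ?thesis using M[OF that] by simp
  qed
  define l where "l = gegenbauer_index d"
  have l: "l > 0" using gegenbauer_index_pos' by (simp add: l_def)
  \<comment> \<open>\<open>l\<close> is the least value of \<open>N n\<close>, so this bounds the
    energy on the interval for all \<open>n\<close> at once.\<close>
  define K where "K = C * exp (\<bar>c\<bar> / l * M)"
  have eK: "e n \<theta> \<le> K" if \<theta>: "\<theta> \<in> {a..b}" for n \<theta>
  proof -
    have "e n \<theta> \<le> e n (pi/2) * exp (\<bar>c\<bar> / N n * \<bar>cot \<theta>\<bar>)" using e_bounds(1) pos[OF \<theta>] by simp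
    also have "\<dots> \<le> K"
      unfolding K_def
    proof (intro mult_mono C)
      have "\<bar>c\<bar> / N n * \<bar>cot \<theta>\<bar> \<le> \<bar>c\<bar> / l * M"
        using N_ge[of n] l cotM[OF \<theta>] unfolding l_def by (intro mult_mono divide_left_mono) auto
      then show "exp (\<bar>c\<bar> / N n * \<bar>cot \<theta>\<bar>) \<le> exp (\<bar>c\<bar> / l * M)" by simp
    qed (use C in auto)
    finally show ?thesis .
  qed
  have K: "K \<ge> 0" using C by (simp add: K_def)
  define r where "r = (\<lambda>n \<theta>. wscale d n * (c / sin \<theta> ^ 2 * U n \<theta> ^ 2))"
  have r_bound: "\<bar>r n \<theta>\<bar> \<le> \<bar>c\<bar> * M^2 * K * (1 / N n)^2" if \<theta>: "\<theta> \<in> {a..b}" for n \<theta>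
  proof -
    have "\<bar>r n \<theta>\<bar> = (\<bar>c\<bar> * (1 / sin \<theta> ^ 2)) * (wscale d n * N n ^ 2 * U n \<theta> ^ 2) * (1 / N n)^2"
      using N_pos[of n] wscale_pos[of n] by (simp add: r_def abs_mult power_divide)
    also have "\<dots> \<le> (\<bar>c\<bar> * M^2) * K * (1 / N n)^2"
    proof (intro mult_mono mult_right_mono mult_left_mono M1 \<theta>)
      show "wscale d n * N n ^ 2 * U n \<theta> ^ 2 \<le> K" using U_le_e[of n \<theta>] eK[OF \<theta>, of n] by simp
    qed (use wscale_pos[of n] K in auto)
    finally show ?thesis by simp
  qed
  have inv2: "(\<lambda>n. \<bar>c\<bar> * M^2 * K * (1 / N n)^2) \<longlonglongrightarrow> 0"
    using tendsto_mult[OF tendsto_const tendsto_power[OF inverse_N_tendsto, of 2]] by simp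
  have invb: "\<bar>c\<bar> * M^2 * K * (1 / N n)^2 \<le> \<bar>c\<bar> * M^2 * K * (1 / l)^2" for n
    using N_ge[of n] l C(1) unfolding l_def K_def by (intro mult_left_mono power_mono divide_left_mono) auto
  define g where "g = (\<lambda>n \<theta>. (e n \<theta> - r n \<theta>) * indicator {a..b} \<theta> :: real)"
  have lim_g: "(\<lambda>n. LBINT \<theta>. g n \<theta>) \<longlonglongrightarrow> (LBINT \<theta>. midpoint_limit d * indicator {a..b} \<theta>)"
  proof (rule integral_dominated_convergence)
    show "integrable lborel (\<lambda>\<theta>. (K + \<bar>c\<bar> * M^2 * K * (1 / l)^2) * indicator {a..b} \<theta> :: real)"
      by (intro integrable_mult_right integrable_real_indicator) (auto simp: emeasure_lborel_Icc_eq)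
    show "(\<lambda>\<theta>. midpoint_limit d * indicator {a..b} \<theta>) \<in> borel_measurable lborel" by simp
    show "g n \<in> borel_measurable lborel" for n
      using ultraspherical_ode.borel_measurable_u[OF ode, of n] ultraspherical_ode.borel_measurable_energy[OF ode, of n]
      unfolding g_def e_def r_def U_def by simp
    show "AE \<theta> in lborel. (\<lambda>n. g n \<theta>) \<longlonglongrightarrow> midpoint_limit d * indicator {a..b} \<theta>"
    proof (rule AE_I2)
      fix \<theta> show "(\<lambda>n. g n \<theta>) \<longlonglongrightarrow> midpoint_limit d * indicator {a..b} \<theta>"
      proof (cases "\<theta> \<in> {a..b}")
        case True
        have "(\<lambda>n. r n \<theta>) \<longlonglongrightarrow> 0"
          by (rule tendsto_rabs_zero_cancel, rule tendsto_sandwich[OF _ _ tendsto_const inv2])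
             (auto intro!: always_eventually r_bound True)
        from tendsto_diff[OF e_tendsto this, of \<theta>] pos[OF True] True show ?thesis by (simp add: g_def)
      qed (simp add: g_def)
    qed
    show "AE \<theta> in lborel. norm (g n \<theta>) \<le> (K + \<bar>c\<bar> * M^2 * K * (1 / l)^2) * indicator {a..b} \<theta>" for n
    proof (rule AE_I2)
      fix \<theta> show "norm (g n \<theta>) \<le> (K + \<bar>c\<bar> * M^2 * K * (1 / l)^2) * indicator {a..b} \<theta>"
      proof (cases "\<theta> \<in> {a..b}")
        case True
        have "\<bar>e n \<theta> - r n \<theta>\<bar> \<le> e n \<theta> + \<bar>r n \<theta>\<bar>" using e_nonneg[of n \<theta>] by linarith
        also have "\<dots> \<le> K + \<bar>c\<bar> * M^2 * K * (1 / l)^2"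
          using eK[OF True, of n] r_bound[OF True, of n] invb[of n] by linarith
        finally show ?thesis using True by (simp add: g_def)
      qed (simp add: g_def)
    qed
  qed
  \<comment> \<open>The energy controls \<open>2 * N * |U * U1|\<close>, so the boundary terms gain
    a factor \<open>1 / N\<close>.\<close>
  have bdry: "(\<lambda>n. wscale d n * (U n \<theta> * U1 n \<theta>)) \<longlonglongrightarrow> 0" if "0 < \<theta>" "\<theta> < pi" for \<theta>
  proof (rule tendsto_rabs_zero_cancel, rule tendsto_sandwich[OF _ _ tendsto_const])
    show "(\<lambda>n. e n \<theta> * (1 / N n)) \<longlonglongrightarrow> 0"
      using tendsto_mult[OF e_tendsto[OF that] inverse_N_tendsto] by simp
    show "\<forall>\<^sub>F n in sequentially. \<bar>wscale d n * (U n \<theta> * U1 n \<theta>)\<bar> \<le> e n \<theta> * (1 / N n)"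
    proof (rule always_eventually, rule allI)
      fix n
      have "wscale d n * \<bar>U n \<theta> * U1 n \<theta>\<bar> * N n \<le> 2 * N n * (wscale d n * \<bar>U n \<theta> * U1 n \<theta>\<bar>)"
        using N_pos[of n] wscale_pos[of n] by simp
      also have "\<dots> \<le> e n \<theta>" by (rule UU1_le_e)
      finally show "\<bar>wscale d n * (U n \<theta> * U1 n \<theta>)\<bar> \<le> e n \<theta> * (1 / N n)"
        using N_pos[of n] wscale_pos[of n] by (simp add: abs_mult field_simps)
    qed
  qed auto
  have eq: "(LBINT \<theta>. legendre_density d n \<theta> * indicator {a..b} \<theta>)
     = rho n * (((LBINT \<theta>. g n \<theta>) - (wscale d n * (U n b * U1 n b) - wscale d n * (U n a * U1 n a))) / 2)" for n
  proof -
    let ?E = "ultraspherical_ode.energy (legendre d n) (legendre1 d n) (gegenbauer_index d) (N n)"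
    have "2 * N n^2 * (LBINT \<theta>. U n \<theta> ^ 2 * indicator {a..b} \<theta>)
      = (LBINT \<theta>. (?E \<theta> - c / sin \<theta> ^ 2 * U n \<theta> ^ 2) * indicator {a..b} \<theta>)
      - (U n b * U1 n b - U n a * U1 n a)"
      using ultraspherical_ode.integral_u_squared[OF ode ab, of n] unfolding U_def U1_def c_eq .
    then have "wscale d n * (2 * N n^2 * (LBINT \<theta>. U n \<theta> ^ 2 * indicator {a..b} \<theta>))
      = wscale d n * (LBINT \<theta>. (?E \<theta> - c / sin \<theta> ^ 2 * U n \<theta> ^ 2) * indicator {a..b} \<theta>)
      - (wscale d n * (U n b * U1 n b) - wscale d n * (U n a * U1 n a))"
      by (simp only: right_diff_distrib)
    also have "wscale d n * (LBINT \<theta>. (?E \<theta> - c / sin \<theta> ^ 2 * U n \<theta> ^ 2) * indicator {a..b} \<theta>)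
      = (LBINT \<theta>. wscale d n * ((?E \<theta> - c / sin \<theta> ^ 2 * U n \<theta> ^ 2) * indicator {a..b} \<theta>))"
      by simp
    also have "\<dots> = (LBINT \<theta>. g n \<theta>)"
      by (rule Bochner_Integration.integral_cong) (auto simp: g_def e_def r_def algebra_simps)
    finally have 1: "wscale d n * N n^2 * (LBINT \<theta>. U n \<theta> ^ 2 * indicator {a..b} \<theta>) =
      ((LBINT \<theta>. g n \<theta>) - (wscale d n * (U n b * U1 n b) - wscale d n * (U n a * U1 n a))) / 2"
      by simp
    have "(LBINT \<theta>. legendre_density d n \<theta> * indicator {a..b} \<theta>)
      = (LBINT \<theta>. rho n * (wscale d n * N n^2 * (U n \<theta> ^ 2 * indicator {a..b} \<theta>)))"
    proof (rule Bochner_Integration.integral_cong[OF refl])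
      fix \<theta>
      show "legendre_density d n \<theta> * indicator {a..b} \<theta> = rho n * (wscale d n * N n^2 * (U n \<theta> ^ 2 * indicator {a..b} \<theta>))"
        using density_eq[of \<theta> n] pos[of \<theta>] by (cases "\<theta> \<in> {a..b}") auto
    qed
    also have "\<dots> = rho n * (wscale d n * N n^2 * (LBINT \<theta>. U n \<theta> ^ 2 * indicator {a..b} \<theta>))"
      by simp
    finally show ?thesis unfolding 1 .
  qed
  have "(\<lambda>n. rho n * (((LBINT \<theta>. g n \<theta>) - (wscale d n * (U n b * U1 n b) - wscale d n * (U n a * U1 n a))) / 2))
     \<longlonglongrightarrow> 2 / Gamma (real d) * (((LBINT \<theta>. midpoint_limit d * indicator {a..b} \<theta>) - (0 - 0)) / 2)"
    using ab by (intro tendsto_mult rho_tendsto tendsto_divide tendsto_diff lim_g bdry tendsto_const) auto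
  also have "2 / Gamma (real d) * (((LBINT \<theta>. midpoint_limit d * indicator {a..b} \<theta>) - (0 - 0)) / 2)
     = legendre_const d * (b - a)"
    using ab by (simp add: midpoint_limit_def legendre_const_def)
  finally show ?thesis unfolding eq .
qed

end

section \<open>Weak convergence of bounded sequences\<close>

locale bounded_sequence =
  fixes w :: "nat \<Rightarrow> real \<Rightarrow> real" and K :: real
  assumes w_measurable [measurable]: "\<And>n. w n \<in> borel_measurable borel"
    and w_bounded: "\<And>n x. \<bar>w n x\<bar> \<le> K"
begin

text \<open>Weak-star convergence to 0, tested on one function at a time so that the class of
  admissible test functions can be enlarged step by step.\<close>

definition weak_null :: "(real \<Rightarrow> real) \<Rightarrow> bool" where
  "weak_null g \<longleftrightarrow> (\<lambda>n. LBINT x. g x * w n x) \<longlonglongrightarrow> 0"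

lemma K_nonneg: "0 \<le> K"
  using w_bounded[of 0 0] by linarith

lemma integrable_mult_w:
  assumes "integrable lborel g"
  shows "integrable lborel (\<lambda>x. g x * w n x)"
proof (rule Bochner_Integration.integrable_bound)
  show "integrable lborel (\<lambda>x. K * g x)" using assms by simp
  show "(\<lambda>x. g x * w n x) \<in> borel_measurable lborel" using assms by measurable
  show "AE x in lborel. norm (g x * w n x) \<le> norm (K * g x)"
    using w_bounded K_nonneg by (auto simp: abs_mult mult.commute[of K] intro!: mult_left_mono)
qed

lemma weak_null_lin:
  assumes "integrable lborel f" "integrable lborel g" "weak_null f" "weak_null g"
  shows "weak_null (\<lambda>x. a * f x + b * g x)"
proof -
  have "(LBINT x. (a * f x + b * g x) * w n x) = a * (LBINT x. f x * w n x) + b * (LBINT x. g x * w n x)" for n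
  proof -
    have "(LBINT x. (a * f x + b * g x) * w n x) = (LBINT x. a * (f x * w n x) + b * (g x * w n x))"
      by (simp add: algebra_simps)
    then show ?thesis using integrable_mult_w[OF assms(1)] integrable_mult_w[OF assms(2)] by simp
  qed
  moreover have "(\<lambda>n. a * (LBINT x. f x * w n x) + b * (LBINT x. g x * w n x)) \<longlonglongrightarrow> a * 0 + b * 0"
    using assms(3,4) unfolding weak_null_def by (intro tendsto_intros)
  ultimately show ?thesis unfolding weak_null_def by simp
qed

text \<open>Replacing the test function by an \<open>L^1\<close> approximation changes every
  integral by at most \<open>K\<close> times the distance; the uniform bound on \<open>w\<close>
  makes this error independent of \<open>n\<close>.\<close>

lemma weak_null_limit:
  assumes s: "\<And>i. integrable lborel (s i)" "\<And>i. weak_null (s i)"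
    and lim: "\<And>x. (\<lambda>i. s i x) \<longlonglongrightarrow> g x"
    and dom: "integrable lborel G" "\<And>i x. \<bar>s i x\<bar> \<le> G x"
    and g: "integrable lborel g"
  shows "weak_null g"
  unfolding weak_null_def
proof (rule LIMSEQ_I)
  fix e :: real assume e: "e > 0"
  have "(\<lambda>i. LBINT x. \<bar>g x - s i x\<bar>) \<longlonglongrightarrow> (LBINT x::real. 0)"
  proof (rule integral_dominated_convergence)
    show "integrable lborel (\<lambda>x. \<bar>g x\<bar> + G x)" using g dom by simp
    show "AE x in lborel. (\<lambda>i. \<bar>g x - s i x\<bar>) \<longlonglongrightarrow> 0"
    proof (rule AE_I2)
      fix x
      show "(\<lambda>i. \<bar>g x - s i x\<bar>) \<longlonglongrightarrow> 0"
        using tendsto_rabs[OF tendsto_diff[OF tendsto_const lim], of "g x" x] by simp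
    qed
    show "AE x in lborel. norm \<bar>g x - s i x\<bar> \<le> \<bar>g x\<bar> + G x" for i
      using dom(2)[of i] by (auto intro: order_trans[OF abs_triangle_ineq4] add_left_mono)
  qed (use g s in measurable)
  then have "(\<lambda>i. K * (LBINT x. \<bar>g x - s i x\<bar>)) \<longlonglongrightarrow> K * 0" by (intro tendsto_mult tendsto_const) simp
  then have "\<forall>\<^sub>F i in sequentially. K * (LBINT x. \<bar>g x - s i x\<bar>) < e/2"
    using e by (intro order_tendstoD(2)[where y="K * 0"]) auto
  then obtain i where i: "K * (LBINT x. \<bar>g x - s i x\<bar>) < e/2"
    by (auto dest: eventually_happens)
  obtain n0 where n0: "\<And>n. n \<ge> n0 \<Longrightarrow> norm ((LBINT x. s i x * w n x) - 0) < e/2"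
    using LIMSEQ_D[OF s(2)[of i, unfolded weak_null_def], of "e/2"] e by auto
  show "\<exists>n0. \<forall>n\<ge>n0. norm ((LBINT x. g x * w n x) - 0) < e"
  proof (intro exI allI impI)
    fix n assume n: "n0 \<le> n"
    have d: "integrable lborel (\<lambda>x. g x - s i x)" using g s by simp
    have "(LBINT x. g x * w n x) = (LBINT x. s i x * w n x) + (LBINT x. (g x - s i x) * w n x)"
      using integrable_mult_w[OF d, of n] integrable_mult_w[OF s(1), of i n]
      by (subst Bochner_Integration.integral_add[symmetric]) (auto simp: algebra_simps)
    moreover have "\<bar>LBINT x. (g x - s i x) * w n x\<bar> \<le> (LBINT x. K * \<bar>g x - s i x\<bar>)"
    proof (rule order_trans[OF integral_abs_bound], rule integral_mono)
      show "integrable lborel (\<lambda>x. \<bar>(g x - s i x) * w n x\<bar>)" using integrable_mult_w[OF d, of n] by simp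
      show "integrable lborel (\<lambda>x. K * \<bar>g x - s i x\<bar>)" using d by simp
      show "\<bar>(g x - s i x) * w n x\<bar> \<le> K * \<bar>g x - s i x\<bar>" for x
        using w_bounded[of n x] by (simp add: abs_mult mult.commute[of K] mult_left_mono)
    qed
    ultimately show "norm ((LBINT x. g x * w n x) - 0) < e" using n0[OF n] i by simp
  qed
qed

text \<open>Closed intervals generate the Borel sets, and indicator functions are total in \<open>L\<^sup>1\<close>.\<close>

lemma weak_null_integrable:
  assumes intervals: "\<And>a b. p < a \<Longrightarrow> a \<le> b \<Longrightarrow> b < q \<Longrightarrow> weak_null (indicator {a..b})"
    and outside: "\<And>n x. x \<notin> {p<..<q} \<Longrightarrow> w n x = 0"
    and g: "integrable lborel g"
  shows "weak_null g"
proof -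
  let ?J = "{p<..<q}"
  \<comment> \<open>As \<open>w\<close> vanishes outside \<open>?J\<close>, every Borel set may be
    cut down to this bounded interval, which makes its indicator integrable.\<close>
  have J: "weak_null (indicator (A \<inter> ?J)) \<longleftrightarrow> weak_null (indicator A)" for A
  proof -
    have "indicator (A \<inter> ?J) x * w n x = indicator A x * w n x" for n x
      using outside[of x n] by (auto simp: indicator_def)
    then show ?thesis unfolding weak_null_def by (simp only:)
  qed
  have int: "integrable lborel (indicator (A \<inter> ?J) :: real \<Rightarrow> real)" if "A \<in> sets borel" for A
  proof -
    have "emeasure lborel (A \<inter> ?J) \<le> emeasure lborel ?J" by (intro emeasure_mono) auto
    also have "\<dots> < \<infinity>" by (cases "p \<le> q") auto
    finally show ?thesis using that by (intro integrable_real_indicator) auto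
  qed
  have empty: "weak_null (indicator {})" by (simp add: weak_null_def)
  \<comment> \<open>The hypothesis covers only intervals strictly inside \<open>?J\<close>; the
    margin \<open>r i\<close> shrinks to 0 and exhausts the rest.\<close>
  have closed: "weak_null (indicator ({a..b} \<inter> ?J))" for a b
  proof -
    define r where "r = (\<lambda>i. 1 / real (Suc i))"
    have r: "r i > 0" for i by (simp add: r_def)
    define s where "s = (\<lambda>i::nat. indicator {max a (p + r i) .. min b (q - r i)} :: real \<Rightarrow> real)"
    show ?thesis
    proof (rule weak_null_limit[of s])
      show "integrable lborel (s i)" for i unfolding s_def by (intro integrable_real_indicator) (auto simp: emeasure_lborel_Icc_eq)
      show "weak_null (s i)" for i
      proof (cases "max a (p + r i) \<le> min b (q - r i)")
        case True
        have "p < max a (p + r i)" using r[of i] by linarith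
        moreover have "min b (q - r i) < q" using r[of i] by linarith
        ultimately show ?thesis unfolding s_def using True by (intro intervals)
      next
        case False then show ?thesis using empty by (simp add: s_def)
      qed
      \<comment> \<open>The indicator is both the dominating function and the limit, hence one fact
        for two premises.\<close>
      show "integrable lborel (indicator ({a..b} \<inter> ?J) :: real \<Rightarrow> real)" by (rule int) simp
      then show "integrable lborel (indicator ({a..b} \<inter> ?J) :: real \<Rightarrow> real)" .
      show "\<bar>s i x\<bar> \<le> indicator ({a..b} \<inter> ?J) x" for i x
      proof -
        show ?thesis using r[of i] by (auto simp: s_def indicator_def)
      qed
      show "(\<lambda>i. s i x) \<longlonglongrightarrow> indicator ({a..b} \<inter> ?J) x" for x
      proof (cases "x \<in> {a..b} \<inter> ?J")
        case True
        define m where "m = min (x - p) (q - x)"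
        have "m > 0" using True by (simp add: m_def)
        moreover have "r \<longlonglongrightarrow> 0" unfolding r_def by real_asymp
        ultimately have "\<forall>\<^sub>F i in sequentially. r i < m"
          by (intro order_tendstoD(2))
        then have "\<forall>\<^sub>F i in sequentially. s i x = indicator ({a..b} \<inter> ?J) x"
          by eventually_elim (use True in \<open>auto simp: s_def m_def\<close>)
        then show ?thesis by (rule tendsto_eventually)
      next
        case False
        have "s i x = 0" for i
        proof -
          show ?thesis using False r[of i] by (auto simp: s_def indicator_def)
        qed
        then show ?thesis using False by simp
      qed
    qed
  qed
  have sets: "weak_null (indicator (A \<inter> ?J))" if "A \<in> sets borel" for A
  proof -
    let ?G = "range (\<lambda>(a, b). {a..b :: real})"
    have borel: "sets borel = sigma_sets UNIV ?G"
      by (subst borel_eq_atLeastAtMost) (simp add: image_def)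
    have stable: "Int_stable ?G" by (auto simp: Int_stable_def)
    have "A \<in> sigma_sets UNIV ?G" using that borel by simp
    from stable subset_UNIV[of ?G, folded Pow_UNIV] this show ?thesis
    proof (induction rule: sigma_sets_induct_disjoint)
      case (basic A) then show ?case using closed by auto
    next
      case empty then show ?case by (simp add: weak_null_def)
    next
      case (compl A)
      have A: "A \<in> sets borel" using compl(1) borel by simp
      \<comment> \<open>Complements are taken inside \<open>?J\<close>, whose own indicator is
        covered by \<open>closed\<close> with the endpoints \<open>p\<close> and
        \<open>q\<close>.\<close>
      have 1: "weak_null (\<lambda>x. 1 * indicator (UNIV \<inter> ?J) x + (-1) * indicator (A \<inter> ?J) x)"
      proof (rule weak_null_lin[OF int int _ compl(2)])
        show "weak_null (indicator (UNIV \<inter> ?J))" using closed[of p q] by (simp add: Int_absorb1 greaterThanLessThan_subseteq_atLeastAtMost_iff)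
      qed (use A in auto)
      have "(\<lambda>x. 1 * indicator (UNIV \<inter> ?J) x + (-1) * indicator (A \<inter> ?J) x) = (indicator ((UNIV - A) \<inter> ?J) :: real \<Rightarrow> real)"
        by (auto simp: indicator_def)
      then show ?case using 1 by simp
    next
      case (union A)
      have A: "A i \<in> sets borel" for i using union(2) borel by auto
      have fin: "weak_null (\<lambda>x. \<Sum>i<m. indicator (A i \<inter> ?J) x) \<and>
          integrable lborel (\<lambda>x. \<Sum>i<m. indicator (A i \<inter> ?J) x :: real)" for m :: nat
      proof (induction m)
        case 0 then show ?case by (simp add: weak_null_def)
      next
        case (Suc m)
        have "weak_null (\<lambda>x. 1 * (\<Sum>i<m. indicator (A i \<inter> ?J) x) + 1 * indicator (A m \<inter> ?J) x)"
          using Suc.IH union(3)[of m] A[of m] by (intro weak_null_lin int) auto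
        then show ?case using Suc.IH int[OF A[of m]] by simp
      qed
      have U: "(\<Union>i. A i) \<in> sets borel" using A by auto
      have disj: "disjoint_family (\<lambda>i. A i \<inter> ?J)" using union(1) by (auto simp: disjoint_family_on_def)
      have sums: "(\<Sum>i<m. indicator (A i \<inter> ?J) x :: real) = indicator (\<Union>i<m. A i \<inter> ?J) x" for m x
        using disj by (subst indicator_UN_disjoint) (auto simp: disjoint_family_on_def)
      show ?case
      proof (rule weak_null_limit[of "\<lambda>m x. \<Sum>i<m. indicator (A i \<inter> ?J) x"])
        show "integrable lborel (indicator ((\<Union>i. A i) \<inter> ?J) :: real \<Rightarrow> real)" by (rule int[OF U])
        then show "integrable lborel (indicator ((\<Union>i. A i) \<inter> ?J) :: real \<Rightarrow> real)" .
        show "\<bar>\<Sum>i<m. indicator (A i \<inter> ?J) x :: real\<bar> \<le> indicator ((\<Union>i. A i) \<inter> ?J) x" for m x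
          unfolding sums by (auto simp: indicator_def)
        show "(\<lambda>m. \<Sum>i<m. indicator (A i \<inter> ?J) x :: real) \<longlonglongrightarrow> indicator ((\<Union>i. A i) \<inter> ?J) x" for x
        proof (cases "x \<in> (\<Union>i. A i) \<inter> ?J")
          case True
          then obtain i where "x \<in> A i \<inter> ?J" by auto
          then have "\<forall>\<^sub>F m in sequentially. (\<Sum>i<m. indicator (A i \<inter> ?J) x :: real) = indicator ((\<Union>i. A i) \<inter> ?J) x"
            unfolding sums by (intro eventually_mono[OF eventually_gt_at_top[of i]]) (auto simp: indicator_def)
          then show ?thesis by (rule tendsto_eventually)
        next
          case False
          then have "(\<Sum>i<m. indicator (A i \<inter> ?J) x :: real) = 0" for m
            by (auto intro!: sum.neutral simp: indicator_def)
          then show ?thesis using False by simp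
        qed
      qed (use fin in auto)
    qed
  qed
  show ?thesis
    using g
  proof (induction rule: integrable_induct)
    case (base A c)
    have "weak_null (\<lambda>x. c * indicator (A \<inter> ?J) x + 0 * indicator (A \<inter> ?J) x)"
      using base sets int by (intro weak_null_lin) auto
    moreover have "(LBINT x. (c * indicator (A \<inter> ?J) x + 0 * indicator (A \<inter> ?J) x) * w n x)
        = (LBINT x. (indicator A x *\<^sub>R c) * w n x)" for n
    proof (rule Bochner_Integration.integral_cong[OF refl])
      show "(c * indicator (A \<inter> ?J) x + 0 * indicator (A \<inter> ?J) x) * w n x = (indicator A x *\<^sub>R c) * w n x" for x
        using outside[of x n] by (auto simp: indicator_def)
    qed
    ultimately show ?case unfolding weak_null_def by (simp only:)
  next
    case (add f g)
    then show ?case using weak_null_lin[of f g 1 1] by simp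
  next
    case (lim f s)
    show ?case
    proof (rule weak_null_limit[of s])
      show "integrable lborel (\<lambda>x. 2 * norm (f x))" using lim by simp
    qed (use lim in auto)
  qed
qed

text \<open>Apply weak convergence to the Radon-Nikodym density of the image of \<open>h M\<close> under \<open>T\<close>.\<close>

lemma weak_null_distr:
  fixes M :: "'a measure"
  assumes null: "\<And>g. integrable lborel g \<Longrightarrow> weak_null g"
    and T [measurable]: "T \<in> borel_measurable M"
    and ac: "\<And>B :: real set. B \<in> sets borel \<Longrightarrow> emeasure lborel B = 0 \<Longrightarrow> AE x in M. T x \<notin> B"
    and h: "integrable M h"
  shows "(\<lambda>n. \<integral>x. h x * w n (T x) \<partial>M) \<longlonglongrightarrow> 0"
proof -
  have nonneg: "(\<lambda>n. \<integral>x. h x * w n (T x) \<partial>M) \<longlonglongrightarrow> 0" if h: "integrable M h" and pos: "\<And>x. h x \<ge> 0" for h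
  proof -
    have [measurable]: "h \<in> borel_measurable M" using h by simp
    define D0 where "D0 = density M (\<lambda>x. ennreal (h x))"
    define N where "N = distr D0 borel T"
    have T0 [measurable]: "T \<in> borel_measurable D0" by (simp add: D0_def)
    have setsN: "sets N = sets lborel" by (simp add: N_def)
    have ND: "emeasure N B = (\<integral>\<^sup>+x. ennreal (h x) * indicator B (T x) \<partial>M)" if [measurable]: "B \<in> sets borel" for B :: "real set"
    proof -
      have "emeasure N B = emeasure D0 (T -` B \<inter> space M)"
        unfolding N_def by (subst emeasure_distr) (auto simp: D0_def)
      also have "\<dots> = (\<integral>\<^sup>+x. ennreal (h x) * indicator (T -` B \<inter> space M) x \<partial>M)"
        unfolding D0_def by (subst emeasure_density) auto
      also have "\<dots> = (\<integral>\<^sup>+x. ennreal (h x) * indicator B (T x) \<partial>M)"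
        by (intro nn_integral_cong) (auto simp: indicator_def)
      finally show ?thesis .
    qed
    have abs: "absolutely_continuous lborel N"
    proof (unfold absolutely_continuous_def, rule subsetI)
      fix B assume "B \<in> null_sets (lborel :: real measure)"
      then have B: "B \<in> sets borel" "emeasure lborel B = 0" by auto
      have "(\<integral>\<^sup>+x. ennreal (h x) * indicator B (T x) \<partial>M) = (\<integral>\<^sup>+x. 0 \<partial>M)"
        using ac[OF B] by (intro nn_integral_cong_AE) (auto simp: indicator_def elim!: eventually_mono)
      then show "B \<in> null_sets N" using B ND[OF B(1)] setsN by (auto simp: null_sets_def)
    qed
    have fin: "emeasure N UNIV < \<infinity>"
      using ND[of UNIV] h by (simp add: integrable_iff_bounded pos less_top)
    have finN: "finite_measure N"
      by standard (use fin in \<open>auto simp: N_def\<close>)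
    obtain D where D: "D \<in> borel_measurable lborel" "AE x in lborel. RN_deriv lborel N x = ennreal (D x)"
        "\<And>x. 0 \<le> D x"
      using sigma_finite_measure.real_RN_deriv[OF lborel.sigma_finite_measure_axioms finN abs setsN] by metis
    have Deq: "N = density lborel (\<lambda>x. ennreal (D x))"
    proof -
      have "N = density lborel (RN_deriv lborel N)" using sigma_finite_measure.density_RN_deriv[OF lborel.sigma_finite_measure_axioms abs setsN] by simp
      also have "\<dots> = density lborel (\<lambda>x. ennreal (D x))"
        using D by (intro density_cong) auto
      finally show ?thesis .
    qed
    have Dint: "integrable lborel D"
    proof (rule integrableI_nonneg)
      have "emeasure N UNIV = (\<integral>\<^sup>+x. ennreal (D x) \<partial>lborel)"
        unfolding Deq using D by (subst emeasure_density) auto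
      then show "(\<integral>\<^sup>+x. ennreal (D x) \<partial>lborel) < \<infinity>" using fin by simp
    qed (use D in auto)
    have "(\<integral>x. h x * w n (T x) \<partial>M) = (LBINT x. D x * w n x)" for n
    proof -
      have "(\<integral>x. h x * w n (T x) \<partial>M) = (\<integral>x. w n (T x) \<partial>D0)"
        unfolding D0_def by (subst integral_density) (auto simp: pos)
      also have "\<dots> = (\<integral>x. w n x \<partial>N)" unfolding N_def by (subst integral_distr) auto
      also have "\<dots> = (LBINT x. D x * w n x)" unfolding Deq
        using D by (subst integral_density) auto
      finally show ?thesis .
    qed
    then show ?thesis using null[OF Dint] by (simp add: weak_null_def)
  qed
  have int: "integrable M (\<lambda>x. f x * w n (T x))" if f: "integrable M f" for f n
  proof (rule Bochner_Integration.integrable_bound)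
    show "integrable M (\<lambda>x. K * f x)" using f by simp
    show "(\<lambda>x. f x * w n (T x)) \<in> borel_measurable M" using f by measurable
    show "AE x in M. norm (f x * w n (T x)) \<le> norm (K * f x)"
      using w_bounded K_nonneg by (auto simp: abs_mult mult.commute[of K] intro!: mult_left_mono)
  qed
  let ?p = "\<lambda>x. max 0 (h x)" and ?m = "\<lambda>x. max 0 (- h x)"
  have pm: "integrable M ?p" "integrable M ?m" using h by auto
  have "(\<integral>x. h x * w n (T x) \<partial>M) = (\<integral>x. ?p x * w n (T x) \<partial>M) - (\<integral>x. ?m x * w n (T x) \<partial>M)" for n
  proof -
    have "(\<integral>x. h x * w n (T x) \<partial>M) = (\<integral>x. ?p x * w n (T x) - ?m x * w n (T x) \<partial>M)"
      by (intro Bochner_Integration.integral_cong refl) (auto simp: max_def)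
    also have "\<dots> = (\<integral>x. ?p x * w n (T x) \<partial>M) - (\<integral>x. ?m x * w n (T x) \<partial>M)"
      by (intro Bochner_Integration.integral_diff int pm)
    finally show ?thesis .
  qed
  moreover have "(\<lambda>n. (\<integral>x. ?p x * w n (T x) \<partial>M) - (\<integral>x. ?m x * w n (T x) \<partial>M)) \<longlonglongrightarrow> 0 - 0"
    by (intro tendsto_diff nonneg pm) auto
  ultimately show ?thesis by simp
qed

end

section \<open>The surface measure and the polar angle\<close>

lemma sets_restrict_borel_subset: "A \<in> sets (restrict_space borel S) \<Longrightarrow> A \<subseteq> S"
  using sets.sets_into_space[of A "restrict_space borel S"] by (simp add: space_restrict_space)

lemma space_sph_measure [simp]: "space sph_measure = sphere 0 1"
  unfolding sph_measure_def by (subst space_measure_of) (auto dest: sets_restrict_borel_subset)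

lemma sets_sph_measure: "sets (sph_measure :: (real^'n) measure) = sets (restrict_space borel (sphere 0 1))"
  unfolding sph_measure_def
  by (metis sets.sigma_sets_eq sets.space_closed sets_measure_of space_restrict_space2 sets_borel sphere_cball Int_UNIV_right space_borel space_restrict_space)

lemma measurable_sgn_sphere:
  "sgn \<in> restrict_space lborel (cball (0::real^'n) 1 - {0}) \<rightarrow>\<^sub>M restrict_space borel (sphere 0 1)"
proof (rule measurable_restrict_space2)
  show "sgn \<in> space (restrict_space lborel (cball 0 1 - {0})) \<rightarrow> sphere (0::real^'n) 1"
    by (auto simp: space_restrict_space norm_sgn)
  show "sgn \<in> restrict_space lborel (cball (0::real^'n) 1 - {0}) \<rightarrow>\<^sub>M borel"
    unfolding sgn_div_norm[abs_def] by (intro measurable_restrict_space1) measurable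
qed

text \<open>On the punctured ball the radial projection is \<open>sgn\<close>, so cones are
  preimages and the cone measure becomes an image measure.\<close>

lemma sph_cone_eq:
  assumes "A \<subseteq> sphere 0 1"
  shows "sph_cone A = sgn -` A \<inter> (cball (0::real^'n) 1 - {0})"
proof (intro equalityI subsetI)
  fix z assume "z \<in> sph_cone A"
  then obtain t x where z: "z = t *\<^sub>R x" "x \<in> A" "0 < t" "t \<le> 1" by (auto simp: sph_cone_def)
  then have "norm x = 1" using assms by auto
  then show "z \<in> sgn -` A \<inter> (cball 0 1 - {0})" using z by (auto simp: sgn_div_norm)
next
  fix z :: "real^'n" assume z: "z \<in> sgn -` A \<inter> (cball 0 1 - {0})"
  then have "z = norm z *\<^sub>R sgn z" by (simp add: sgn_div_norm)
  then show "z \<in> sph_cone A" using z unfolding sph_cone_def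
    by (intro CollectI exI[of _ "norm z"] exI[of _ "sgn z"]) auto
qed

lemma sph_measure_eq:
  "(sph_measure :: (real^'n) measure) = scale_measure (ennreal (real CARD('n)))
     (distr (restrict_space lborel (cball 0 1 - {0})) (restrict_space borel (sphere 0 1)) sgn)" (is "_ = scale_measure ?c ?D")
proof -
  have sp: "space ?D = sphere 0 1" by (simp add: space_restrict_space)
  have st: "sets ?D = sets (restrict_space borel (sphere (0::real^'n) 1))" by simp
  show ?thesis
    unfolding sph_measure_def scale_measure_def sp st
  proof (rule measure_of_eq)
    show "sets (restrict_space borel (sphere (0::real^'n) 1)) \<subseteq> Pow (sphere 0 1)"
      by (auto dest: sets_restrict_borel_subset)
    fix A assume "A \<in> sigma_sets (sphere 0 1) (sets (restrict_space borel (sphere (0::real^'n) 1)))"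
    then have A: "A \<in> sets (restrict_space borel (sphere (0::real^'n) 1))"
      using sets.sigma_sets_eq[of "restrict_space borel (sphere (0::real^'n) 1)"] by (simp add: space_restrict_space)
    then have A': "A \<subseteq> sphere 0 1" by (auto dest: sets_restrict_borel_subset)
    have "emeasure ?D A = emeasure (restrict_space lborel (cball 0 1 - {0})) (sgn -` A \<inter> (cball (0::real^'n) 1 - {0}))"
      using A measurable_sgn_sphere by (subst emeasure_distr) (auto simp: space_restrict_space)
    also have "\<dots> = emeasure lborel (sgn -` A \<inter> (cball (0::real^'n) 1 - {0}))"
      by (subst emeasure_restrict_space) auto
    finally show "?c * emeasure lborel (sph_cone A) = ?c * emeasure ?D A"
      by (simp add: sph_cone_eq[OF A'])
  qed
qed

lemma nn_integral_sph_measure: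
  assumes "h \<in> borel_measurable (sph_measure :: (real^'n) measure)"
  shows "(\<integral>\<^sup>+x. h x \<partial>(sph_measure :: (real^'n) measure))
    = real CARD('n) * (\<integral>\<^sup>+z. h (sgn z) * indicator (cball 0 1 - {0}) z \<partial>lborel)"
proof -
  have h: "h \<in> borel_measurable (restrict_space borel (sphere (0::real^'n) 1))"
    using assms by (subst (asm) measurable_cong_sets[OF sets_sph_measure refl])
  show ?thesis
    unfolding sph_measure_eq
    by (subst nn_integral_scale_measure)
      (auto simp: h nn_integral_distr[OF measurable_sgn_sphere] nn_integral_restrict_space)
qed

lemma finite_measure_sph_measure: "finite_measure (sph_measure :: (real^'n) measure)"
proof
  have "emeasure (sph_measure :: (real^'n) measure) (space sph_measure) = (\<integral>\<^sup>+x. 1 \<partial>(sph_measure :: (real^'n) measure))"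
    by simp
  also have "\<dots> = real CARD('n) * emeasure lborel (cball (0::real^'n) 1 - {0})"
    by (subst nn_integral_sph_measure) simp_all
  also have "\<dots> < \<infinity>"
  proof -
    have "emeasure lborel (cball (0::real^'n) 1 - {0}) \<le> emeasure lborel (cball (0::real^'n) 1)"
      by (rule emeasure_mono) auto
    also have "\<dots> < \<infinity>" using emeasure_lborel_cball_finite by auto
    finally show ?thesis by (simp add: ennreal_mult_less_top)
  qed
  finally show "emeasure (sph_measure :: (real^'n) measure) (space sph_measure) \<noteq> \<infinity>" by simp
qed

lemma measurable_ident_sph [measurable]: "(\<lambda>x. x) \<in> sph_measure \<rightarrow>\<^sub>M borel"
  unfolding measurable_cong_sets[OF sets_sph_measure refl] by (intro measurable_restrict_space1) simp

text \<open>\<open>arccos\<close> is unspecified outside \<open>[-1, 1]\<close>. Clamping makes the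
  composition continuous on the whole line, hence Borel, without changing it on inner products of
  unit vectors.\<close>

definition clamp1 :: "real \<Rightarrow> real" where "clamp1 t = max (-1) (min 1 t)"

lemma clamp1_eq: "\<bar>t\<bar> \<le> 1 \<Longrightarrow> clamp1 t = t"
  by (auto simp: clamp1_def)

lemma borel_measurable_arccos_clamp [measurable]: "(\<lambda>t. arccos (clamp1 t)) \<in> borel_measurable borel"
  by (intro borel_measurable_continuous_onI continuous_on_arccos) (auto simp: clamp1_def intro!: continuous_intros)

lemma abs_inner_sphere_le_1: "x \<in> sphere 0 1 \<Longrightarrow> y \<in> sphere 0 1 \<Longrightarrow> \<bar>x \<bullet> y\<bar> \<le> 1"
  for x y :: "'a :: real_inner"
  using Cauchy_Schwarz_ineq2[of x y] by simp

section \<open>The polar angle with respect to an axis\<close>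

lemma sin_arccos_eq: "\<bar>t\<bar> \<le> 1 \<Longrightarrow> sin (arccos t) = sqrt (1 - t^2)"
  by (simp add: sin_arccos abs_le_iff)

text \<open>For a unit vector \<open>y\<close>, the distance of \<open>z\<close> from the line
  spanned by \<open>y\<close>.\<close>

definition axis_dist :: "'a::real_inner \<Rightarrow> 'a \<Rightarrow> real" where "axis_dist y z = norm (z - (z \<bullet> y) *\<^sub>R y)"

lemma axis_dist_squared: "norm y = 1 \<Longrightarrow> axis_dist y z ^ 2 = norm z ^ 2 - (z \<bullet> y)^2"
  unfolding axis_dist_def power2_norm_eq_inner
  by (simp add: inner_diff_left inner_diff_right inner_commute power2_eq_square norm_eq_1)

lemma axis_dist_translate: "norm y = 1 \<Longrightarrow> axis_dist y (z + s *\<^sub>R y) = axis_dist y z"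
  by (simp add: axis_dist_def inner_add_left norm_eq_1 algebra_simps)

lemma sin_arccos_sgn:
  assumes "norm y = 1" "z \<noteq> 0"
  shows "sin (arccos (sgn z \<bullet> y)) = axis_dist y z / norm z"
proof -
  have "\<bar>sgn z \<bullet> y\<bar> \<le> 1" using assms by (intro abs_inner_sphere_le_1) (auto simp: norm_sgn)
  then have "sin (arccos (sgn z \<bullet> y)) = sqrt (1 - (sgn z \<bullet> y)^2)" by (rule sin_arccos_eq)
  also have "1 - (sgn z \<bullet> y)^2 = (axis_dist y z / norm z)^2"
    using assms by (simp add: axis_dist_squared sgn_div_norm power_divide power_mult_distrib field_simps)
  also have "sqrt \<dots> = axis_dist y z / norm z" by (simp add: axis_dist_def)
  finally show ?thesis .
qed

lemma axis_dist_eq_0_iff: "norm y = 1 \<Longrightarrow> axis_dist y z = 0 \<longleftrightarrow> z \<in> span {y}"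
  by (auto simp: axis_dist_def span_singleton norm_eq_1 inner_commute)

text \<open>Moving \<open>z\<close> along the axis changes only its axial coordinate, so
  \<open>cot \<theta>\<close> is affine in \<open>s\<close>. Solving for \<open>s\<close> gives a
  smooth function of the angle, which preserves null sets.\<close>

lemma polar_angle_translate:
  assumes y: "norm y = 1" and r: "axis_dist y z > 0"
    and \<theta>: "\<theta> = arccos (sgn (z + s *\<^sub>R y) \<bullet> y)"
  shows "0 < \<theta>" "\<theta> < pi" "s = axis_dist y z * cot \<theta> - z \<bullet> y"
proof -
  let ?w = "z + s *\<^sub>R y"
  have rw: "axis_dist y ?w = axis_dist y z" using y by (rule axis_dist_translate)
  have w0: "?w \<noteq> 0" using r rw by (auto simp: axis_dist_def)
  have le: "\<bar>sgn ?w \<bullet> y\<bar> \<le> 1" using y w0 by (intro abs_inner_sphere_le_1) (auto simp: norm_sgn)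
  have s: "sin \<theta> = axis_dist y z / norm ?w" unfolding \<theta> sin_arccos_sgn[OF y w0] rw ..
  then have spos: "sin \<theta> > 0" using r w0 by simp
  have b: "0 \<le> \<theta>" "\<theta> \<le> pi" unfolding \<theta> using le by (auto intro!: arccos_lbound arccos_ubound)
  then show "0 < \<theta>" "\<theta> < pi" using spos by (auto simp: less_le)
  have "cos \<theta> = sgn ?w \<bullet> y" unfolding \<theta> using le by (intro cos_arccos) auto
  also have "\<dots> = (z \<bullet> y + s) / norm ?w"
    using y by (simp add: sgn_div_norm inner_add_left norm_eq_1 divide_inverse mult.commute)
  finally have "cot \<theta> = (z \<bullet> y + s) / axis_dist y z" using s w0 r by (simp add: cot_def)
  then show "s = axis_dist y z * cot \<theta> - z \<bullet> y" using r by simp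
qed

text \<open>A differentiable map of the line sends null sets to null sets. Assuming an inclusion
  instead of an equality avoids asking whether the image is measurable.\<close>

lemma null_sets_cot_image:
  fixes S :: "real set"
  assumes B: "B \<in> null_sets lborel" and S: "S \<in> sets borel"
    and sub: "S \<subseteq> (\<lambda>\<theta>. r * cot \<theta> - c) ` (B \<inter> {0<..<pi})"
  shows "emeasure lborel S = 0"
proof -
  have "negligible (B \<inter> {0<..<pi})"
    using B null_sets_completionI[of B lborel] by (intro negligible_Int) (simp add: negligible_iff_null_sets)
  moreover have "(\<lambda>\<theta>. r * cot \<theta> - c) differentiable_on (B \<inter> {0<..<pi})"
  proof (intro differentiable_at_imp_differentiable_on)
    fix \<theta> assume "\<theta> \<in> B \<inter> {0<..<pi}"
    then have "sin \<theta> > 0" by (auto intro: sin_gt_zero)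
    then have "((\<lambda>\<theta>. r * cot \<theta> - c) has_real_derivative r * (- inverse ((sin \<theta>)\<^sup>2)) - 0) (at \<theta>)"
      by (intro DERIV_diff DERIV_cmult DERIV_cot DERIV_const) auto
    then show "(\<lambda>\<theta>. r * cot \<theta> - c) differentiable (at \<theta>)"
      using real_differentiable_def by blast
  qed
  ultimately have "negligible ((\<lambda>\<theta>. r * cot \<theta> - c) ` (B \<inter> {0<..<pi}))"
    by (intro negligible_differentiable_image_negligible) auto
  then have "negligible S" using sub by (rule negligible_subset)
  then have "emeasure lebesgue S = 0" by (simp add: negligible_iff_emeasure0 S)
  then show ?thesis using S by simp
qed

text \<open>Averaging over translations along the axis replaces a choice of coordinates: on almost every
  line parallel to the axis the polar angle is \<open>arccot\<close> of an affine function.\<close>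

lemma AE_sph_polar_angle:
  fixes y :: "real^'n"
  assumes dim: "CARD('n) \<ge> 2" and y: "norm y = 1" and B: "B \<in> null_sets lborel"
  shows "AE x in sph_measure. arccos (x \<bullet> y) \<notin> B"
proof -
  have Bb [measurable]: "B \<in> sets borel" using B by auto
  \<comment> \<open>The cone over the exceptional set, extended to the whole space so that
    translations act on it.\<close>
  define A where "A = {z :: real^'n. z \<noteq> 0 \<and> arccos (clamp1 (sgn z \<bullet> y)) \<in> B}"
  have A [measurable]: "A \<in> sets borel"
    unfolding A_def sgn_div_norm by measurable
  have clamp: "clamp1 (sgn z \<bullet> y) = sgn z \<bullet> y" if "z \<noteq> 0" for z
    using that y by (intro clamp1_eq abs_inner_sphere_le_1) (auto simp: norm_sgn)
  have inner: "emeasure lborel {s. z + s *\<^sub>R y \<in> A} = 0" if z: "z \<notin> span {y}" for z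
  proof (rule null_sets_cot_image[OF B])
    show "{s. z + s *\<^sub>R y \<in> A} \<in> sets borel" by measurable
    have r: "axis_dist y z > 0" using axis_dist_eq_0_iff[OF y, of z] z by (simp add: axis_dist_def)
    show "{s. z + s *\<^sub>R y \<in> A} \<subseteq> (\<lambda>\<theta>. axis_dist y z * cot \<theta> - z \<bullet> y) ` (B \<inter> {0<..<pi})"
    proof safe
      fix s assume s: "z + s *\<^sub>R y \<in> A"
      define \<theta> where "\<theta> = arccos (sgn (z + s *\<^sub>R y) \<bullet> y)"
      have "\<theta> \<in> B" using s clamp[of "z + s *\<^sub>R y"] by (auto simp: A_def \<theta>_def)
      then show "s \<in> (\<lambda>\<theta>. axis_dist y z * cot \<theta> - z \<bullet> y) ` (B \<inter> {0<..<pi})"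
        using polar_angle_translate[OF y r \<theta>_def] by (intro image_eqI[of _ _ \<theta>]) auto
    qed
  qed
  \<comment> \<open>The axis itself, where the change of variable breaks down, is a null set since
    the dimension is at least 2.\<close>
  have span: "AE z in lborel. z \<notin> span {y}"
  proof (rule AE_not_in)
    have "dim (span {y}) \<le> 1" using dim_le_card[of "span {y}" "{y}"] by simp
    then have "negligible (span {y})" using dim by (intro negligible_lowdim) auto
    moreover have "span {y} \<in> sets borel" using closed_span by (intro borel_closed)
    ultimately show "span {y} \<in> null_sets lborel"
      by (simp add: negligible_iff_emeasure0 null_sets_def)
  qed
  \<comment> \<open>The factor \<open>indicator {0..1}\<close> has integral 1. Translation
    invariance replaces \<open>A\<close> by its translates along \<open>y\<close>, and exchanging
    the integrals leaves a one-dimensional measure on each line.\<close>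
  have "emeasure lborel A = (\<integral>\<^sup>+s. emeasure lborel A * indicator {0..1::real} s \<partial>lborel)"
    by (subst nn_integral_cmult_indicator) auto
  also have "\<dots> = (\<integral>\<^sup>+s. (\<integral>\<^sup>+z. indicator A (z + s *\<^sub>R y) * indicator {0..1} s \<partial>lborel) \<partial>lborel)"
  proof (intro nn_integral_cong)
    fix s :: real
    have "emeasure lborel A = (\<integral>\<^sup>+z. indicator A z \<partial>lborel)" by simp
    also have "\<dots> = (\<integral>\<^sup>+z. indicator A z \<partial>distr lborel borel ((+) (s *\<^sub>R y)))" by (simp add: lborel_distr_plus)
    also have "\<dots> = (\<integral>\<^sup>+z. indicator A (s *\<^sub>R y + z) \<partial>lborel)" by (subst nn_integral_distr) auto
    finally show "emeasure lborel A * indicator {0..1} s = (\<integral>\<^sup>+z. indicator A (z + s *\<^sub>R y) * indicator {0..1} s \<partial>lborel)"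
      by (subst nn_integral_multc) (auto simp: add.commute)
  qed
  also have "\<dots> = (\<integral>\<^sup>+z. (\<integral>\<^sup>+s. indicator A (z + s *\<^sub>R y) * indicator {0..1} s \<partial>lborel) \<partial>lborel)"
    by (rule lborel_pair.Fubini') measurable
  also have "\<dots> = (\<integral>\<^sup>+z. 0 \<partial>(lborel :: (real^'n) measure))"
  proof (rule nn_integral_cong_AE, rule eventually_mono[OF span])
    fix z assume z: "z \<notin> span {y}"
    have "(\<integral>\<^sup>+s. indicator A (z + s *\<^sub>R y) * indicator {0..1} s \<partial>lborel) \<le> (\<integral>\<^sup>+s. indicator {s. z + s *\<^sub>R y \<in> A} s \<partial>lborel)"
      by (intro nn_integral_mono) (auto simp: indicator_def)
    also have "\<dots> = emeasure lborel {s. z + s *\<^sub>R y \<in> A}" by (intro nn_integral_indicator) measurable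
    finally show "(\<integral>\<^sup>+s. indicator A (z + s *\<^sub>R y) * indicator {0..1} s \<partial>lborel) = 0"
      unfolding inner[OF z] by simp
  qed
  finally have A0: "emeasure lborel A = 0" by simp
  define Z where "Z = {x \<in> space (sph_measure :: (real^'n) measure). arccos (clamp1 (x \<bullet> y)) \<in> B}"
  have Z: "Z \<in> sets sph_measure" unfolding Z_def by measurable
  have "emeasure sph_measure Z = (\<integral>\<^sup>+x. indicator Z x \<partial>sph_measure)" using Z by simp
  also have "\<dots> = real CARD('n) * (\<integral>\<^sup>+z. indicator Z (sgn z) * indicator (cball 0 1 - {0}) z \<partial>lborel)"
    using Z by (intro nn_integral_sph_measure) auto
  also have "(\<integral>\<^sup>+z. indicator Z (sgn z) * indicator (cball 0 1 - {0}) z \<partial>lborel) \<le> (\<integral>\<^sup>+z. indicator A z \<partial>lborel)"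
    by (intro nn_integral_mono) (auto simp: indicator_def A_def Z_def)
  finally have "emeasure sph_measure Z = 0" using A0 by (simp add: mult_left_mono)
  then have "AE x in sph_measure. x \<notin> Z" using Z by (intro AE_not_in) (auto simp: null_sets_def)
  moreover have "clamp1 (x \<bullet> y) = x \<bullet> y" if "x \<in> sphere 0 1" for x
    using that y by (intro clamp1_eq abs_inner_sphere_le_1) auto
  ultimately show ?thesis by (elim AE_mp) (auto intro!: AE_I2 simp: Z_def)
qed

text \<open>The part of the unit ball within distance \<open>2\<^sup>-\<^sup>j\<close> of the axis is covered by \<open>O(2\<^sup>j)\<close>
  balls of radius \<open>2 \<cdot> 2\<^sup>-\<^sup>j\<close>.\<close>

lemma emeasure_tube_le:
  fixes y :: "real^'n"
  assumes y: "norm y = 1"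
  shows "emeasure lborel {z \<in> cball 0 1. axis_dist y z \<le> 1 / 2^j}
    \<le> ennreal (3 * 2 ^ CARD('n) * unit_ball_vol (real CARD('n)) / 2 ^ (j * (CARD('n) - 1)))"
proof -
  \<comment> \<open>The centres lie on the axis at spacing \<open>1 / 2^j\<close>. The radius adds
    the distance from the axis and the rounding error along it, each at most
    \<open>1 / 2^j\<close>.\<close>
  define b where "b = (\<lambda>k::int. cball ((of_int k / 2^j) *\<^sub>R y) (2 / 2^j))"
  define I where "I = {- (2^j) .. 2^j :: int}"
  have sub: "{z \<in> cball 0 1. axis_dist y z \<le> 1 / 2^j} \<subseteq> (\<Union>k\<in>I. b k)"
  proof
    fix z assume "z \<in> {z \<in> cball 0 1. axis_dist y z \<le> 1 / 2^j}"
    then have z: "norm z \<le> 1" "axis_dist y z \<le> 1 / 2^j" by auto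
    define t where "t = z \<bullet> y"
    have t: "\<bar>t\<bar> \<le> 1" using Cauchy_Schwarz_ineq2[of z y] y z by (simp add: t_def)
    define k where "k = \<lfloor>t * 2^j\<rfloor>"
    have k: "of_int k \<le> t * 2^j" "t * 2^j < of_int k + 1" by (auto simp: k_def)
    have "\<bar>t * 2^j\<bar> \<le> 1 * 2^j" using t unfolding abs_mult by (intro mult_mono) auto
    then have tj: "- of_int (2^j) \<le> t * 2^j" "t * 2^j \<le> of_int (2^j)" by (auto simp: abs_le_iff)
    then have "of_int k \<le> (of_int (2^j) :: real)" using k(1) by linarith
    then have "k \<le> 2^j" by (simp only: of_int_le_iff)
    then have "k \<in> I" using tj(1) unfolding I_def k_def by (auto simp: le_floor_iff)
    moreover have "norm (z - (of_int k / 2^j) *\<^sub>R y) \<le> 2 / 2^j"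
    proof -
      have "z - (of_int k / 2^j) *\<^sub>R y = (z - t *\<^sub>R y) + (t - of_int k / 2^j) *\<^sub>R y"
        by (simp add: algebra_simps)
      then have "norm (z - (of_int k / 2^j) *\<^sub>R y) \<le> norm (z - t *\<^sub>R y) + \<bar>t - of_int k / 2^j\<bar>"
        using norm_triangle_ineq[of "z - t *\<^sub>R y" "(t - of_int k / 2^j) *\<^sub>R y"] y by (simp only: norm_scaleR) simp
      also have "norm (z - t *\<^sub>R y) \<le> 1 / 2^j" using z by (simp add: axis_dist_def t_def)
      also have "\<bar>t - of_int k / 2^j\<bar> \<le> 1 / 2^j"
      proof -
        have "t - of_int k / 2^j = (t * 2^j - of_int k) / 2^j" by (simp add: field_simps)
        then show ?thesis using k by (simp add: divide_right_mono)
      qed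
      finally show ?thesis by simp
    qed
    ultimately show "z \<in> (\<Union>k\<in>I. b k)"
      by (auto simp: b_def dist_norm norm_minus_commute)
  qed
  have "emeasure lborel {z \<in> cball 0 1. axis_dist y z \<le> 1 / 2^j} \<le> emeasure lborel (\<Union>k\<in>I. b k)"
    using sub by (intro emeasure_mono) (auto simp: b_def I_def)
  also have "\<dots> \<le> (\<Sum>k\<in>I. emeasure lborel (b k))"
    by (intro emeasure_subadditive_finite) (auto simp: I_def b_def)
  also have "\<dots> = (\<Sum>k\<in>I. ennreal (unit_ball_vol (real CARD('n)) * (2 / 2^j) ^ CARD('n)))"
    by (intro sum.cong refl) (simp add: b_def emeasure_cball)
  also have "\<dots> = ennreal (real (card I) * (unit_ball_vol (real CARD('n)) * (2 / 2^j) ^ CARD('n)))"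
    by (simp add: ennreal_mult' ennreal_of_nat_eq_real_of_nat)
  also have "\<dots> \<le> ennreal (3 * 2 ^ CARD('n) * unit_ball_vol (real CARD('n)) / 2 ^ (j * (CARD('n) - 1)))"
  proof (rule ennreal_leI)
    have "real (card I) = 2 * 2^j + 1" by (simp add: I_def nat_add_distrib)
    also have "\<dots> \<le> 3 * 2^j" by simp
    finally have "real (card I) * (unit_ball_vol (real CARD('n)) * (2 / 2^j) ^ CARD('n))
       \<le> 3 * 2^j * (unit_ball_vol (real CARD('n)) * (2 / 2^j) ^ CARD('n))"
      by (intro mult_right_mono) (auto intro!: mult_nonneg_nonneg unit_ball_vol_nonneg)
    also have "\<dots> = 3 * 2 ^ CARD('n) * unit_ball_vol (real CARD('n)) / 2 ^ (j * (CARD('n) - 1))"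
    proof -
      obtain m where "CARD('n) = Suc m" using zero_less_card_finite[where 'a='n] gr0_implies_Suc by blast
      then show ?thesis by (simp add: power_divide power_mult)
    qed
    finally show "real (card I) * (unit_ball_vol (real CARD('n)) * (2 / 2^j) ^ CARD('n))
       \<le> 3 * 2 ^ CARD('n) * unit_ball_vol (real CARD('n)) / 2 ^ (j * (CARD('n) - 1))" .
  qed
  finally show ?thesis .
qed

lemma axis_dist_le_norm: "norm y = 1 \<Longrightarrow> axis_dist y z \<le> norm z"
proof -
  assume "norm y = 1"
  then have "axis_dist y z ^ 2 \<le> norm z ^ 2" by (simp add: axis_dist_squared)
  then show ?thesis by (rule power2_le_imp_le) simp
qed

text \<open>Dyadic shells around the axis: at distance about \<open>1 / 2^j\<close> the integrand is
  at most \<open>2 ^ (Suc j * m)\<close>, while the tube has volume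
  \<open>O(1 / 2 ^ (j * (m + 1)))\<close>. The surplus factor \<open>1 / 2^j\<close> makes the
  series geometric.\<close>

lemma nn_integral_axis_singularity:
  fixes y :: "real^'n"
  assumes dim: "CARD('n) \<ge> 2" and y: "norm y = 1"
  shows "(\<integral>\<^sup>+z. ennreal (1 / axis_dist y z ^ (CARD('n) - 2)) * indicator (cball 0 1) z \<partial>lborel)
    \<le> ennreal (3 * 4 ^ CARD('n) * unit_ball_vol (real CARD('n)))"
proof -
  define m where "m = CARD('n) - 2"
  have n: "CARD('n) = m + 2" using dim by (simp add: m_def)
  define t where "t = (\<lambda>j. {z :: real^'n. z \<in> cball 0 1 \<and> axis_dist y z \<le> 1 / 2^j})"
  have t [measurable]: "t j \<in> sets borel" for j unfolding t_def axis_dist_def by measurable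
  have "(\<integral>\<^sup>+z. ennreal (1 / axis_dist y z ^ m) * indicator (cball 0 1) z \<partial>lborel)
     \<le> (\<integral>\<^sup>+z. (\<Sum>j. ennreal (2 ^ (Suc j * m)) * indicator (t j) z) \<partial>lborel)"
  proof (intro nn_integral_mono)
    fix z :: "real^'n"
    show "ennreal (1 / axis_dist y z ^ m) * indicator (cball 0 1) z \<le> (\<Sum>j. ennreal (2 ^ (Suc j * m)) * indicator (t j) z)"
    proof (cases "z \<in> cball 0 1")
      case True
      have single: "f j \<le> (\<Sum>j. f j)" for f :: "nat \<Rightarrow> ennreal" and j
        using sum_le_suminf[OF summableI, of "{j}" f] by simp
      have one: "ennreal (2 ^ (Suc j * m)) * indicator (t j) z \<le> (\<Sum>j. ennreal (2 ^ (Suc j * m)) * indicator (t j) z)" for j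
        by (rule single)
      show ?thesis
      proof (cases "axis_dist y z = 0")
        case True': True
        \<comment> \<open>On the axis the quotient is 0 by convention, or 1 if \<open>m = 0\<close>;
          the term with index 0 covers both.\<close>
        have "1 / axis_dist y z ^ m \<le> 1" using True' by (cases m) auto
        also have "1 \<le> (2::real) ^ (Suc 0 * m)" by simp
        finally have "ennreal (1 / axis_dist y z ^ m) * indicator (cball 0 1) z \<le> ennreal (2 ^ (Suc 0 * m)) * indicator (t 0) z"
          using True True' by (simp add: t_def ennreal_leI del: mult_Suc)
        then show ?thesis using one[of 0] by (rule order_trans)
      next
        case False
        then have r0: "axis_dist y z > 0" by (simp add: axis_dist_def)
        have r1: "axis_dist y z \<le> 1" using axis_dist_le_norm[OF y, of z] True by simp
        define P where "P = (\<lambda>j. axis_dist y z > 1 / 2^Suc j)"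
        have "\<exists>j. P j"
        proof -
          obtain j where "(1/2)^j < axis_dist y z" using real_arch_pow_inv[OF r0, of "1/2"] by auto
          moreover have "(1/2::real)^Suc j \<le> (1/2)^j" by simp
          ultimately have "1 / 2^Suc j < axis_dist y z" by (simp add: power_one_over)
          then show ?thesis unfolding P_def by blast
        qed
        then obtain j where j: "P j" "\<And>i. i < j \<Longrightarrow> \<not> P i"
          using exists_least_iff[of P] by blast
        have rj: "axis_dist y z \<le> 1 / 2^j"
        proof (cases j)
          case 0 then show ?thesis using r1 by simp
        next
          case (Suc i) then show ?thesis using j(2)[of i] by (simp add: P_def)
        qed
        have "1 / axis_dist y z < 2 ^ Suc j" using j(1) r0 by (simp add: P_def field_simps)
        then have "(1 / axis_dist y z) ^ m \<le> (2 ^ Suc j) ^ m" using r0 by (intro power_mono) auto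
        then have "1 / axis_dist y z ^ m \<le> 2 ^ (Suc j * m)" by (simp add: power_one_over power_mult del: mult_Suc power_Suc)
        then have "ennreal (1 / axis_dist y z ^ m) * indicator (cball 0 1) z \<le> ennreal (2 ^ (Suc j * m)) * indicator (t j) z"
          using True rj by (simp add: t_def ennreal_leI del: mult_Suc)
        then show ?thesis using one[of j] by (rule order_trans)
      qed
    qed simp
  qed
  also have "\<dots> = (\<Sum>j. (\<integral>\<^sup>+z. ennreal (2 ^ (Suc j * m)) * indicator (t j) z \<partial>lborel))"
    by (rule nn_integral_suminf) measurable
  also have "\<dots> = (\<Sum>j. ennreal (2 ^ (Suc j * m)) * emeasure lborel (t j))"
    by (simp add: nn_integral_cmult_indicator)
  also have "\<dots> \<le> (\<Sum>j. ennreal (3 * 4 ^ CARD('n) * unit_ball_vol (real CARD('n)) * (1/2)^Suc j))"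
  proof (intro suminf_le summableI)
    fix j
    let ?v = "unit_ball_vol (real CARD('n))"
    have v: "?v \<ge> 0" by (rule unit_ball_vol_nonneg) simp
    have "ennreal (2 ^ (Suc j * m)) * emeasure lborel (t j)
      \<le> ennreal (2 ^ (Suc j * m)) * ennreal (3 * 2 ^ CARD('n) * ?v / 2 ^ (j * (CARD('n) - 1)))"
      using emeasure_tube_le[OF y, of j] unfolding t_def by (intro mult_left_mono) auto
    also have "\<dots> = ennreal (2 ^ (Suc j * m) * (3 * 2 ^ CARD('n) * ?v / 2 ^ (j * (CARD('n) - 1))))"
      using v by (subst ennreal_mult) auto
    also have "2 ^ (Suc j * m) * (3 * 2 ^ CARD('n) * ?v / 2 ^ (j * (CARD('n) - 1))) = 3 * (2 ^ (m + 1) * 2 ^ CARD('n)) * ?v * (1/2)^Suc j"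
      by (simp add: n power_add power_divide field_simps)
    also have "\<dots> \<le> 3 * 4 ^ CARD('n) * ?v * (1/2)^Suc j"
    \<comment> \<open>Rounds \<open>m + 1\<close> up to \<open>CARD('n)\<close> for a simpler
      constant.\<close>
    proof -
      have "(2::real) ^ (m + 1) * 2 ^ CARD('n) \<le> 2 ^ CARD('n) * 2 ^ CARD('n)"
        by (intro mult_right_mono) (auto simp: n)
      also have "\<dots> = 4 ^ CARD('n)" by (simp add: power_mult_distrib[symmetric])
      finally show ?thesis using v by (intro mult_right_mono mult_left_mono) auto
    qed
    finally show "ennreal (2 ^ (Suc j * m)) * emeasure lborel (t j) \<le> ennreal (3 * 4 ^ CARD('n) * ?v * (1/2)^Suc j)"
      by (simp add: ennreal_leI)
  qed
  also have "\<dots> = ennreal (3 * 4 ^ CARD('n) * unit_ball_vol (real CARD('n)) * 1)"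
    using unit_ball_vol_nonneg[of "real CARD('n)"] by (intro suminf_ennreal_eq sums_mult power_half_series) auto
  finally show ?thesis by (simp add: m_def)
qed

section \<open>Products of spheres\<close>

lemma sphere_in_sets_sph [simp]: "sphere 0 1 \<in> sets sph_measure"
  using sets.top[of sph_measure] by simp

interpretation sph: finite_measure "sph_measure :: (real^'n) measure"
  by (rule finite_measure_sph_measure)

interpretation sph_pair: pair_sigma_finite "sph_measure :: (real^'n) measure" "sph_measure :: (real^'n) measure"
  by unfold_locales

interpretation sph_prod: product_sigma_finite "\<lambda>_::nat. sph_measure :: (real^'n) measure"
  by unfold_locales

section \<open>Pairs of points and the angle between them\<close>

abbreviation sph2 :: "((real^'n) \<times> (real^'n)) measure" where
  "sph2 \<equiv> sph_measure \<Otimes>\<^sub>M sph_measure"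

lemma sigma_finite_sph2: "sigma_finite_measure (sph2 :: ((real^'n) \<times> (real^'n)) measure)"
  by (rule sph_pair.P.sigma_finite_measure_axioms)

definition angle :: "'a::real_inner \<times> 'a \<Rightarrow> real" where
  "angle p = arccos (fst p \<bullet> snd p)"

text \<open>The exponent is d - 1, so this is the weight in the theorem; multiplied by
  \<open>legendre_density\<close> at the angle it gives \<open>kdim\<close> times the squared
  polynomial.\<close>

definition singular :: "(real^'n) \<times> (real^'n) \<Rightarrow> real" where
  "singular p = 1 / sin (angle p) ^ (CARD('n) - 2)"

lemma measurable_fst_sph2 [measurable]: "fst \<in> sph2 \<rightarrow>\<^sub>M borel"
  and measurable_snd_sph2 [measurable]: "snd \<in> sph2 \<rightarrow>\<^sub>M borel"
  by (rule measurable_compose[OF measurable_fst measurable_ident_sph],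
      rule measurable_compose[OF measurable_snd measurable_ident_sph])

lemma angle_clamp: "fst p \<in> sphere 0 1 \<Longrightarrow> snd p \<in> sphere 0 1 \<Longrightarrow> angle p = arccos (clamp1 (fst p \<bullet> snd p))"
  unfolding angle_def by (subst clamp1_eq) (auto intro!: abs_inner_sphere_le_1)

lemma borel_measurable_angle [measurable]: "angle \<in> borel_measurable (sph2 :: ((real^'n) \<times> (real^'n)) measure)"
proof -
  have "(\<lambda>p. arccos (clamp1 (fst p \<bullet> snd p))) \<in> borel_measurable (sph2 :: ((real^'n) \<times> (real^'n)) measure)"
    by measurable
  then show ?thesis
    by (subst measurable_cong[where g="\<lambda>p. arccos (clamp1 (fst p \<bullet> snd p))"])
      (auto simp: space_pair_measure intro!: angle_clamp)
qed

lemma borel_measurable_singular [measurable]: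
  "singular \<in> borel_measurable (sph2 :: ((real^'n) \<times> (real^'n)) measure)"
  unfolding singular_def[abs_def] by measurable

lemma angle_bounds:
  assumes "x \<in> sphere 0 1" "y \<in> sphere 0 1"
  shows "0 \<le> angle (x, y)" "angle (x, y) \<le> pi" "cos (angle (x, y)) = x \<bullet> y"
proof -
  have "\<bar>x \<bullet> y\<bar> \<le> 1" using abs_inner_sphere_le_1[OF assms] .
  then show "0 \<le> angle (x, y)" "angle (x, y) \<le> pi" "cos (angle (x, y)) = x \<bullet> y"
    by (auto simp: angle_def abs_le_iff intro!: arccos_lbound arccos_ubound cos_arccos)
qed

lemma singular_nonneg: "x \<in> sphere 0 1 \<Longrightarrow> y \<in> sphere 0 1 \<Longrightarrow> singular (x, y) \<ge> 0"
  unfolding singular_def by (intro divide_nonneg_nonneg zero_le_power sin_ge_zero angle_bounds) auto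

lemma angle_commute: "angle (x, y) = angle (y, x)"
  by (simp add: angle_def inner_commute)

lemma AE_sph2_angle:
  assumes dim: "CARD('n) \<ge> 2" and B: "B \<in> null_sets lborel"
  shows "AE p in (sph2 :: ((real^'n) \<times> (real^'n)) measure). angle p \<notin> B"
proof (rule sph_pair.AE_pair_measure)
  have [measurable]: "B \<in> sets borel" using B by auto
  show "{p \<in> space (sph2 :: ((real^'n) \<times> (real^'n)) measure). angle p \<notin> B} \<in> sets sph2"
    by measurable
  show "AE x in (sph_measure :: (real^'n) measure). AE y in sph_measure. angle (x, y) \<notin> B"
  proof (rule AE_I2)
    fix x assume "x \<in> space (sph_measure :: (real^'n) measure)"
    then have "norm x = 1" by simp
    then show "AE y in sph_measure. angle (x, y) \<notin> B"
      using AE_sph_polar_angle[OF dim _ B, of x] by (simp add: angle_def inner_commute)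
  qed
qed

lemma AE_sph2_angle_interior:
  assumes dim: "CARD('n) \<ge> 2"
  shows "AE p in (sph2 :: ((real^'n) \<times> (real^'n)) measure). 0 < angle p \<and> angle p < pi"
proof -
  have "{0, pi} \<in> null_sets (lborel :: real measure)"
    by (simp add: null_sets_def emeasure_lborel_countable)
  from AE_sph2_angle[OF dim this] AE_space show ?thesis
    by eventually_elim (use angle_bounds in \<open>auto simp: space_pair_measure less_le\<close>)
qed

text \<open>Under radial projection the weight becomes
  \<open>norm z ^ ?m / axis_dist y z ^ ?m\<close>, and the numerator is at most 1 in the
  ball.\<close>

lemma nn_integral_singular_le:
  fixes y :: "real^'n"
  assumes dim: "CARD('n) \<ge> 2" and y: "y \<in> sphere 0 1"
  shows "(\<integral>\<^sup>+x. ennreal (singular (x, y)) \<partial>sph_measure)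
    \<le> real CARD('n) * ennreal (3 * 4 ^ CARD('n) * unit_ball_vol (real CARD('n)))"
proof -
  let ?m = "CARD('n) - 2"
  have y1: "norm y = 1" using y by simp
  have [measurable]: "(\<lambda>x. (x, y)) \<in> sph_measure \<rightarrow>\<^sub>M sph2"
    using y by (intro measurable_Pair) auto
  have "(\<integral>\<^sup>+x. ennreal (singular (x, y)) \<partial>sph_measure)
    = real CARD('n) * (\<integral>\<^sup>+z. ennreal (singular (sgn z, y)) * indicator (cball 0 1 - {0}) z \<partial>lborel)"
    by (rule nn_integral_sph_measure) measurable
  also have "(\<integral>\<^sup>+z. ennreal (singular (sgn z, y)) * indicator (cball 0 1 - {0}) z \<partial>lborel)
    \<le> (\<integral>\<^sup>+z. ennreal (1 / axis_dist y z ^ ?m) * indicator (cball 0 1) z \<partial>lborel)"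
  proof (intro nn_integral_mono)
    fix z :: "real^'n"
    show "ennreal (singular (sgn z, y)) * indicator (cball 0 1 - {0}) z \<le> ennreal (1 / axis_dist y z ^ ?m) * indicator (cball 0 1) z"
    proof (cases "z \<in> cball 0 1 - {0}")
      case True
      have "singular (sgn z, y) = norm z ^ ?m * (1 / axis_dist y z ^ ?m)"
        using True y1 by (simp add: singular_def angle_def sin_arccos_sgn power_divide)
      also have "\<dots> \<le> 1 * (1 / axis_dist y z ^ ?m)"
        using True by (intro mult_right_mono power_le_one) (auto simp: axis_dist_def)
      finally show ?thesis using True by (simp add: ennreal_leI)
    qed simp
  qed
  also have "\<dots> \<le> ennreal (3 * 4 ^ CARD('n) * unit_ball_vol (real CARD('n)))"
    by (rule nn_integral_axis_singularity[OF dim y1])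
  finally show ?thesis by (simp add: mult_left_mono)
qed

lemma integrable_singular:
  assumes dim: "CARD('n) \<ge> 2"
  shows "integrable (sph2 :: ((real^'n) \<times> (real^'n)) measure) singular"
proof (rule integrableI_nonneg)
  let ?S = "sph_measure :: (real^'n) measure"
  show "AE p in (sph2 :: ((real^'n) \<times> (real^'n)) measure). 0 \<le> singular p"
    by (rule AE_I2) (auto simp: space_pair_measure intro!: singular_nonneg)
  define C where "C = ennreal (real CARD('n)) * ennreal (3 * 4 ^ CARD('n) * unit_ball_vol (real CARD('n)))"
  have "(\<integral>\<^sup>+p. ennreal (singular p) \<partial>(sph2 :: ((real^'n) \<times> (real^'n)) measure))
     = (\<integral>\<^sup>+x. \<integral>\<^sup>+y. ennreal (singular (x, y)) \<partial>?S \<partial>?S)"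
    by (rule sph.nn_integral_fst[symmetric]) measurable
  also have "\<dots> \<le> (\<integral>\<^sup>+x. C \<partial>?S)"
  proof (rule nn_integral_mono)
    fix x assume "x \<in> space ?S"
    then have "(\<integral>\<^sup>+y. ennreal (singular (y, x)) \<partial>?S) \<le> C"
      unfolding C_def by (intro nn_integral_singular_le[OF dim]) simp
    then show "(\<integral>\<^sup>+y. ennreal (singular (x, y)) \<partial>?S) \<le> C"
      by (simp add: singular_def angle_commute)
  qed
  also have "\<dots> < \<infinity>"
  proof -
    have "C < \<infinity>" by (simp add: C_def ennreal_mult_less_top)
    moreover have "emeasure ?S (space ?S) < \<infinity>" using sph.emeasure_finite[of "space ?S"] by (metis top.not_eq_extremum infinity_ennreal_def)
    ultimately show ?thesis by (simp add: ennreal_mult_less_top)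
  qed
  finally show "(\<integral>\<^sup>+p. ennreal (singular p) \<partial>(sph2 :: ((real^'n) \<times> (real^'n)) measure)) < \<infinity>" .
qed measurable

section \<open>Separating two coordinates from a finite product\<close>

abbreviation sphPi :: "nat set \<Rightarrow> (nat \<Rightarrow> real^'n) measure" where
  "sphPi I \<equiv> PiM I (\<lambda>_. sph_measure)"

lemma finite_measure_sphPi:
  assumes "finite I"
  shows "finite_measure (sphPi I :: (nat \<Rightarrow> real^'n) measure)"
proof
  have "emeasure (sphPi I :: (nat \<Rightarrow> real^'n) measure) (space (sphPi I))
      = (\<Prod>i\<in>I. emeasure (sph_measure :: (real^'n) measure) (space sph_measure))"
    unfolding space_PiM using assms by (intro sph_prod.emeasure_PiM) auto
  also have "\<dots> \<noteq> \<infinity>"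
    using sph.emeasure_finite by (auto simp: ennreal_prod_eq_top power_eq_top_ennreal)
  finally show "emeasure (sphPi I :: (nat \<Rightarrow> real^'n) measure) (space (sphPi I)) \<noteq> \<infinity>" .
qed

text \<open>The update order is that of \<open>margin\<close>, so integrating out the second
  component produces the margin by mere unfolding.\<close>

definition glue :: "nat \<Rightarrow> nat \<Rightarrow> ('a \<times> 'a) \<times> (nat \<Rightarrow> 'a) \<Rightarrow> nat \<Rightarrow> 'a" where
  "glue a b = (\<lambda>(p, z). z(a := fst p, b := snd p))"

lemma measurable_glue:
  assumes "a \<in> I" "b \<in> I"
  shows "glue a b \<in> sph2 \<Otimes>\<^sub>M sphPi (I - {a, b}) \<rightarrow>\<^sub>M sphPi I"
proof (rule measurable_PiM_single')
  fix i assume i: "i \<in> I"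
  consider "i = b" | "i \<noteq> b" "i = a" | "i \<in> I - {a, b}" using i by auto
  then show "(\<lambda>p. glue a b p i) \<in> sph2 \<Otimes>\<^sub>M sphPi (I - {a, b}) \<rightarrow>\<^sub>M sph_measure"
    by cases (auto simp: glue_def split_beta')
next
  show "(\<lambda>p i. glue a b p i) \<in> space (sph2 \<Otimes>\<^sub>M sphPi (I - {a, b})) \<rightarrow> (\<Pi>\<^sub>E i\<in>I. space sph_measure)"
    using assms by (auto simp: glue_def space_pair_measure space_PiM PiE_def extensional_def Pi_def)
qed

text \<open>The product measure is determined by boxes, and the preimage of a box is a box with the
  factors \<open>a\<close> and \<open>b\<close> moved to the front.\<close>

lemma distr_glue:
  assumes I: "finite I" "a \<in> I" "b \<in> I" "a \<noteq> b"
  shows "distr (sph2 \<Otimes>\<^sub>M sphPi (I - {a, b})) (sphPi I) (glue a b) = (sphPi I :: (nat \<Rightarrow> real^'n) measure)"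
proof (rule sph_prod.PiM_eqI[OF I(1)])
  fix A :: "nat \<Rightarrow> (real^'n) set" assume A: "\<And>i. i \<in> I \<Longrightarrow> A i \<in> sets sph_measure"
  let ?J = "I - {a, b}"
  have AI: "Pi\<^sub>E I A \<in> sets (sphPi I)" using A I by (intro sets_PiM_I_finite) auto
  have AJ: "Pi\<^sub>E ?J A \<in> sets (sphPi ?J)" using A I by (intro sets_PiM_I_finite) auto
  have As: "A i \<subseteq> sphere 0 1" if "i \<in> I" for i using sets.sets_into_space[OF A[OF that]] by simp
  have pre: "glue a b -` Pi\<^sub>E I A \<inter> space (sph2 \<Otimes>\<^sub>M sphPi ?J) = (A a \<times> A b) \<times> Pi\<^sub>E ?J A"
  proof (intro equalityI subsetI)
    fix p assume p: "p \<in> glue a b -` Pi\<^sub>E I A \<inter> space (sph2 \<Otimes>\<^sub>M sphPi ?J)"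
    obtain x y z where [simp]: "p = ((x, y), z)" by (metis prod.collapse)
    have g: "z(a := x, b := y) \<in> Pi\<^sub>E I A" and z: "z \<in> extensional ?J"
      using p by (auto simp: glue_def space_pair_measure space_PiM PiE_def)
    have "x \<in> A a" using PiE_mem[OF g I(2)] I(4) by simp
    moreover have "y \<in> A b" using PiE_mem[OF g I(3)] by simp
    moreover have "z i \<in> A i" if "i \<in> ?J" for i using PiE_mem[OF g, of i] that by auto
    ultimately show "p \<in> (A a \<times> A b) \<times> Pi\<^sub>E ?J A" using z by (auto simp: PiE_def)
  next
    fix p assume p: "p \<in> (A a \<times> A b) \<times> Pi\<^sub>E ?J A"
    obtain x y z where [simp]: "p = ((x, y), z)" by (metis prod.collapse)
    have xyz: "x \<in> A a" "y \<in> A b" "z \<in> Pi\<^sub>E ?J A" using p by auto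
    then have "z(a := x, b := y) \<in> Pi\<^sub>E I A"
    proof (intro PiE_I)
      fix i assume "i \<in> I"
      then show "(z(a := x, b := y)) i \<in> A i" using xyz PiE_mem[OF xyz(3), of i] by auto
    next
      fix i assume "i \<notin> I"
      then show "(z(a := x, b := y)) i = undefined" using I PiE_arb[OF xyz(3), of i] by auto
    qed
    moreover have "z \<in> Pi\<^sub>E ?J (\<lambda>_. sphere 0 1)"
    proof (intro PiE_I)
      fix i assume "i \<in> ?J"
      then show "z i \<in> sphere 0 1" using PiE_mem[OF xyz(3), of i] As[of i] by blast
    next
      fix i assume "i \<notin> ?J"
      then show "z i = undefined" by (rule PiE_arb[OF xyz(3)])
    qed
    moreover have "x \<in> sphere 0 1" "y \<in> sphere 0 1" using xyz As I by blast+
    ultimately show "p \<in> glue a b -` Pi\<^sub>E I A \<inter> space (sph2 \<Otimes>\<^sub>M sphPi ?J)"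
      by (simp add: glue_def space_pair_measure space_PiM)
  qed
  interpret J: sigma_finite_measure "sphPi ?J :: (nat \<Rightarrow> real^'n) measure"
    using I by (intro sph_prod.sigma_finite) auto
  have "emeasure (distr (sph2 \<Otimes>\<^sub>M sphPi ?J) (sphPi I) (glue a b)) (Pi\<^sub>E I A)
     = emeasure (sph2 \<Otimes>\<^sub>M sphPi ?J) ((A a \<times> A b) \<times> Pi\<^sub>E ?J A)"
    using AI measurable_glue[OF I(2,3)] by (subst emeasure_distr) (auto simp: pre)
  also have "\<dots> = emeasure sph_measure (A a) * emeasure sph_measure (A b) * (\<Prod>i\<in>?J. emeasure sph_measure (A i))"
  proof -
    have "emeasure (sphPi ?J) (Pi\<^sub>E ?J A) = (\<Prod>i\<in>?J. emeasure sph_measure (A i))"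
      using I A by (intro sph_prod.emeasure_PiM) auto
    then show ?thesis using A AJ I
      by (simp add: J.emeasure_pair_measure_Times sph.emeasure_pair_measure_Times)
  qed
  also have "\<dots> = (\<Prod>i\<in>I. emeasure sph_measure (A i))"
  proof -
    have "(\<Prod>i\<in>I. emeasure sph_measure (A i)) = emeasure sph_measure (A a) * (\<Prod>i\<in>I - {a}. emeasure sph_measure (A i))"
      using I by (intro prod.remove) auto
    also have "(\<Prod>i\<in>I - {a}. emeasure sph_measure (A i)) = emeasure sph_measure (A b) * (\<Prod>i\<in>I - {a} - {b}. emeasure sph_measure (A i))"
      using I by (intro prod.remove) auto
    also have "I - {a} - {b} = ?J" by auto
    finally show ?thesis by (simp add: mult.assoc)
  qed
  finally show "emeasure (distr (sph2 \<Otimes>\<^sub>M sphPi ?J) (sphPi I) (glue a b)) (Pi\<^sub>E I A) = (\<Prod>i\<in>I. emeasure sph_measure (A i))" .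
qed simp

lemma glue_pair: "a \<noteq> b \<Longrightarrow> (glue a b p a, glue a b p b) = fst p"
  by (cases p) (simp add: glue_def)

lemma measurable_pair_component [measurable (raw)]:
  "a \<in> I \<Longrightarrow> b \<in> I \<Longrightarrow> (\<lambda>x. (x a, x b)) \<in> sphPi I \<rightarrow>\<^sub>M sph2"
  by (intro measurable_Pair measurable_component_singleton)

text \<open>Pulled back along \<open>glue a b\<close>, an exceptional set of pairs lies in a
  cylinder over a null set.\<close>

lemma AE_sphPi_pair:
  fixes P :: "(real^'n) \<times> (real^'n) \<Rightarrow> bool"
  assumes I: "finite I" "a \<in> I" "b \<in> I" "a \<noteq> b"
    and P: "AE p in sph2. P p"
  shows "AE x in sphPi I. P (x a, x b)"
proof -
  let ?J = "I - {a, b}"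
  obtain N where N: "N \<in> null_sets sph2" "{p \<in> space sph2. \<not> P p} \<subseteq> N" 
    by (rule AE_E3[OF P]) blast
  have Ns [measurable]: "N \<in> sets sph2" using N by auto
  interpret J: sigma_finite_measure "sphPi ?J :: (nat \<Rightarrow> real^'n) measure"
    using I by (intro sph_prod.sigma_finite) auto
  define X where "X = {x \<in> space (sphPi I). (x a, x b) \<in> N}"
  have X: "X \<in> sets (sphPi I)" unfolding X_def using I by measurable
  have "emeasure (sphPi I) X = emeasure (distr (sph2 \<Otimes>\<^sub>M sphPi ?J) (sphPi I) (glue a b)) X"
    by (simp add: distr_glue[OF I])
  also have "\<dots> = emeasure (sph2 \<Otimes>\<^sub>M sphPi ?J) (glue a b -` X \<inter> space (sph2 \<Otimes>\<^sub>M sphPi ?J))"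
    by (rule emeasure_distr[OF measurable_glue[OF I(2,3)] X])
  also have "\<dots> \<le> emeasure (sph2 \<Otimes>\<^sub>M sphPi ?J) (N \<times> space (sphPi ?J :: (nat \<Rightarrow> real^'n) measure))"
    using Ns by (intro emeasure_mono) (auto simp: X_def space_pair_measure glue_def I(4))
  also have "\<dots> = 0"
    using N by (subst J.emeasure_pair_measure_Times) auto
  finally have "X \<in> null_sets (sphPi I)" using X by auto
  then have "AE x in sphPi I. x \<notin> X" by (rule AE_not_in)
  with AE_space show ?thesis
  proof eventually_elim
    case (elim x)
    have "(x a, x b) \<in> space sph2" using elim(1) I by (auto simp: space_pair_measure space_PiM)
    then show ?case using elim N(2) by (auto simp: X_def)
  qed
qed

lemma integrable_sphPi_pair:
  fixes h :: "(real^'n) \<times> (real^'n) \<Rightarrow> real"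
  assumes I: "finite I" "a \<in> I" "b \<in> I" "a \<noteq> b"
    and h: "integrable sph2 h"
  shows "integrable (sphPi I) (\<lambda>x. h (x a, x b))"
proof -
  let ?J = "I - {a, b}"
  interpret J: finite_measure "sphPi ?J :: (nat \<Rightarrow> real^'n) measure"
    using I by (intro finite_measure_sphPi) auto
  interpret P: pair_sigma_finite "sph2 :: ((real^'n) \<times> (real^'n)) measure" "sphPi ?J :: (nat \<Rightarrow> real^'n) measure"
    using sigma_finite_sph2 J.sigma_finite_measure_axioms by (simp add: pair_sigma_finite_def)
  have [measurable]: "h \<in> borel_measurable sph2" using h by auto
  have "integrable (sph2 \<Otimes>\<^sub>M (sphPi ?J :: (nat \<Rightarrow> real^'n) measure)) (\<lambda>q. h (fst q))"
  proof (rule P.Fubini_integrable)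
    show "integrable sph2 (\<lambda>p. \<integral>z. norm (h (fst (p, z))) \<partial>sphPi ?J)" using h by simp
  qed (auto simp: J.integrable_const)
  then have "integrable (distr (sph2 \<Otimes>\<^sub>M sphPi ?J) (sphPi I) (glue a b)) (\<lambda>x. h (x a, x b))"
    using I by (subst integrable_distr_eq[OF measurable_glue]) (auto simp: glue_pair)
  then show ?thesis by (simp add: distr_glue[OF I])
qed

text \<open>The factor \<open>h\<close> depends on two coordinates only and leaves the inner
  integral, so what remains inside is the margin.\<close>

lemma integral_sphPi_margin:
  fixes f :: "(nat \<Rightarrow> real^'n) \<Rightarrow> real" and h :: "(real^'n) \<times> (real^'n) \<Rightarrow> real"
  assumes ij: "i < k" "j < k" "i \<noteq> j"
    and [measurable]: "h \<in> borel_measurable sph2"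
    and fh: "integrable (sphPi {..<k}) (\<lambda>x. f x * h (x i, x j))"
  shows "(\<integral>x. f x * h (x i, x j) \<partial>sphPi {..<k})
    = (\<integral>x. (\<integral>y. margin k f i j x y * h (x, y) \<partial>sph_measure) \<partial>sph_measure)"
proof -
  let ?I = "{..<k}" let ?J = "{..<k} - {i, j}"
  let ?F = "\<lambda>x. f x * h (x i, x j)"
  have I: "finite ?I" "i \<in> ?I" "j \<in> ?I" "i \<noteq> j" using ij by auto
  interpret J: finite_measure "sphPi ?J :: (nat \<Rightarrow> real^'n) measure"
    using I by (intro finite_measure_sphPi) auto
  interpret P: pair_sigma_finite "sph2 :: ((real^'n) \<times> (real^'n)) measure" "sphPi ?J :: (nat \<Rightarrow> real^'n) measure"
    using sigma_finite_sph2 J.sigma_finite_measure_axioms by (simp add: pair_sigma_finite_def)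
  have g: "glue i j \<in> sph2 \<Otimes>\<^sub>M sphPi ?J \<rightarrow>\<^sub>M sphPi ?I" by (rule measurable_glue[OF I(2,3)])
  have Fm: "?F \<in> borel_measurable (sphPi ?I)" using fh by auto
  have F: "integrable (sph2 \<Otimes>\<^sub>M sphPi ?J) (\<lambda>q. ?F (glue i j q))"
    using fh by (subst integrable_distr_eq[OF g Fm, symmetric]) (simp add: distr_glue[OF I])
  have Fg: "?F (glue i j (p, z)) = h p * f (glue i j (p, z))" for p z
    using glue_pair[OF ij(3), of "(p, z)"] by simp
  have m: "(\<integral>z. ?F (glue i j ((x, y), z)) \<partial>sphPi ?J) = margin k f i j x y * h (x, y)" for x y
    unfolding Fg by (simp add: margin_def glue_def)
  have "(\<integral>x. ?F x \<partial>sphPi ?I) = (\<integral>x. ?F x \<partial>distr (sph2 \<Otimes>\<^sub>M sphPi ?J) (sphPi ?I) (glue i j))"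
    by (simp add: distr_glue[OF I])
  also have "\<dots> = (\<integral>q. ?F (glue i j q) \<partial>(sph2 \<Otimes>\<^sub>M sphPi ?J))"
    by (rule integral_distr[OF g Fm])
  also have "\<dots> = (\<integral>p. (\<integral>z. ?F (glue i j (p, z)) \<partial>sphPi ?J) \<partial>sph2)"
    by (rule P.integral_fst'[OF F, symmetric])
  also have "\<dots> = (\<integral>x. \<integral>y. (\<integral>z. ?F (glue i j ((x, y), z)) \<partial>sphPi ?J) \<partial>sph_measure \<partial>sph_measure)"
    by (rule sph_pair.integral_fst'[OF P.integrable_fst'[OF F], symmetric])
  also have "\<dots> = (\<integral>x. (\<integral>y. margin k f i j x y * h (x, y) \<partial>sph_measure) \<partial>sph_measure)"
    unfolding m ..
  finally show ?thesis .
qed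

section \<open>Expansion over permutations\<close>

lemma kdim_pos: "d \<ge> 2 \<Longrightarrow> kdim d n > 0"
  by (auto simp: kdim_def zero_less_binomial_iff intro!: mult_pos_pos divide_pos_pos)

lemma inverse_kdim_tendsto:
  assumes d: "d \<ge> 2"
  shows "(\<lambda>n. 1 / kdim d n) \<longlonglongrightarrow> 0"
proof -
  have G: "Gamma (real d) > 0" using d by (intro Gamma_real_pos) simp
  have lim: "(\<lambda>n. inverse (kdim d n / (real n + 0)^(d-1))) \<longlonglongrightarrow> inverse (2 / Gamma (real d))"
    using G by (intro tendsto_inverse kdim_tendsto[OF d]) auto
  have "(\<lambda>n. (1 / real n)^(d-1)) \<longlonglongrightarrow> 0 ^ (d-1)"
    by (intro tendsto_power lim_const_over_n)
  then have "(\<lambda>n. (1 / real n)^(d-1)) \<longlonglongrightarrow> 0" using d by (simp add: power_0_left)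
  from tendsto_mult[OF lim this]
  have "(\<lambda>n. inverse (kdim d n / (real n + 0)^(d-1)) * (1 / real n)^(d-1)) \<longlonglongrightarrow> 0" by simp
  then show ?thesis
  proof (rule Lim_transform_eventually)
    show "\<forall>\<^sub>F n in sequentially. inverse (kdim d n / (real n + 0)^(d-1)) * (1 / real n)^(d-1) = 1 / kdim d n"
      using kdim_pos[OF d]
      by (intro eventually_mono[OF eventually_gt_at_top[of 0]]) (auto simp: field_simps power_divide)
  qed
qed

section \<open>The centred density as a bounded sequence\<close>

context legendre_asymptotics
begin

text \<open>The cut-off to \<open>{0<..<pi}\<close> lets bounds and limits for these angles suffice
  on the whole line.\<close>

definition w :: "nat \<Rightarrow> real \<Rightarrow> real" where
  "w n \<theta> = (legendre_density d n \<theta> - legendre_const d) * indicator {0<..<pi} \<theta>"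

lemma borel_measurable_w: "w n \<in> borel_measurable borel"
  unfolding w_def[abs_def] legendre_density_def by measurable

lemma legendre_const_nonneg: "legendre_const d \<ge> 0"
  using d Gamma_real_pos[of "real d"] by (auto simp: legendre_const_def intro!: divide_nonneg_nonneg mult_nonneg_nonneg)

lemma w_bounded_sequence: obtains K where "bounded_sequence w K"
proof -
  obtain C where C: "\<And>n \<theta>. 0 < \<theta> \<Longrightarrow> \<theta> < pi \<Longrightarrow> legendre_density d n \<theta> \<le> C"
    using density_bounded by blast
  have C0: "0 \<le> C"
    using density_nonneg[of "pi/2" 0] C[of "pi/2" 0] by simp
  have "\<bar>w n \<theta>\<bar> \<le> C + legendre_const d" for n \<theta>
  proof (cases "\<theta> \<in> {0<..<pi}")
    case True
    then show ?thesis using C[of \<theta> n] density_nonneg[of \<theta> n] legendre_const_nonneg by (auto simp: w_def abs_le_iff)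
  next
    case False
    then show ?thesis using C0 legendre_const_nonneg by (simp add: w_def)
  qed
  then have "bounded_sequence w (C + legendre_const d)"
    by unfold_locales (auto simp: borel_measurable_w)
  then show ?thesis by (rule that)
qed

lemma weak_null_w:
  assumes "bounded_sequence w K" "integrable lborel g"
  shows "bounded_sequence.weak_null w g"
proof (rule bounded_sequence.weak_null_integrable[OF assms(1) _ _ assms(2), of 0 pi])
  fix a b :: real assume ab: "0 < a" "a \<le> b" "b < pi"
  have "(LBINT x. indicator {a..b} x * w n x) = (LBINT x. legendre_density d n x * indicator {a..b} x) - legendre_const d * (b - a)" for n
  proof -
    have int: "integrable lborel (\<lambda>x. legendre_density d n x * indicator {a..b} x :: real)"
    proof -
      have "isCont (legendre d n) x" for x
        using continuous_on_legendre[of UNIV d n] by (simp add: continuous_on_eq_continuous_at)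
      then have "isCont (legendre_density d n) x" for x
        unfolding legendre_density_def[abs_def]
        by (intro continuous_intros isCont_o2[of _ cos "legendre d n"]) auto
      then show ?thesis using borel_integrable_atLeastAtMost[of a b "legendre_density d n"]
        by (auto simp: indicator_def if_distrib mult.commute cong: if_cong)
    qed
    have int2: "integrable lborel (\<lambda>x. legendre_const d * indicator {a..b} x :: real)"
      by (intro integrable_mult_right integrable_real_indicator) (auto simp: emeasure_lborel_Icc_eq)
    have "(LBINT x. indicator {a..b} x * w n x) = (LBINT x. legendre_density d n x * indicator {a..b} x - legendre_const d * indicator {a..b} x)"
      using ab by (intro Bochner_Integration.integral_cong refl) (auto simp: w_def indicator_def)
    also have "\<dots> = (LBINT x. legendre_density d n x * indicator {a..b} x) - (LBINT x. legendre_const d * indicator {a..b} x)"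
      by (rule Bochner_Integration.integral_diff[OF int int2])
    finally show ?thesis using ab by simp
  qed
  then show "bounded_sequence.weak_null w (indicator {a..b})"
    using integral_density_tendsto[OF ab]
    unfolding bounded_sequence.weak_null_def[OF assms(1)] by (simp add: LIM_zero)
qed (simp add: w_def)

end

text \<open>If \<open>a\<close> and \<open>p a\<close> were the only moved points, \<open>p\<close>
  would permute a two-element set and be the identity or a transposition.\<close>

lemma permutes_third_moved_point:
  assumes p: "p permutes S" and ne: "p \<noteq> id"
    and nt: "\<And>a b. a \<in> S \<Longrightarrow> b \<in> S \<Longrightarrow> a \<noteq> b \<Longrightarrow> p \<noteq> Transposition.transpose a b"
  obtains a c where "a \<in> S" "c \<in> S" "p a \<noteq> a" "p c \<noteq> c" "c \<noteq> a" "c \<noteq> p a" "p (p a) \<noteq> p a"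
proof -
  obtain a where a: "p a \<noteq> a" using ne by (auto simp: fun_eq_iff)
  then have aS: "a \<in> S" using p by (meson permutes_not_in)
  have bS: "p a \<in> S" using aS p by (simp add: permutes_in_image)
  have inj: "p x = p y \<longleftrightarrow> x = y" for x y using p by (metis permutes_inj inj_eq)
  have "\<exists>c. c \<noteq> a \<and> c \<noteq> p a \<and> p c \<noteq> c"
  proof (rule ccontr)
    assume no: "\<not> ?thesis"
    have "p permutes {a, p a}"
    proof (rule permutes_superset[OF p])
      fix x assume "x \<in> S - {a, p a}"
      then show "p x = x" using no by blast
    qed
    then have "p = id \<or> p = Transposition.transpose a (p a)" by (rule permutes_doubleton_iff[THEN iffD1])
    then show False
    proof
      assume "p = id"
      then show False by (rule notE[OF ne])
    next
      assume "p = Transposition.transpose a (p a)"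
      then show False by (rule notE[OF nt[OF aS bS not_sym[OF a]]])
    qed
  qed
  then obtain c where c: "c \<noteq> a" "c \<noteq> p a" "p c \<noteq> c" by blast
  have cS: "c \<in> S" using c(3) p by (meson permutes_not_in)
  show ?thesis by (rule that[OF aS cS a c(3,1,2)]) (use a inj in auto)
qed

text \<open>A transposition determines the two points it moves, so the pairs with
  \<open>i < j\<close> count each one once.\<close>

lemma sum_permutations_split:
  obtains R where "finite R"
    "\<forall>p\<in>R. p permutes {..<k::nat} \<and> p \<noteq> id \<and> (\<forall>i<k. \<forall>j<k. i \<noteq> j \<longrightarrow> p \<noteq> Transposition.transpose i j)"
    "\<forall>g :: (nat \<Rightarrow> nat) \<Rightarrow> real. (\<Sum>p | p permutes {..<k}. g p)
      = g id + (\<Sum>(i, j) \<in> {(i, j). i < j \<and> j < k}. g (Transposition.transpose i j)) + (\<Sum>p\<in>R. g p)"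
proof -
  let ?A = "{p. p permutes {..<k}}"
  let ?P = "{(i, j). i < j \<and> j < k}"
  let ?t = "\<lambda>(i, j). Transposition.transpose i j :: nat \<Rightarrow> nat"
  define R where "R = ?A - {id} - ?t ` ?P"
  have fin: "finite ?A" by (rule finite_permutations) simp
  have finP: "finite ?P" by (rule finite_subset[of _ "{..<k} \<times> {..<k}"]) auto
  have inj: "inj_on ?t ?P"
  proof (rule inj_onI, clarify)
    fix i j i' j' :: nat assume ij: "i < j" "i' < j'" and eq: "Transposition.transpose i j = Transposition.transpose i' j'"
    have "{x. Transposition.transpose i j x \<noteq> x} = {i, j}" "{x. Transposition.transpose i' j' x \<noteq> x} = {i', j'}"
      using ij by (auto simp: Transposition.transpose_def)
    then have "{i, j} = {i', j'}" using eq by simp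
    then show "i = i' \<and> j = j'" using ij by (auto simp: doubleton_eq_iff)
  qed
  have sub: "?t ` ?P \<subseteq> ?A - {id}"
  proof clarify
    fix i j :: nat assume ij: "i < j" "j < k"
    then have "Transposition.transpose i j i \<noteq> id i" by simp
    then have "Transposition.transpose i j \<noteq> id" by metis
    then show "Transposition.transpose i j \<in> ?A - {id}" using ij by (auto intro: permutes_swap_id)
  qed
  have split: "(\<Sum>p\<in>?A. g p) = g id + (\<Sum>(i, j) \<in> ?P. g (Transposition.transpose i j)) + (\<Sum>p\<in>R. g p)"
    for g :: "(nat \<Rightarrow> nat) \<Rightarrow> real"
  proof -
    have "(\<Sum>p\<in>?A. g p) = g id + (\<Sum>p\<in>?A - {id}. g p)"
      using fin by (intro sum.remove) (auto simp: permutes_id)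
    also have "(\<Sum>p\<in>?A - {id}. g p) = (\<Sum>p\<in>R. g p) + (\<Sum>p\<in>?t ` ?P. g p)"
      unfolding R_def using fin sub by (intro sum.subset_diff) auto
    also have "(\<Sum>p\<in>?t ` ?P. g p) = (\<Sum>(i, j) \<in> ?P. g (Transposition.transpose i j))"
      by (subst sum.reindex[OF inj]) (auto intro!: sum.cong)
    finally show ?thesis by (simp only: add_ac)
  qed
  have nt: "p \<noteq> Transposition.transpose i j" if "p \<in> R" "i < k" "j < k" "i \<noteq> j" for p i j
  proof
    assume "p = Transposition.transpose i j"
    then have "p = ?t (min i j, max i j)"
      using transpose_commute[of i j] by (cases "i \<le> j") (simp_all add: min_def max_def)
    moreover have "(min i j, max i j) \<in> ?P" using that by auto
    ultimately show False using that(1) unfolding R_def by blast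
  qed
  have pp: "p permutes {..<k}" "p \<noteq> id" if "p \<in> R" for p using that by (auto simp: R_def)
  have finR: "finite R" using fin by (simp add: R_def)
  show ?thesis
    by (rule that[OF finR]) (intro ballI conjI allI impI pp nt split; assumption)+
qed

section \<open>The terms of the determinant expansion\<close>

locale bounded_statistic =
  fixes f :: "(nat \<Rightarrow> real^'n) \<Rightarrow> real" and k :: nat and B :: real and d :: nat
  assumes dim: "CARD('n) \<ge> 3"
    and d_eq: "d = CARD('n) - 1"
    and f_measurable [measurable]: "f \<in> borel_measurable (sphPi {..<k})"
    and f_bounded: "\<And>x. x \<in> space (sphPi {..<k}) \<Longrightarrow> \<bar>f x\<bar> \<le> B"
begin

abbreviation "M \<equiv> (sphPi {..<k} :: (nat \<Rightarrow> real^'n) measure)"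

lemma d_ge_2: "d \<ge> 2" using dim by (simp add: d_eq)

sublocale leg: legendre_asymptotics d by unfold_locales (rule d_ge_2)

sublocale M: finite_measure M by (rule finite_measure_sphPi) simp

text \<open>The determinant term without its sign and the factor
  \<open>(kdim d n / s_area d)^k\<close>; in this normalisation fixed points of \<open>p\<close>
  contribute the factor 1.\<close>

definition perm_integral :: "nat \<Rightarrow> (nat \<Rightarrow> nat) \<Rightarrow> real" where
  "perm_integral n p = (\<integral>x. f x * (\<Prod>a<k. legendre d n (x a \<bullet> x (p a))) \<partial>M)"

lemma component: "x \<in> space M \<Longrightarrow> i < k \<Longrightarrow> x i \<in> sphere 0 1"
  using PiE_mem[of x "{..<k}" "\<lambda>_. sphere 0 1" i] by (simp add: space_PiM)

lemma component_self: "x \<in> space M \<Longrightarrow> i < k \<Longrightarrow> x i \<bullet> x i = 1"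
  using component[of x i] by (simp add: norm_eq_1)

lemma abs_legendre_component: "x \<in> space M \<Longrightarrow> i < k \<Longrightarrow> j < k \<Longrightarrow> \<bar>legendre d n (x i \<bullet> x j)\<bar> \<le> 1"
  using component by (intro abs_legendre_le_1 d_ge_2 abs_inner_sphere_le_1) auto

lemma measurable_component_inner [measurable]:
  assumes "i < k" "j < k"
  shows "(\<lambda>x. x i \<bullet> x j) \<in> borel_measurable M"
proof -
  have "(\<lambda>x. x i) \<in> borel_measurable M" if "i < k" for i
  proof -
    have "(\<lambda>x. x i) \<in> M \<rightarrow>\<^sub>M sph_measure" using that by (intro measurable_component_singleton) auto
    then show ?thesis by (rule measurable_compose[OF _ measurable_ident_sph])
  qed
  then show ?thesis using assms by (intro borel_measurable_inner) auto
qed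

lemma measurable_perm_product:
  assumes "p permutes {..<k}"
  shows "(\<lambda>x. \<Prod>a<k. legendre d n (x a \<bullet> x (p a))) \<in> borel_measurable M"
proof (rule borel_measurable_prod)
  fix a assume "a \<in> {..<k}"
  then have "a < k" "p a < k" using permutes_in_image[OF assms, of a] by auto
  then show "(\<lambda>x. legendre d n (x a \<bullet> x (p a))) \<in> borel_measurable M"
    by (intro measurable_compose[OF measurable_component_inner borel_measurable_legendre])
qed

lemma abs_perm_product_le:
  assumes "p permutes {..<k}" "x \<in> space M" "A \<subseteq> {..<k}"
  shows "\<bar>\<Prod>a\<in>A. legendre d n (x a \<bullet> x (p a))\<bar> \<le> 1"
  unfolding abs_prod
proof (rule prod_le_1)
  fix a assume "a \<in> A"
  then have "a < k" "p a < k" using permutes_in_image[OF assms(1), of a] assms(3) by auto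
  then show "0 \<le> \<bar>legendre d n (x a \<bullet> x (p a))\<bar> \<and> \<bar>legendre d n (x a \<bullet> x (p a))\<bar> \<le> 1"
    using abs_legendre_component[OF assms(2)] by simp
qed

lemma integrable_f_mult:
  assumes h: "integrable M h"
  shows "integrable M (\<lambda>x. f x * h x)"
proof (rule Bochner_Integration.integrable_bound)
  show "integrable M (\<lambda>x. B * h x)" using h by simp
  show "(\<lambda>x. f x * h x) \<in> borel_measurable M" using h by measurable
  show "AE x in M. norm (f x * h x) \<le> norm (B * h x)"
  proof (rule AE_I2)
    fix x assume "x \<in> space M"
    then have "\<bar>f x\<bar> \<le> \<bar>B\<bar>" using f_bounded[of x] by simp
    then show "norm (f x * h x) \<le> norm (B * h x)" by (simp add: abs_mult mult_right_mono)
  qed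
qed

lemma integrable_perm:
  assumes p: "p permutes {..<k}"
  shows "integrable M (\<lambda>x. f x * (\<Prod>a<k. legendre d n (x a \<bullet> x (p a))))"
proof (rule integrable_f_mult)
  show "integrable M (\<lambda>x. \<Prod>a<k. legendre d n (x a \<bullet> x (p a)))"
    using abs_perm_product_le[OF p] measurable_perm_product[OF p]
    by (intro M.integrable_const_bound[of _ 1]) auto
qed

lemma ELn_eq:
  "ELn k n f = (kdim d n / s_area d)^k * (\<Sum>p | p permutes {..<k}. of_int (sign p) * perm_integral n p)"
proof -
  let ?c = "(kdim d n / s_area d)^k"
  have "f x * corr n k x = (\<Sum>p | p permutes {..<k}. ?c * (of_int (sign p) * (f x * (\<Prod>a<k. legendre d n (x a \<bullet> x (p a))))))" for x
  proof -
    have "(\<Prod>a<k. kdim d n / s_area d * legendre d n (x a \<bullet> x (p a))) = ?c * (\<Prod>a<k. legendre d n (x a \<bullet> x (p a)))" for p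
      by (simp only: prod.distrib prod_constant card_lessThan)
    then show ?thesis
      unfolding corr_def Kproj_def d_eq[symmetric] by (simp only: sum_distrib_left mult_ac)
  qed
  then have "ELn k n f = (\<integral>x. (\<Sum>p | p permutes {..<k}. ?c * (of_int (sign p) * (f x * (\<Prod>a<k. legendre d n (x a \<bullet> x (p a)))))) \<partial>M)"
    unfolding ELn_def by simp
  also have "\<dots> = (\<Sum>p | p permutes {..<k}. ?c * (of_int (sign p) * perm_integral n p))"
    unfolding perm_integral_def using integrable_perm
    by (subst Bochner_Integration.integral_sum) auto
  finally show ?thesis by (simp add: sum_distrib_left)
qed

lemma perm_integral_id: "perm_integral n id = (\<integral>x. f x \<partial>M)"
  unfolding perm_integral_def
  by (intro Bochner_Integration.integral_cong refl) (simp add: component_self legendre_at_1[OF d_ge_2])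

lemma kdim_legendre_squared:
  fixes x y :: "real^'n"
  assumes "x \<in> sphere 0 1" "y \<in> sphere 0 1" "0 < angle (x, y)" "angle (x, y) < pi"
  shows "kdim d n * legendre d n (x \<bullet> y)^2 = singular (x, y) * legendre_density d n (angle (x, y))"
proof -
  have "sin (angle (x, y)) > 0" using assms by (intro sin_gt_zero)
  moreover have "CARD('n) - 2 = d - 1" by (simp add: d_eq)
  ultimately show ?thesis
    using assms by (simp add: legendre_density_def singular_def angle_bounds)
qed

lemma AE_angle:
  assumes "i < k" "j < k" "i \<noteq> j"
  shows "AE x in M. 0 < angle (x i, x j) \<and> angle (x i, x j) < pi"
proof (rule AE_sphPi_pair[of "{..<k}" i j])
  show "AE p in (sph2 :: ((real^'n) \<times> (real^'n)) measure). 0 < angle p \<and> angle p < pi"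
    using dim by (intro AE_sph2_angle_interior) simp
qed (use assms in auto)

lemma integrable_singular_component:
  assumes "i < k" "j < k" "i \<noteq> j"
  shows "integrable M (\<lambda>x. singular (x i, x j))"
  using assms dim by (intro integrable_sphPi_pair integrable_singular) auto

lemma transposition_product:
  assumes "i < k" "j < k" "i \<noteq> j" "x \<in> space M"
  shows "(\<Prod>a<k. legendre d n (x a \<bullet> x (Transposition.transpose i j a))) = legendre d n (x i \<bullet> x j)^2"
proof -
  have "(\<Prod>a<k. legendre d n (x a \<bullet> x (Transposition.transpose i j a)))
      = (\<Prod>a\<in>{i, j}. legendre d n (x a \<bullet> x (Transposition.transpose i j a)))"
    using assms by (intro prod.mono_neutral_right) (auto simp: component_self legendre_at_1[OF d_ge_2])
  then show ?thesis using assms by (simp add: power2_eq_square inner_commute)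
qed

text \<open>Almost everywhere \<open>kdim\<close> times the squared polynomial is the weight times
  \<open>leg.w n + legendre_const d\<close>, with \<open>leg.w n\<close> taken at the angle. The
  centred part vanishes in the limit because the angle has an absolutely continuous law; the
  constant part is the limit.\<close>

lemma transposition_limit:
  assumes ij: "i < k" "j < k" "i \<noteq> j"
  shows "(\<lambda>n. kdim d n * perm_integral n (Transposition.transpose i j))
    \<longlonglongrightarrow> legendre_const d * (\<integral>x. (\<integral>y. margin k f i j x y / sin (arccos (x \<bullet> y)) ^ (d - 1) \<partial>sph_measure) \<partial>sph_measure)"
proof -
  obtain K where K: "bounded_sequence leg.w K" by (rule leg.w_bounded_sequence)
  let ?T = "\<lambda>x :: nat \<Rightarrow> real^'n. angle (x i, x j)"
  let ?h = "\<lambda>x. f x * singular (x i, x j)"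
  have h: "integrable M ?h" by (rule integrable_f_mult[OF integrable_singular_component[OF ij]])
  have T [measurable]: "?T \<in> borel_measurable M"
    using ij by (intro measurable_compose[OF measurable_pair_component borel_measurable_angle]) auto
  have P: "integrable M (\<lambda>x. f x * (\<Prod>a<k. legendre d n (x a \<bullet> x (Transposition.transpose i j a))))" for n
    using ij by (intro integrable_perm permutes_swap_id) auto
  have "(\<lambda>n. \<integral>x. ?h x * leg.w n (?T x) \<partial>M) \<longlonglongrightarrow> 0"
  proof (rule bounded_sequence.weak_null_distr[OF K leg.weak_null_w[OF K] T _ h])
    fix N :: "real set" assume "N \<in> sets borel" "emeasure lborel N = 0"
    then have "N \<in> null_sets lborel" by auto
    then have "AE p in (sph2 :: ((real^'n) \<times> (real^'n)) measure). angle p \<notin> N"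
      using dim by (intro AE_sph2_angle) simp
    then show "AE x in M. ?T x \<notin> N"
      using ij by (intro AE_sphPi_pair[of "{..<k}" i j]) auto
  qed
  moreover have "(\<integral>x. ?h x * leg.w n (?T x) \<partial>M)
      = kdim d n * perm_integral n (Transposition.transpose i j) - legendre_const d * (\<integral>x. ?h x \<partial>M)" for n
  proof -
    have "(\<integral>x. ?h x * leg.w n (?T x) \<partial>M) =
       (\<integral>x. kdim d n * (f x * (\<Prod>a<k. legendre d n (x a \<bullet> x (Transposition.transpose i j a)))) - legendre_const d * ?h x \<partial>M)"
    proof (rule integral_cong_AE)
      show "(\<lambda>x. ?h x * leg.w n (?T x)) \<in> borel_measurable M"
        using h leg.borel_measurable_w[of n] by measurable
      show "(\<lambda>x. kdim d n * (f x * (\<Prod>a<k. legendre d n (x a \<bullet> x (Transposition.transpose i j a)))) - legendre_const d * ?h x) \<in> borel_measurable M"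
        using h P[of n] by measurable
      show "AE x in M. ?h x * leg.w n (?T x) =
        kdim d n * (f x * (\<Prod>a<k. legendre d n (x a \<bullet> x (Transposition.transpose i j a)))) - legendre_const d * ?h x"
        using AE_angle[OF ij] AE_space
      proof eventually_elim
        case (elim x)
        have "kdim d n * legendre d n (x i \<bullet> x j)^2 = singular (x i, x j) * legendre_density d n (?T x)"
          using elim ij component by (intro kdim_legendre_squared) auto
        then have X: "?h x * legendre_density d n (?T x) = kdim d n * (f x * legendre d n (x i \<bullet> x j)^2)"
          by simp
        have W: "leg.w n (?T x) = legendre_density d n (?T x) - legendre_const d"
          using elim by (simp add: leg.w_def)
        then show ?case
          unfolding transposition_product[OF ij elim(2)] W
          by (simp only: right_diff_distrib X mult.commute[of _ "legendre_const d"])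
      qed
    qed
    also have "\<dots> = kdim d n * perm_integral n (Transposition.transpose i j) - legendre_const d * (\<integral>x. ?h x \<partial>M)"
      unfolding perm_integral_def using P[of n] h by (subst Bochner_Integration.integral_diff) auto
    finally show ?thesis .
  qed
  ultimately have "(\<lambda>n. kdim d n * perm_integral n (Transposition.transpose i j)) \<longlonglongrightarrow> legendre_const d * (\<integral>x. ?h x \<partial>M)"
    by (simp add: LIM_zero_iff)
  also have "(\<integral>x. ?h x \<partial>M) = (\<integral>x. (\<integral>y. margin k f i j x y * singular (x, y) \<partial>sph_measure) \<partial>sph_measure)"
    by (rule integral_sphPi_margin[OF ij borel_measurable_singular h])
  also have "\<dots> = (\<integral>x. (\<integral>y. margin k f i j x y / sin (arccos (x \<bullet> y)) ^ (d - 1) \<partial>sph_measure) \<partial>sph_measure)"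
    by (simp add: singular_def angle_def d_eq numeral_2_eq_2)
  finally show ?thesis .
qed

text \<open>Two of the moved points \<open>a\<close>, \<open>b = p a\<close> yield an integrable majorant of \<open>k\<^sub>n\<close> times the product; the
  factor of a third moved point \<open>c\<close> tends to \<open>0\<close> almost everywhere.\<close>

lemma other_limit:
  assumes p: "p permutes {..<k}" and ne: "p \<noteq> id"
    and nt: "\<And>i j. i < k \<Longrightarrow> j < k \<Longrightarrow> i \<noteq> j \<Longrightarrow> p \<noteq> Transposition.transpose i j"
  shows "(\<lambda>n. kdim d n * perm_integral n p) \<longlonglongrightarrow> 0"
proof -
  obtain a c where "a \<in> {..<k}" "c \<in> {..<k}"
      and ac': "p a \<noteq> a" "p c \<noteq> c" "c \<noteq> a" "c \<noteq> p a" "p (p a) \<noteq> p a"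
    by (rule permutes_third_moved_point[OF p ne]) (use nt in auto)
  then have ac: "a < k" "c < k" "p a \<noteq> a" "p c \<noteq> c" "c \<noteq> a" "c \<noteq> p a" "p (p a) \<noteq> p a" by auto
  \<comment> \<open>The pairs \<open>(a, p a)\<close> and \<open>(b, p b)\<close> may consist of the
    same two points, as when \<open>p\<close> exchanges \<open>a\<close> and \<open>b\<close>; what
    matters is that \<open>a\<close>, \<open>b\<close>, \<open>c\<close> index three different
    factors.\<close>
  define b where "b = p a"
  have pk: "p i < k" if "i < k" for i using permutes_in_image[OF p, of i] that by simp
  have b: "b < k" "p b < k" "p b \<noteq> b" "a \<noteq> b" "c \<noteq> b" "p c < k" using ac pk by (auto simp: b_def)
  obtain C where C: "\<And>n \<theta>. 0 < \<theta> \<Longrightarrow> \<theta> < pi \<Longrightarrow> legendre_density d n \<theta> \<le> C"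
    by (rule leg.density_bounded) blast
  have C0: "C \<ge> 0" using leg.density_nonneg[of "pi/2" 0] C[of "pi/2" 0] by simp
  let ?L = "\<lambda>n i x. \<bar>legendre d n (x i \<bullet> x (p i))\<bar>"
  let ?s = "\<lambda>i x :: nat \<Rightarrow> real^'n. C * singular (x i, x (p i))"
  let ?G = "\<lambda>x. \<bar>B\<bar> * (?s a x + ?s b x)"
  let ?F = "\<lambda>n x. kdim d n * (f x * (\<Prod>a<k. legendre d n (x a \<bullet> x (p a))))"
  have square: "kdim d n * ?L n i x ^ 2 \<le> ?s i x"
    if "x \<in> space M" "i < k" "0 < angle (x i, x (p i))" "angle (x i, x (p i)) < pi" for n i x
  proof -
    have sph: "x i \<in> sphere 0 1" "x (p i) \<in> sphere 0 1" using that component pk by auto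
    have "kdim d n * ?L n i x ^ 2 = singular (x i, x (p i)) * legendre_density d n (angle (x i, x (p i)))"
      using kdim_legendre_squared[OF sph that(3,4)] by simp
    also have "\<dots> \<le> singular (x i, x (p i)) * C"
      using C[OF that(3,4)] singular_nonneg[OF sph] by (rule mult_left_mono)
    finally show ?thesis by (simp add: mult.commute)
  qed
  have bound: "\<bar>?F n x\<bar> \<le> ?G x * ?L n c x"
    if x: "x \<in> space M" and an: "0 < angle (x a, x (p a))" "angle (x a, x (p a)) < pi"
      "0 < angle (x b, x (p b))" "angle (x b, x (p b)) < pi" for n x
  proof -
    have kp: "kdim d n > 0" by (rule kdim_pos[OF d_ge_2])
    have "(\<Prod>a<k. legendre d n (x a \<bullet> x (p a)))
       = (\<Prod>a\<in>{..<k} - {a, b, c}. legendre d n (x a \<bullet> x (p a))) * (\<Prod>a\<in>{a, b, c}. legendre d n (x a \<bullet> x (p a)))"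
      using ac b by (intro prod.subset_diff) auto
    then have "\<bar>\<Prod>a<k. legendre d n (x a \<bullet> x (p a))\<bar>
       \<le> 1 * \<bar>\<Prod>a\<in>{a, b, c}. legendre d n (x a \<bullet> x (p a))\<bar>"
      unfolding abs_mult[of "\<Prod>a\<in>{..<k} - {a, b, c}. legendre d n (x a \<bullet> x (p a))", symmetric]
      using abs_perm_product_le[OF p x, of "{..<k} - {a, b, c}" n]
      by (simp only: abs_mult) (intro mult_right_mono, auto)
    also have "\<dots> = ?L n a x * ?L n b x * ?L n c x"
      using ac b by (simp add: abs_mult mult.assoc)
    finally have prod: "\<bar>\<Prod>a<k. legendre d n (x a \<bullet> x (p a))\<bar> \<le> ?L n a x * ?L n b x * ?L n c x" .
    \<comment> \<open>Separates the two factors, so that each square absorbs \<open>kdim d n\<close>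
      on its own.\<close>
    have amgm: "u * v \<le> u^2 + v^2" for u v :: real
      using sum_squares_bound[of u v] zero_le_power2[of u] zero_le_power2[of v] by (cases "u * v \<ge> 0") linarith+
    have "kdim d n * (?L n a x * ?L n b x) \<le> kdim d n * (?L n a x ^ 2 + ?L n b x ^ 2)"
      using kp by (intro mult_left_mono amgm) simp
    also have "\<dots> \<le> ?s a x + ?s b x"
      using square[OF x ac(1) an(1,2), of n] square[OF x b(1) an(3,4), of n] by (simp add: distrib_left)
    finally have two: "kdim d n * (?L n a x * ?L n b x) \<le> ?s a x + ?s b x" .
    have "\<bar>?F n x\<bar> = \<bar>f x\<bar> * (kdim d n * \<bar>\<Prod>a<k. legendre d n (x a \<bullet> x (p a))\<bar>)"
      using kp by (simp add: abs_mult)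
    also have "\<dots> \<le> \<bar>B\<bar> * (kdim d n * (?L n a x * ?L n b x * ?L n c x))"
    proof (intro mult_mono mult_left_mono prod)
      show "\<bar>f x\<bar> \<le> \<bar>B\<bar>" using f_bounded[OF x] by simp
    qed (use kp in auto)
    also have "\<dots> = \<bar>B\<bar> * (kdim d n * (?L n a x * ?L n b x)) * ?L n c x" by (simp add: mult_ac)
    also have "\<dots> \<le> \<bar>B\<bar> * (?s a x + ?s b x) * ?L n c x"
      using two by (intro mult_right_mono mult_left_mono) auto
    finally show ?thesis .
  qed
  have AE: "AE x in M. x \<in> space M \<and> 0 < angle (x a, x (p a)) \<and> angle (x a, x (p a)) < pi \<and>
      0 < angle (x b, x (p b)) \<and> angle (x b, x (p b)) < pi \<and> 0 < angle (x c, x (p c)) \<and> angle (x c, x (p c)) < pi"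
    using AE_space AE_angle[of a "p a"] AE_angle[of b "p b"] AE_angle[of c "p c"] ac b pk by auto
  have "(\<lambda>n. \<integral>x. ?F n x \<partial>M) \<longlonglongrightarrow> (\<integral>x. 0 \<partial>M)"
  proof (rule integral_dominated_convergence)
    show "integrable M ?G"
      using integrable_singular_component[of a "p a"] integrable_singular_component[of b "p b"] ac b pk
      by (intro integrable_mult_right Bochner_Integration.integrable_add) auto
    show "?F n \<in> borel_measurable M" for n
      using integrable_perm[OF p, of n] by measurable
    show "AE x in M. norm (?F n x) \<le> ?G x" for n
      using AE
    proof eventually_elim
      case (elim x)
      have G0: "?G x \<ge> 0"
        using C0 singular_nonneg[of "x a" "x (p a)"] singular_nonneg[of "x b" "x (p b)"]
          component[of x] elim ac(1) b(1,2) pk[OF ac(1)]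
        by (intro mult_nonneg_nonneg add_nonneg_nonneg) auto
      have "?G x * ?L n c x \<le> ?G x * 1"
        using G0 elim ac b by (intro mult_left_mono abs_legendre_component) auto
      then show ?case using bound[of x n] elim by simp
    qed
    show "AE x in M. (\<lambda>n. ?F n x) \<longlonglongrightarrow> 0"
      using AE
    proof eventually_elim
      case (elim x)
      \<comment> \<open>The weight at \<open>(x c, x (p c))\<close> does not depend on
        \<open>n\<close> while \<open>kdim d n\<close> grows, so this factor decays at almost every
        point.\<close>
      have "(\<lambda>n. ?L n c x ^ 2) \<longlonglongrightarrow> 0"
      proof (rule tendsto_sandwich[OF _ _ tendsto_const])
        show "(\<lambda>n. ?s c x * (1 / kdim d n)) \<longlonglongrightarrow> 0"
          using tendsto_mult[OF tendsto_const inverse_kdim_tendsto[OF d_ge_2]] by simp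
        show "\<forall>\<^sub>F n in sequentially. ?L n c x ^ 2 \<le> ?s c x * (1 / kdim d n)"
        proof (rule always_eventually, rule allI)
          fix n
          show "?L n c x ^ 2 \<le> ?s c x * (1 / kdim d n)"
            using square[of x c n] elim ac kdim_pos[OF d_ge_2, of n] by (simp add: field_simps)
        qed
      qed auto
      then have "(\<lambda>n. sqrt (?L n c x ^ 2)) \<longlonglongrightarrow> sqrt 0" by (rule tendsto_real_sqrt)
      then have L: "(\<lambda>n. ?L n c x) \<longlonglongrightarrow> 0" by simp
      show ?case
      proof (rule tendsto_rabs_zero_cancel, rule tendsto_sandwich[OF _ _ tendsto_const])
        show "(\<lambda>n. ?G x * ?L n c x) \<longlonglongrightarrow> 0" using tendsto_mult[OF tendsto_const L] by simp
        show "\<forall>\<^sub>F n in sequentially. \<bar>?F n x\<bar> \<le> ?G x * ?L n c x"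
          using elim by (intro always_eventually allI bound) auto
      qed auto
    qed
  qed simp
  then show ?thesis using integrable_perm[OF p] by (simp add: perm_integral_def)
qed

end

section \<open>Assembly of the expansion\<close>

theorem theorem1:
  fixes f :: "(nat \<Rightarrow> real^'n) \<Rightarrow> real" and k :: nat
  assumes dim: "CARD('n) \<ge> 3"
    and k: "k \<ge> 1"
    and meas: "f \<in> borel_measurable (PiM {..<k} (\<lambda>_. sph_measure))"
    and bdd: "\<exists>B. \<forall>x\<in>space (PiM {..<k} (\<lambda>_. sph_measure)). \<bar>f x\<bar> \<le> B"
  defines "d \<equiv> CARD('n) - 1"
  shows "(\<lambda>n. ELn k n f
           - ((kdim d n / s_area d) ^ k * (\<integral>x. f x \<partial>(PiM {..<k} (\<lambda>_. sph_measure)))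
              - kdim d n ^ (k - 1) / s_area d ^ k
                * (\<Sum>(i, j) \<in> {(i, j). i < j \<and> j < k}.
                     2 ^ (d - 1) / (Gamma (real d) * pi) * Gamma (real d / 2) ^ 2
                     * (\<integral>x. (\<integral>y. margin k f i j x y / sin (arccos (x \<bullet> y)) ^ (d - 1)
                                 \<partial>sph_measure) \<partial>sph_measure))))
         \<in> o(\<lambda>n. real n ^ ((d - 1) * (k - 1)))"
proof -
  obtain B where B: "\<And>x. x \<in> space (PiM {..<k} (\<lambda>_. sph_measure)) \<Longrightarrow> \<bar>f x\<bar> \<le> B"
    using bdd by blast
  interpret bounded_statistic f k B d
    using dim meas B by unfold_locales (auto simp: d_def)
  have d2: "d \<ge> 2" using dim by (simp add: d_def)
  let ?P = "{(i, j). i < j \<and> j < k}"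
  let ?t = "Transposition.transpose :: nat \<Rightarrow> nat \<Rightarrow> nat \<Rightarrow> nat"
  define Q where "Q = (\<lambda>i j. 2 ^ (d - 1) / (Gamma (real d) * pi) * Gamma (real d / 2) ^ 2
      * (\<integral>x. (\<integral>y. margin k f i j x y / sin (arccos (x \<bullet> y)) ^ (d - 1) \<partial>sph_measure) \<partial>sph_measure))"
  obtain R where R: "finite R"
    "\<forall>p\<in>R. p permutes {..<k} \<and> p \<noteq> id \<and> (\<forall>i<k. \<forall>j<k. i \<noteq> j \<longrightarrow> p \<noteq> ?t i j)"
    and all_split: "\<forall>g :: (nat \<Rightarrow> nat) \<Rightarrow> real. (\<Sum>p | p permutes {..<k}. g p)
      = g id + (\<Sum>(i, j) \<in> ?P. g (?t i j)) + (\<Sum>p\<in>R. g p)"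
    by (rule sum_permutations_split[of k])
  note split = all_split[rule_format]
  \<comment> \<open>The error after factoring out \<open>kdim d n ^ (k - 1) / s_area d ^ k\<close>;
    it suffices that it tends to 0.\<close>
  define r where "r = (\<lambda>n. (\<Sum>p\<in>R. of_int (sign p) * (kdim d n * perm_integral n p))
      - (\<Sum>(i, j) \<in> ?P. kdim d n * perm_integral n (?t i j) - Q i j))"
  have "r \<longlonglongrightarrow> (\<Sum>p\<in>R. of_int (sign p) * 0) - (\<Sum>(i, j) \<in> ?P. 0)"
    unfolding r_def
  proof (intro tendsto_diff tendsto_sum tendsto_mult tendsto_const)
    fix p assume "p \<in> R"
    then show "(\<lambda>n. kdim d n * perm_integral n p) \<longlonglongrightarrow> 0"
      using R by (intro other_limit) auto
  next
    fix q assume "q \<in> ?P"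
    then obtain i j where q: "q = (i, j)" "i < j" "j < k" by auto
    have "(\<lambda>n. kdim d n * perm_integral n (?t i j)) \<longlonglongrightarrow> Q i j"
      using transposition_limit[of i j] q unfolding Q_def legendre_const_def by simp
    then show "(\<lambda>n. case q of (i, j) \<Rightarrow> kdim d n * perm_integral n (?t i j) - Q i j) \<longlonglongrightarrow> (case q of (i, j) \<Rightarrow> 0)"
      using q by (simp add: LIM_zero)
  qed
  then have r: "r \<longlonglongrightarrow> 0" by (simp add: split_beta')
  have eq: "ELn k n f - ((kdim d n / s_area d) ^ k * (\<integral>x. f x \<partial>M) - kdim d n ^ (k - 1) / s_area d ^ k * (\<Sum>(i, j) \<in> ?P. Q i j))
      = kdim d n ^ (k - 1) / s_area d ^ k * r n" for n
  proof -
    define c where "c = kdim d n ^ (k - 1) / s_area d ^ k"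
    \<comment> \<open>Since \<open>k \<ge> 1\<close>, one factor \<open>kdim d n\<close> can be
      split off to scale the integrals.\<close>
    have c: "(kdim d n / s_area d) ^ k = c * kdim d n"
      using k by (cases k) (auto simp: c_def power_divide)
    \<comment> \<open>Transpositions are odd, whence the minus sign of the second term.\<close>
    have sgn: "(\<Sum>(i, j) \<in> ?P. of_int (sign (?t i j)) * perm_integral n (?t i j))
       = - (\<Sum>(i, j) \<in> ?P. perm_integral n (?t i j))"
      unfolding sum_negf[symmetric] by (intro sum.cong) (auto simp: sign_swap_id)
    have e1: "ELn k n f = c * kdim d n * ((\<integral>x. f x \<partial>M) - (\<Sum>(i, j) \<in> ?P. perm_integral n (?t i j))
         + (\<Sum>p\<in>R. of_int (sign p) * perm_integral n p))"
      unfolding ELn_eq c split sgn by (simp add: perm_integral_id)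
    have e2: "r n = kdim d n * (\<Sum>p\<in>R. of_int (sign p) * perm_integral n p)
        - (kdim d n * (\<Sum>(i, j) \<in> ?P. perm_integral n (?t i j)) - (\<Sum>(i, j) \<in> ?P. Q i j))"
      unfolding r_def by (simp add: split_beta' sum_distrib_left sum_subtractf mult_ac)
    show ?thesis unfolding c c_def[symmetric] e1 e2 by algebra
  qed
  \<comment> \<open>The comparison scale is a power of \<open>n\<close> itself, so the shift in
    \<open>kdim_tendsto\<close> is 0.\<close>
  have "(\<lambda>n. (kdim d n / (real n + 0)^(d-1))^(k-1) / s_area d ^ k * r n) \<longlonglongrightarrow> (2 / Gamma (real d))^(k-1) / s_area d ^ k * 0"
    unfolding divide_inverse[of _ "s_area d ^ k"]
    by (intro tendsto_mult tendsto_power kdim_tendsto[OF d2] tendsto_const r)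
  then have lim: "(\<lambda>n. (kdim d n ^ (k - 1) / s_area d ^ k * r n) / real n ^ ((d - 1) * (k - 1))) \<longlonglongrightarrow> 0"
    by (simp add: power_divide power_mult mult_ac)
  show ?thesis
    unfolding Q_def[symmetric] eq
  proof (rule smalloI_tendsto[OF lim])
    show "\<forall>\<^sub>F n in sequentially. real n ^ ((d - 1) * (k - 1)) \<noteq> 0"
      by (rule eventually_mono[OF eventually_gt_at_top[of 0]]) simp
  qed
qed

end
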